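(* Let $T$ be a dependent theory, $A$ a set, and $\varphi(x,y)$ a formula. Any instance of dividing over $A$ witnessed by a sequence $I$ such that $\mathrm{tp}(I/A)$ does not fork over $A$ can be witnessed by a Morley sequence: if $I=(a_i)_{i<\omega}$ is an $A$-indiscernible sequence, $\{\varphi(x,a_i)\}_{i<\omega}$ is inconsistent, and $\mathrm{tp}(I/A)$ does not fork over $A$, then there is a Morley sequence $(a^i)_{i<\omega}$ over $A$ with $a^0=a_0$ and $\{\varphi(x,a^i)\}_{i<\omega}$ inconsistent. Moreover, let $b$ be a tuple and let $I=(a_i)_{i<\omega}$ be indiscernible over $Ab$ such that $\{\varphi(x,a_i)\}_{i<\omega}$ is $k$-inconsistent for some $k$ and $\mathrm{tp}(I/Ab)$ does not fork over $A$. Then there is a Morley sequence $(a^i)_{i<\omega}$ over $Ab$ based on $A$ such that $a^0=a_0$ and $\{\varphi(x,a^i)\}_{i<\omega}$ is inconsistent.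
   Context: $T$ is a complete first-order theory with $T=T^{eq}$, dependent (no formula has the independence property, NIP); everything takes place in a monster model; sets are small. Forking and dividing are in the usual (Shelah) sense. For $A\subseteq B$, a Morley sequence over $B$ based on $A$ is a $B$-indiscernible sequence $(c_i)_{i<\omega}$ such that $\mathrm{tp}(c_i/Bc_{<i})$ does not fork over $A$ for every $i$; a Morley sequence over $A$ means a Morley sequence over $A$ based on $A$. *)

theory Defs
  imports Main "HOL-Library.Nat_Bijection"
begin

unbundle cardinal_syntax

section \<open>Many-sorted first-order logic\<close>

text \<open>
  The sorts, function symbols and relation symbols of a language are the elements of the types
  \<open>'s\<close>, \<open>'f\<close>, \<open>'r\<close>. The \<open>n\<close>-th variable of sort \<open>s\<close> is \<open>(s, n)\<close>. Elements \<open>m :: 'm\<close> of a structure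
  occur in formulas as constants \<open>Par m\<close>; a formula of the language proper is one without such
  parameters.
\<close>

type_synonym 's var = "'s \<times> nat"

datatype ('s, 'f, 'm) trm =
    Var "'s var"
  | Par 'm
  | Fn 'f "('s, 'f, 'm) trm list"

datatype ('s, 'f, 'r, 'm) fm =
    Eq "('s, 'f, 'm) trm" "('s, 'f, 'm) trm"
  | Rel 'r "('s, 'f, 'm) trm list"
  | Neg "('s, 'f, 'r, 'm) fm"
  | Conj "('s, 'f, 'r, 'm) fm" "('s, 'f, 'r, 'm) fm"
  | Ex "'s var" "('s, 'f, 'r, 'm) fm"

record ('s, 'f, 'r) lang =
  fdom :: "'f \<Rightarrow> 's list"
  fcod :: "'f \<Rightarrow> 's"
  rdom :: "'r \<Rightarrow> 's list"

text \<open>A structure carries its language. Each element has exactly one sort, i.e. the carriers of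
  different sorts are disjoint.\<close>

record ('s, 'f, 'r, 'm) struct = "('s, 'f, 'r) lang" +
  univ :: "'m set"
  srt :: "'m \<Rightarrow> 's"
  fint :: "'f \<Rightarrow> 'm list \<Rightarrow> 'm"
  rint :: "'r \<Rightarrow> 'm list \<Rightarrow> bool"

definition is_structure :: "('s, 'f, 'r, 'm) struct \<Rightarrow> bool" where
  "is_structure M \<longleftrightarrow>
     (\<forall>s. \<exists>m\<in>univ M. srt M m = s) \<and>
     (\<forall>f ms. set ms \<subseteq> univ M \<and> map (srt M) ms = fdom M f \<longrightarrow>
        fint M f ms \<in> univ M \<and> srt M (fint M f ms) = fcod M f)"

fun tm_vars :: "('s, 'f, 'm) trm \<Rightarrow> 's var set" where
  "tm_vars (Var x) = {x}"
| "tm_vars (Par m) = {}"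
| "tm_vars (Fn f ts) = (\<Union>t\<in>set ts. tm_vars t)"

fun tm_params :: "('s, 'f, 'm) trm \<Rightarrow> 'm set" where
  "tm_params (Var x) = {}"
| "tm_params (Par m) = {m}"
| "tm_params (Fn f ts) = (\<Union>t\<in>set ts. tm_params t)"

fun tm_sort :: "('s, 'f, 'r, 'm) struct \<Rightarrow> ('s, 'f, 'm) trm \<Rightarrow> 's" where
  "tm_sort M (Var x) = fst x"
| "tm_sort M (Par m) = srt M m"
| "tm_sort M (Fn f ts) = fcod M f"

fun tm_ok :: "('s, 'f, 'r, 'm) struct \<Rightarrow> ('s, 'f, 'm) trm \<Rightarrow> bool" where
  "tm_ok M (Var x) \<longleftrightarrow> True"
| "tm_ok M (Par m) \<longleftrightarrow> m \<in> univ M"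
| "tm_ok M (Fn f ts) \<longleftrightarrow> (\<forall>t\<in>set ts. tm_ok M t) \<and> map (tm_sort M) ts = fdom M f"

fun tm_val :: "('s, 'f, 'r, 'm) struct \<Rightarrow> ('s var \<Rightarrow> 'm) \<Rightarrow> ('s, 'f, 'm) trm \<Rightarrow> 'm" where
  "tm_val M e (Var x) = e x"
| "tm_val M e (Par m) = m"
| "tm_val M e (Fn f ts) = fint M f (map (tm_val M e) ts)"

fun tm_subst :: "('s var \<Rightarrow> 'm option) \<Rightarrow> ('s, 'f, 'm) trm \<Rightarrow> ('s, 'f, 'm) trm" where
  "tm_subst \<sigma> (Var x) = (case \<sigma> x of None \<Rightarrow> Var x | Some m \<Rightarrow> Par m)"
| "tm_subst \<sigma> (Par m) = Par m"
| "tm_subst \<sigma> (Fn f ts) = Fn f (map (tm_subst \<sigma>) ts)"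

fun fv :: "('s, 'f, 'r, 'm) fm \<Rightarrow> 's var set" where
  "fv (Eq t u) = tm_vars t \<union> tm_vars u"
| "fv (Rel r ts) = (\<Union>t\<in>set ts. tm_vars t)"
| "fv (Neg \<phi>) = fv \<phi>"
| "fv (Conj \<phi> \<psi>) = fv \<phi> \<union> fv \<psi>"
| "fv (Ex x \<phi>) = fv \<phi> - {x}"

fun params :: "('s, 'f, 'r, 'm) fm \<Rightarrow> 'm set" where
  "params (Eq t u) = tm_params t \<union> tm_params u"
| "params (Rel r ts) = (\<Union>t\<in>set ts. tm_params t)"
| "params (Neg \<phi>) = params \<phi>"
| "params (Conj \<phi> \<psi>) = params \<phi> \<union> params \<psi>"
| "params (Ex x \<phi>) = params \<phi>"

fun fm_ok :: "('s, 'f, 'r, 'm) struct \<Rightarrow> ('s, 'f, 'r, 'm) fm \<Rightarrow> bool" where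
  "fm_ok M (Eq t u) \<longleftrightarrow> tm_ok M t \<and> tm_ok M u \<and> tm_sort M t = tm_sort M u"
| "fm_ok M (Rel r ts) \<longleftrightarrow> (\<forall>t\<in>set ts. tm_ok M t) \<and> map (tm_sort M) ts = rdom M r"
| "fm_ok M (Neg \<phi>) \<longleftrightarrow> fm_ok M \<phi>"
| "fm_ok M (Conj \<phi> \<psi>) \<longleftrightarrow> fm_ok M \<phi> \<and> fm_ok M \<psi>"
| "fm_ok M (Ex x \<phi>) \<longleftrightarrow> fm_ok M \<phi>"

fun sat :: "('s, 'f, 'r, 'm) struct \<Rightarrow> ('s var \<Rightarrow> 'm) \<Rightarrow> ('s, 'f, 'r, 'm) fm \<Rightarrow> bool" where
  "sat M e (Eq t u) \<longleftrightarrow> tm_val M e t = tm_val M e u"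
| "sat M e (Rel r ts) \<longleftrightarrow> rint M r (map (tm_val M e) ts)"
| "sat M e (Neg \<phi>) \<longleftrightarrow> \<not> sat M e \<phi>"
| "sat M e (Conj \<phi> \<psi>) \<longleftrightarrow> sat M e \<phi> \<and> sat M e \<psi>"
| "sat M e (Ex x \<phi>) \<longleftrightarrow> (\<exists>m\<in>univ M. srt M m = fst x \<and> sat M (e(x := m)) \<phi>)"

fun subst :: "('s var \<Rightarrow> 'm option) \<Rightarrow> ('s, 'f, 'r, 'm) fm \<Rightarrow> ('s, 'f, 'r, 'm) fm" where
  "subst \<sigma> (Eq t u) = Eq (tm_subst \<sigma> t) (tm_subst \<sigma> u)"
| "subst \<sigma> (Rel r ts) = Rel r (map (tm_subst \<sigma>) ts)"
| "subst \<sigma> (Neg \<phi>) = Neg (subst \<sigma> \<phi>)"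
| "subst \<sigma> (Conj \<phi> \<psi>) = Conj (subst \<sigma> \<phi>) (subst \<sigma> \<psi>)"
| "subst \<sigma> (Ex x \<phi>) = Ex x (subst (\<sigma>(x := None)) \<phi>)"

text \<open>The formulas over \<open>B\<close> whose free variables lie in \<open>X\<close>. The formulas of the language itself are
  those over \<open>{}\<close>; whether a formula is one of them depends only on the language of \<open>M\<close>.\<close>

definition Fml :: "('s, 'f, 'r, 'm) struct \<Rightarrow> 's var set \<Rightarrow> 'm set \<Rightarrow> ('s, 'f, 'r, 'm) fm set" where
  "Fml M X B = {\<phi>. fm_ok M \<phi> \<and> fv \<phi> \<subseteq> X \<and> params \<phi> \<subseteq> B}"

definition asg :: "('s, 'f, 'r, 'm) struct \<Rightarrow> ('s var \<Rightarrow> 'm) \<Rightarrow> bool" where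
  "asg M e \<longleftrightarrow> (\<forall>x. e x \<in> univ M \<and> srt M (e x) = fst x)"

text \<open>\<open>tuples M ys\<close> is the set of tuples that can be substituted for \<open>ys\<close>, and \<open>inst ys a \<phi>\<close> is the
  instance \<open>\<phi>(x, a)\<close> of \<open>\<phi>(x, ys)\<close>.\<close>

definition tuples :: "('s, 'f, 'r, 'm) struct \<Rightarrow> 's var list \<Rightarrow> 'm list set" where
  "tuples M ys = {a. set a \<subseteq> univ M \<and> map (srt M) a = map fst ys}"

definition inst :: "'s var list \<Rightarrow> 'm list \<Rightarrow> ('s, 'f, 'r, 'm) fm \<Rightarrow> ('s, 'f, 'r, 'm) fm" where
  "inst ys a \<phi> = subst (map_of (zip ys a)) \<phi>"

text \<open>\<open>holds M \<phi> zs d\<close> is \<open>M \<Turnstile> \<phi>(d)\<close> for \<open>\<phi> = \<phi>(zs)\<close>; values of other variables are irrelevant.\<close>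

definition holds ::
  "('s, 'f, 'r, 'm) struct \<Rightarrow> ('s, 'f, 'r, 'm) fm \<Rightarrow> 's var list \<Rightarrow> 'm list \<Rightarrow> bool" where
  "holds M \<phi> zs d \<longleftrightarrow> sat M (\<lambda>z. the (map_of (zip zs d) z)) \<phi>"

section \<open>Theories and the monster model\<close>

definition complete_theory ::
  "('s, 'f, 'r, 'm) struct \<Rightarrow> ('s, 'f, 'r, 'm) fm set \<Rightarrow> bool" where
  "complete_theory M T \<longleftrightarrow>
     T \<subseteq> Fml M {} {} \<and>
     (\<forall>\<sigma>\<in>Fml M {} {}. \<sigma> \<in> T \<or> Neg \<sigma> \<in> T)"

definition models :: "('s, 'f, 'r, 'm) struct \<Rightarrow> ('s, 'f, 'r, 'm) fm set \<Rightarrow> bool" where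
  "models M T \<longleftrightarrow> is_structure M \<and> (\<forall>\<sigma>\<in>T. \<forall>e. asg M e \<longrightarrow> sat M e \<sigma>)"

text \<open>Consistency is realizability in \<open>M\<close>, as is usual in a monster model; it is only used for
  sets of formulas over small sets and, in the definition of saturation, for finite sets.\<close>

definition consistent :: "('s, 'f, 'r, 'm) struct \<Rightarrow> ('s, 'f, 'r, 'm) fm set \<Rightarrow> bool" where
  "consistent M \<Gamma> \<longleftrightarrow> (\<exists>e. asg M e \<and> (\<forall>\<psi>\<in>\<Gamma>. sat M e \<psi>))"

definition small :: "'k rel \<Rightarrow> 'a set \<Rightarrow> bool" where
  "small \<kappa> A \<longleftrightarrow> |A| <o \<kappa>"

definition saturated :: "'k rel \<Rightarrow> ('s, 'f, 'r, 'm) struct \<Rightarrow> bool" where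
  "saturated \<kappa> M \<longleftrightarrow>
     (\<forall>A x. \<forall>p \<subseteq> Fml M {x} A.
        A \<subseteq> univ M \<and> small \<kappa> A \<and> (\<forall>p0 \<subseteq> p. finite p0 \<longrightarrow> consistent M p0) \<longrightarrow> consistent M p)"

text \<open>The variables of the type of a tuple \<open>c = (c j | j \<in> J)\<close>, possibly infinite, are \<open>x\<^sub>j\<close> (\<open>j \<in> J\<close>),
  where \<open>x\<^sub>j\<close> is the \<open>j\<close>-th variable of the sort of \<open>c j\<close>. Hence two tuples of the same type agree
  in their index sets and sorts (look at the formulas \<open>x\<^sub>j = x\<^sub>j\<close>).\<close>

definition tvars :: "('s, 'f, 'r, 'm) struct \<Rightarrow> nat set \<Rightarrow> (nat \<Rightarrow> 'm) \<Rightarrow> 's var set" where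
  "tvars M J c = {(srt M (c j), j) | j. j \<in> J}"

definition tp ::
  "('s, 'f, 'r, 'm) struct \<Rightarrow> nat set \<Rightarrow> (nat \<Rightarrow> 'm) \<Rightarrow> 'm set \<Rightarrow> ('s, 'f, 'r, 'm) fm set" where
  "tp M J c B = {\<phi> \<in> Fml M (tvars M J c) B. sat M (\<lambda>(s, j). c j) \<phi>}"

definition ltp ::
  "('s, 'f, 'r, 'm) struct \<Rightarrow> 'm list \<Rightarrow> 'm set \<Rightarrow> ('s, 'f, 'r, 'm) fm set" where
  "ltp M c B = tp M {..<length c} (\<lambda>j. c ! j) B"

definition automorphism :: "('s, 'f, 'r, 'm) struct \<Rightarrow> ('m \<Rightarrow> 'm) \<Rightarrow> bool" where
  "automorphism M g \<longleftrightarrow>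
     bij_betw g (univ M) (univ M) \<and>
     (\<forall>m\<in>univ M. srt M (g m) = srt M m) \<and>
     (\<forall>f ms. set ms \<subseteq> univ M \<and> map (srt M) ms = fdom M f \<longrightarrow>
        g (fint M f ms) = fint M f (map g ms)) \<and>
     (\<forall>r ms. set ms \<subseteq> univ M \<and> map (srt M) ms = rdom M r \<longrightarrow>
        (rint M r (map g ms) \<longleftrightarrow> rint M r ms))"

definition strongly_homogeneous :: "'k rel \<Rightarrow> ('s, 'f, 'r, 'm) struct \<Rightarrow> bool" where
  "strongly_homogeneous \<kappa> M \<longleftrightarrow>
     (\<forall>A h. A \<subseteq> univ M \<and> small \<kappa> A \<and> h ` A \<subseteq> univ M \<and>
        (\<forall>c. set c \<subseteq> A \<longrightarrow> ltp M (map h c) {} = ltp M c {}) \<longrightarrow>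
        (\<exists>g. automorphism M g \<and> (\<forall>a\<in>A. g a = h a)))"

text \<open>The cardinality of the language, i.e. the number of its formulas, is below \<open>\<kappa>\<close>; in particular
  \<open>\<kappa>\<close> is uncountable.\<close>

definition monster_model ::
  "'k rel \<Rightarrow> ('s, 'f, 'r, 'm) struct \<Rightarrow> ('s, 'f, 'r, 'm) fm set \<Rightarrow> bool" where
  "monster_model \<kappa> M T \<longleftrightarrow>
     Card_order \<kappa> \<and> small \<kappa> (Fml M UNIV {}) \<and>
     models M T \<and> saturated \<kappa> M \<and> strongly_homogeneous \<kappa> M"

text \<open>\<open>T = T\<^sup>e\<^sup>q\<close>: every quotient of a finite product of sorts by a definable (without parameters)
  equivalence relation \<open>E\<close> is a sort. That is, some formula \<open>G(x, z)\<close> defines the graph of a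
  surjection \<open>q\<close> onto the sort of \<open>z\<close> with \<open>q a = q b\<close> iff \<open>E(a, b)\<close>. As \<open>T\<close> is complete, this can be
  said in its monster model.\<close>

definition eq_closed :: "('s, 'f, 'r, 'm) struct \<Rightarrow> bool" where
  "eq_closed M \<longleftrightarrow>
     (\<forall>E xs ys.
        distinct (xs @ ys) \<and> map fst xs = map fst ys \<and> E \<in> Fml M (set xs \<union> set ys) {} \<and>
        equiv (tuples M xs)
          {(a, b). a \<in> tuples M xs \<and> b \<in> tuples M xs \<and> holds M E (xs @ ys) (a @ b)} \<longrightarrow>
        (\<exists>G z q.
           z \<notin> set xs \<and> G \<in> Fml M (insert z (set xs)) {} \<and>
           q ` tuples M xs = {m \<in> univ M. srt M m = fst z} \<and>
           (\<forall>a\<in>tuples M xs. \<forall>m\<in>univ M. srt M m = fst z \<longrightarrow>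
              (holds M G (xs @ [z]) (a @ [m]) \<longleftrightarrow> q a = m)) \<and>
           (\<forall>a\<in>tuples M xs. \<forall>b\<in>tuples M xs.
              q a = q b \<longleftrightarrow> holds M E (xs @ ys) (a @ b))))"

definition independence_property ::
  "('s, 'f, 'r, 'm) struct \<Rightarrow> ('s, 'f, 'r, 'm) fm \<Rightarrow> 's var list \<Rightarrow> 's var list \<Rightarrow> bool" where
  "independence_property M \<phi> xs ys \<longleftrightarrow>
     (\<exists>(a :: nat \<Rightarrow> 'm list) (b :: nat set \<Rightarrow> 'm list).
        (\<forall>i. a i \<in> tuples M xs) \<and> (\<forall>S. b S \<in> tuples M ys) \<and>
        (\<forall>i S. holds M \<phi> (xs @ ys) (a i @ b S) \<longleftrightarrow> i \<in> S))"

definition dependent :: "('s, 'f, 'r, 'm) struct \<Rightarrow> bool" where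
  "dependent M \<longleftrightarrow>
     (\<forall>\<phi> xs ys. distinct (xs @ ys) \<and> \<phi> \<in> Fml M (set xs \<union> set ys) {} \<longrightarrow>
        \<not> independence_property M \<phi> xs ys)"

section \<open>Dividing, forking, Morley sequences\<close>

definition indiscernible ::
  "('s, 'f, 'r, 'm) struct \<Rightarrow> 'm set \<Rightarrow> (nat \<Rightarrow> 'm list) \<Rightarrow> bool" where
  "indiscernible M B c \<longleftrightarrow>
     (\<forall>i. set (c i) \<subseteq> univ M) \<and>
     (\<forall>is js. length is = length js \<and> sorted_wrt (<) is \<and> sorted_wrt (<) js \<longrightarrow>
        ltp M (concat (map c is)) B = ltp M (concat (map c js)) B)"

definition k_inconsistent ::
  "('s, 'f, 'r, 'm) struct \<Rightarrow> nat \<Rightarrow> (nat \<Rightarrow> ('s, 'f, 'r, 'm) fm) \<Rightarrow> bool" where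
  "k_inconsistent M k \<psi> \<longleftrightarrow> (\<forall>S. finite S \<and> card S = k \<longrightarrow> \<not> consistent M (\<psi> ` S))"

text \<open>\<open>\<chi> = \<phi>(x, c)\<close> divides over \<open>A\<close>, where \<open>\<phi>(x, ys)\<close> has no parameters.\<close>

definition divides ::
  "('s, 'f, 'r, 'm) struct \<Rightarrow> 'm set \<Rightarrow> ('s, 'f, 'r, 'm) fm \<Rightarrow> bool" where
  "divides M A \<chi> \<longleftrightarrow>
     (\<exists>\<phi> ys c. \<phi> \<in> Fml M UNIV {} \<and> distinct ys \<and> c \<in> tuples M ys \<and> \<chi> = inst ys c \<phi> \<and>
        (\<exists>k d. (\<forall>i. d i \<in> tuples M ys \<and> ltp M (d i) A = ltp M c A) \<and>
           k_inconsistent M k (\<lambda>i. inst ys (d i) \<phi>)))"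

text \<open>A partial type \<open>\<pi>\<close> in the variables \<open>X\<close> forks over \<open>A\<close> if it implies a finite disjunction of
  formulas in these variables each of which divides over \<open>A\<close>.\<close>

definition forks ::
  "('s, 'f, 'r, 'm) struct \<Rightarrow> 'm set \<Rightarrow> 's var set \<Rightarrow> ('s, 'f, 'r, 'm) fm set \<Rightarrow> bool" where
  "forks M A X \<pi> \<longleftrightarrow>
     (\<exists>\<Delta>. finite \<Delta> \<and> \<Delta> \<subseteq> Fml M X (univ M) \<and> (\<forall>\<chi>\<in>\<Delta>. divides M A \<chi>) \<and>
        (\<forall>e. asg M e \<and> (\<forall>\<psi>\<in>\<pi>. sat M e \<psi>) \<longrightarrow> (\<exists>\<chi>\<in>\<Delta>. sat M e \<chi>)))"

definition tp_forks ::
  "('s, 'f, 'r, 'm) struct \<Rightarrow> 'm set \<Rightarrow> nat set \<Rightarrow> (nat \<Rightarrow> 'm) \<Rightarrow> 'm set \<Rightarrow> bool" where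
  "tp_forks M A J c B \<longleftrightarrow> forks M A (tvars M J c) (tp M J c B)"

definition ltp_forks ::
  "('s, 'f, 'r, 'm) struct \<Rightarrow> 'm set \<Rightarrow> 'm list \<Rightarrow> 'm set \<Rightarrow> bool" where
  "ltp_forks M A c B \<longleftrightarrow> tp_forks M A {..<length c} (\<lambda>j. c ! j) B"

text \<open>A sequence \<open>I = (a i | i < \<omega>)\<close> of finite tuples as one infinite tuple: the \<open>j\<close>-th entry of
  \<open>a i\<close> gets the index \<open>prod_encode (i, j)\<close>.\<close>

definition seq_tp_forks ::
  "('s, 'f, 'r, 'm) struct \<Rightarrow> 'm set \<Rightarrow> (nat \<Rightarrow> 'm list) \<Rightarrow> 'm set \<Rightarrow> bool" where
  "seq_tp_forks M A a B \<longleftrightarrow>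
     tp_forks M A {prod_encode (i, j) | i j. j < length (a i)}
       (\<lambda>n. case prod_decode n of (i, j) \<Rightarrow> a i ! j) B"

definition morley_sequence ::
  "('s, 'f, 'r, 'm) struct \<Rightarrow> 'm set \<Rightarrow> 'm set \<Rightarrow> (nat \<Rightarrow> 'm list) \<Rightarrow> bool" where
  "morley_sequence M B A c \<longleftrightarrow>
     A \<subseteq> B \<and> indiscernible M B c \<and>
     (\<forall>i. \<not> ltp_forks M A (c i) (B \<union> (\<Union>j<i. set (c j))))"

end

theory Submission
  imports Defs
begin

text \<open>
  Let \<open>B\<close> be the set over which the given sequence \<open>I\<close> is indiscernible. By compactness and
  indiscernibility the instances of \<open>\<phi>\<close> along \<open>I\<close> are \<open>k\<close>-inconsistent for some \<open>k\<close>. Since \<open>tp(I/B)\<close> does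
  not fork over \<open>A\<close>, it extends to a global type, in infinitely many variables, that contains no
  formula dividing over \<open>A\<close>. Let \<open>W\<close> be a limit, along an ultrafilter on \<open>\<omega>\<close>, of the restrictions of
  this type to the single members of \<open>I\<close> (\<open>limit_type_exists\<close>). It is a global type of a single tuple,
  extends \<open>tp(a\<^sub>0/B)\<close>, contains no formula dividing over \<open>A\<close>, and each of its formulas is satisfied by \<open>k\<close>
  tuples \<open>h\<^sub>1, \<dots>, h\<^sub>k\<close> for which \<open>\<phi>(x, h\<^sub>1) \<and> \<dots> \<and> \<phi>(x, h\<^sub>k)\<close> is inconsistent.

  Dependence enters twice, both times because a formula can only alternate boundedly often along an
  indiscernible sequence (\<open>bounded_alternation\<close>). First, it makes \<open>W\<close> invariant over every small model
  \<open>N\<close> containing \<open>A\<close> (\<open>nondividing_invariant\<close>): \<open>W\<close> cannot contain \<open>R(x, g\<^sub>0) \<and> \<not> R(x, g\<^sub>1)\<close> for a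
  sequence \<open>g\<close> indiscernible over \<open>A\<close>, as this formula divides over \<open>A\<close>, and tuples of the same type
  over \<open>N\<close> are joined by such sequences, made of realizations of a coheir (\<open>coheir_exists\<close>).
  By invariance any two sequences of successive realizations of \<open>W\<close>
  over \<open>N\<close> have the same type over \<open>N\<close>; in particular such sequences are indiscernible over \<open>N\<close>
  (\<open>morley_seq_indiscernible\<close>).

  Secondly, take a small model \<open>N\<close> containing \<open>B\<close> and choose successively \<open>k\<close>-tuples \<open>H\<^sub>0, H\<^sub>1, \<dots>\<close> of
  realizations of \<open>W\<close> over \<open>N\<close> and all the previous ones, each \<open>H\<^sub>n\<close> being inconsistent for \<open>\<phi>\<close>. Every
  choice of one element from each \<open>H\<^sub>n\<close> is a sequence of successive realizations of \<open>W\<close>. Let \<open>c\<^sub>n\<close> be the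
  first element of \<open>H\<^sub>n\<close>. If some \<open>b\<close> satisfied all \<open>\<phi>(x, c\<^sub>n)\<close>, one could replace \<open>c\<^sub>n\<close>, for odd \<open>n\<close>, by
  an element \<open>h\<close> of \<open>H\<^sub>n\<close> for which \<open>\<phi>(b, h)\<close> fails, and \<open>\<phi>(b, -)\<close> would alternate infinitely often along an
  indiscernible sequence. So \<open>{\<phi>(x, c\<^sub>n)}\<close> is inconsistent, and an automorphism over \<open>B\<close> that moves
  \<open>c\<^sub>0\<close> to \<open>a\<^sub>0\<close> gives the sequence wanted (\<open>morley_sequence_exists\<close>).

  In the formalization, definable sets are predicates on lists of elements and global types are
  ultrafilters on the set of such lists. Everything takes place inside the monster model, and the limit
  above becomes a limit of ultrafilters.
\<close>

section \<open>Ultrafilters\<close>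

definition ultra :: "'a filter \<Rightarrow> bool" where
  "ultra U \<longleftrightarrow> U \<noteq> bot \<and> (\<forall>P. eventually P U \<or> eventually (\<lambda>x. \<not> P x) U)"

lemma ultra_not:
  assumes "ultra U"
  shows "eventually (\<lambda>x. \<not> P x) U \<longleftrightarrow> \<not> eventually P U"
proof
  assume "eventually (\<lambda>x. \<not> P x) U"
  show "\<not> eventually P U"
  proof
    assume "eventually P U"
    with \<open>eventually (\<lambda>x. \<not> P x) U\<close> have "eventually (\<lambda>x. False) U"
      by eventually_elim auto
    with assms show False by (simp add: ultra_def trivial_limit_def)
  qed
qed (use assms in \<open>auto simp: ultra_def\<close>)

lemma ultra_exists:
  assumes "U \<noteq> bot"
  shows "\<exists>W\<le>U. ultra W"
proof -
  let ?A = "{G. G \<le> U \<and> G \<noteq> bot}"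
  have "\<exists>W\<in>?A. \<forall>G\<in>?A. G \<le> W \<longrightarrow> G = W"
  proof (rule predicate_Zorn[where P = "\<lambda>G H. H \<le> G"])
    show "partial_order_on ?A (relation_of (\<lambda>G H. H \<le> G) ?A)"
      by (rule partial_order_on_relation_ofI) auto
  next
    fix C assume C: "C \<in> Chains (relation_of (\<lambda>G H. H \<le> G) ?A)"
    then have sub: "C \<subseteq> ?A" and lin: "\<And>x y. x \<in> C \<Longrightarrow> y \<in> C \<Longrightarrow> x \<le> y \<or> y \<le> x"
      by (auto simp: Chains_def relation_of_def)
    show "\<exists>u\<in>?A. \<forall>a\<in>C. u \<le> a"
    proof (cases "C = {}")
      case True
      then show ?thesis using assms by auto
    next
      case False
      have "Inf C \<noteq> bot"
      proof
        assume "Inf C = bot"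
        then have "eventually (\<lambda>x. False) (Inf C)" by simp
        then obtain b where "b \<in> C" "eventually (\<lambda>x. False) b"
          using eventually_Inf_base[OF False] lin
          by (metis inf.absorb_iff1 inf.absorb_iff2 order_refl)
        then show False using sub by (auto simp: trivial_limit_def)
      qed
      moreover have "Inf C \<le> U" using False sub by (auto intro: Inf_lower2)
      ultimately show ?thesis by (auto intro: Inf_lower)
    qed
  qed
  then obtain W where W: "W \<le> U" "W \<noteq> bot" and min: "\<And>G. G \<le> W \<Longrightarrow> G \<noteq> bot \<Longrightarrow> G = W"
    by (auto dest: order_trans)
  have "ultra W"
    unfolding ultra_def
  proof (intro conjI allI)
    fix P
    show "eventually P W \<or> eventually (\<lambda>x. \<not> P x) W"
    proof (cases "inf W (principal {x. P x}) = bot")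
      case True
      then have "eventually (\<lambda>x. False) (inf W (principal {x. P x}))" by simp
      then show ?thesis by (simp add: eventually_inf_principal)
    next
      case False
      then have "inf W (principal {x. P x}) = W" by (intro min) auto
      moreover have "eventually P (inf W (principal {x. P x}))"
        by (simp add: eventually_inf_principal)
      ultimately show ?thesis by simp
    qed
  qed (fact W)
  with W show ?thesis by blast
qed

lemma ultra_ex: "ultra U \<Longrightarrow> eventually P U \<Longrightarrow> \<exists>x. P x"
  by (rule eventually_happens') (simp_all add: ultra_def)

lemma ultra_fip:
  assumes "\<And>S0. finite S0 \<Longrightarrow> S0 \<subseteq> S \<Longrightarrow> \<exists>x. \<forall>P\<in>S0. P x"
  shows "\<exists>W. ultra W \<and> (\<forall>P\<in>S. eventually P W)"
proof -
  let ?F = "INF P\<in>S. principal {x. P x}"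
  have "?F \<noteq> bot"
  proof (rule INF_filter_not_bot)
    fix X assume X: "X \<subseteq> S" "finite X"
    with assms obtain x where "\<forall>P\<in>X. P x" by blast
    then show "(INF P\<in>X. principal {x. P x}) \<noteq> bot"
      using X by (auto simp: INF_principal_finite principal_eq_bot_iff)
  qed
  then obtain W where "W \<le> ?F" "ultra W" using ultra_exists by blast
  moreover have "eventually P ?F" if "P \<in> S" for P
    using that by (rule eventually_INF1) (simp add: eventually_principal)
  ultimately show ?thesis by (auto simp: le_filter_def)
qed

lemma ultra_filtermap: "ultra U \<Longrightarrow> ultra (filtermap f U)"
  by (simp add: ultra_def eventually_filtermap filtermap_bot_iff)

section \<open>Substitution\<close>

lemma finite_tm_vars [simp]: "finite (tm_vars t)"
  by (induction t) auto

lemma finite_fv [simp]: "finite (fv \<phi>)"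
  by (induction \<phi>) auto

lemma finite_tm_params [simp]: "finite (tm_params t)"
  by (induction t) auto

lemma finite_params [simp]: "finite (params \<phi>)"
  by (induction \<phi>) auto

lemma tm_val_cong: "(\<And>v. v \<in> tm_vars t \<Longrightarrow> e v = e' v) \<Longrightarrow> tm_val M e t = tm_val M e' t"
proof (induction t)
  case (Fn g ts)
  have "tm_val M e t = tm_val M e' t" if "t \<in> set ts" for t
    using that Fn.prems by (intro Fn.IH) auto
  then have "map (tm_val M e) ts = map (tm_val M e') ts" by simp
  then show ?case by (simp del: map_eq_conv)
qed auto

lemma sat_cong: "(\<And>v. v \<in> fv \<phi> \<Longrightarrow> e v = e' v) \<Longrightarrow> sat M e \<phi> = sat M e' \<phi>"
proof (induction \<phi> arbitrary: e e')
  case (Eq t u)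
  then have "tm_val M e t = tm_val M e' t" "tm_val M e u = tm_val M e' u"
    by (auto intro!: tm_val_cong)
  then show ?case by simp
next
  case (Rel r ts)
  then have "map (tm_val M e) ts = map (tm_val M e') ts"
    by (auto intro!: tm_val_cong)
  then show ?case by (simp del: map_eq_conv)
next
  case (Neg \<phi>)
  show ?case using Neg.IH[of e e'] Neg.prems by auto
next
  case (Conj \<phi> \<psi>)
  show ?case using Conj.IH(1)[of e e'] Conj.IH(2)[of e e'] Conj.prems by auto
next
  case (Ex x \<phi>)
  have "sat M (e(x := m)) \<phi> = sat M (e'(x := m)) \<phi>" for m
    using Ex.prems by (intro Ex.IH) auto
  then show ?case by simp
qed

fun tm_repl ::
  "('s var \<Rightarrow> ('s, 'f, 'm) trm) \<Rightarrow> ('m \<Rightarrow> ('s, 'f, 'm) trm) \<Rightarrow> ('s, 'f, 'm) trm \<Rightarrow> ('s, 'f, 'm) trm" where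
  "tm_repl \<sigma> f (Var x) = \<sigma> x"
| "tm_repl \<sigma> f (Par m) = f m"
| "tm_repl \<sigma> f (Fn g ts) = Fn g (map (tm_repl \<sigma> f) ts)"

lemma tm_vars_repl:
  "tm_vars (tm_repl \<sigma> f t) = (\<Union>v\<in>tm_vars t. tm_vars (\<sigma> v)) \<union> (\<Union>m\<in>tm_params t. tm_vars (f m))"
  by (induction t) auto

lemma tm_params_repl:
  "tm_params (tm_repl \<sigma> f t) =
     (\<Union>v\<in>tm_vars t. tm_params (\<sigma> v)) \<union> (\<Union>m\<in>tm_params t. tm_params (f m))"
  by (induction t) auto

lemma tm_sort_repl:
  "(\<And>v. tm_sort M (\<sigma> v) = fst v) \<Longrightarrow> (\<And>m. m \<in> tm_params t \<Longrightarrow> tm_sort M (f m) = srt M m) \<Longrightarrow>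
   tm_sort M (tm_repl \<sigma> f t) = tm_sort M t"
  by (cases t) auto

lemma tm_ok_repl:
  assumes "\<And>v. tm_ok M (\<sigma> v) \<and> tm_sort M (\<sigma> v) = fst v"
  shows "(\<And>m. m \<in> tm_params t \<Longrightarrow> tm_ok M (f m) \<and> tm_sort M (f m) = srt M m) \<Longrightarrow> tm_ok M t \<Longrightarrow>
   tm_ok M (tm_repl \<sigma> f t)"
proof (induction t)
  case (Fn g ts)
  have "tm_sort M (tm_repl \<sigma> f t) = tm_sort M t" if "t \<in> set ts" for t
    using that assms Fn.prems by (intro tm_sort_repl) auto
  then have "map (tm_sort M) (map (tm_repl \<sigma> f) ts) = map (tm_sort M) ts" by simp
  moreover have "tm_ok M (tm_repl \<sigma> f t)" if "t \<in> set ts" for t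
    using that Fn.prems by (intro Fn.IH) auto
  ultimately show ?case using Fn.prems by (auto simp del: map_map)
qed (use assms in auto)

lemma tm_val_repl:
  "(\<And>m. m \<in> tm_params t \<Longrightarrow> tm_val M e (f m) = m) \<Longrightarrow>
   tm_val M e (tm_repl \<sigma> f t) = tm_val M (\<lambda>v. tm_val M e (\<sigma> v)) t"
proof (induction t)
  case (Fn g ts)
  have "tm_val M e (tm_repl \<sigma> f t) = tm_val M (\<lambda>v. tm_val M e (\<sigma> v)) t" if "t \<in> set ts" for t
    using that Fn.prems by (intro Fn.IH) auto
  then have "map (tm_val M e) (map (tm_repl \<sigma> f) ts) = map (tm_val M (\<lambda>v. tm_val M e (\<sigma> v))) ts"
    by simp
  then show ?case by (simp del: map_eq_conv map_map)
qed auto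

text \<open>Capture is avoided by renaming the bound variable, so the result of a substitution is only
  determined up to bound variables; its existence is all that matters. Parameters may be replaced
  by variables in the same go: this is how a formula over \<open>C\<close> is turned into a parameter-free
  formula applied to a tuple from \<open>C\<close>.\<close>

lemma substitution:
  assumes "fm_ok M \<phi>"
    and "\<And>v. tm_ok M (\<sigma> v) \<and> tm_sort M (\<sigma> v) = fst v"
    and "\<And>m. m \<in> params \<phi> \<Longrightarrow> tm_ok M (f m) \<and> tm_sort M (f m) = srt M m"
  shows "\<exists>\<phi>'. fm_ok M \<phi>' \<and>
     fv \<phi>' \<subseteq> (\<Union>v\<in>fv \<phi>. tm_vars (\<sigma> v)) \<union> (\<Union>m\<in>params \<phi>. tm_vars (f m)) \<and>
     params \<phi>' \<subseteq> (\<Union>v\<in>fv \<phi>. tm_params (\<sigma> v)) \<union> (\<Union>m\<in>params \<phi>. tm_params (f m)) \<and>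
     (\<forall>e. (\<forall>m\<in>params \<phi>. tm_val M e (f m) = m) \<longrightarrow>
        sat M e \<phi>' = sat M (\<lambda>v. tm_val M e (\<sigma> v)) \<phi>)"
  using assms
proof (induction \<phi> arbitrary: \<sigma>)
  case (Eq t u)
  show ?case
  proof (rule exI[of _ "Eq (tm_repl \<sigma> f t) (tm_repl \<sigma> f u)"], intro conjI)
    show "fm_ok M (Eq (tm_repl \<sigma> f t) (tm_repl \<sigma> f u))"
      using Eq by (auto simp: tm_ok_repl tm_sort_repl)
  qed (use Eq in \<open>auto simp: tm_vars_repl tm_params_repl tm_val_repl\<close>)
next
  case (Rel r ts)
  show ?case
  proof (rule exI[of _ "Rel r (map (tm_repl \<sigma> f) ts)"], intro conjI allI impI)
    have "tm_sort M (tm_repl \<sigma> f t) = tm_sort M t" if "t \<in> set ts" for t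
      using that Rel.prems by (intro tm_sort_repl) auto
    then have "map (tm_sort M) (map (tm_repl \<sigma> f) ts) = map (tm_sort M) ts" by simp
    moreover have "tm_ok M (tm_repl \<sigma> f t)" if "t \<in> set ts" for t
      using that Rel.prems by (intro tm_ok_repl) auto
    ultimately show "fm_ok M (Rel r (map (tm_repl \<sigma> f) ts))"
      using Rel.prems by (auto simp del: map_map)
    fix e assume e: "\<forall>m\<in>params (Rel r ts). tm_val M e (f m) = m"
    have "map (tm_val M e \<circ> tm_repl \<sigma> f) ts = map (tm_val M (\<lambda>v. tm_val M e (\<sigma> v))) ts"
      using e by (auto intro!: tm_val_repl)
    then show "sat M e (Rel r (map (tm_repl \<sigma> f) ts)) = sat M (\<lambda>v. tm_val M e (\<sigma> v)) (Rel r ts)"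
      by (simp del: map_eq_conv)
  qed (auto simp: tm_vars_repl tm_params_repl)
next
  case (Neg \<phi>)
  from Neg.IH[of \<sigma>] Neg.prems obtain \<phi>' where "fm_ok M \<phi>' \<and>
     fv \<phi>' \<subseteq> (\<Union>v\<in>fv \<phi>. tm_vars (\<sigma> v)) \<union> (\<Union>m\<in>params \<phi>. tm_vars (f m)) \<and>
     params \<phi>' \<subseteq> (\<Union>v\<in>fv \<phi>. tm_params (\<sigma> v)) \<union> (\<Union>m\<in>params \<phi>. tm_params (f m)) \<and>
     (\<forall>e. (\<forall>m\<in>params \<phi>. tm_val M e (f m) = m) \<longrightarrow>
        sat M e \<phi>' = sat M (\<lambda>v. tm_val M e (\<sigma> v)) \<phi>)" by auto
  then show ?case by (intro exI[of _ "Neg \<phi>'"]) auto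
next
  case (Conj \<phi> \<psi>)
  from Conj.IH(1)[of \<sigma>] Conj.prems obtain \<phi>' where "fm_ok M \<phi>' \<and>
     fv \<phi>' \<subseteq> (\<Union>v\<in>fv \<phi>. tm_vars (\<sigma> v)) \<union> (\<Union>m\<in>params \<phi>. tm_vars (f m)) \<and>
     params \<phi>' \<subseteq> (\<Union>v\<in>fv \<phi>. tm_params (\<sigma> v)) \<union> (\<Union>m\<in>params \<phi>. tm_params (f m)) \<and>
     (\<forall>e. (\<forall>m\<in>params \<phi>. tm_val M e (f m) = m) \<longrightarrow>
        sat M e \<phi>' = sat M (\<lambda>v. tm_val M e (\<sigma> v)) \<phi>)" by auto
  moreover from Conj.IH(2)[of \<sigma>] Conj.prems obtain \<psi>' where "fm_ok M \<psi>' \<and>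
     fv \<psi>' \<subseteq> (\<Union>v\<in>fv \<psi>. tm_vars (\<sigma> v)) \<union> (\<Union>m\<in>params \<psi>. tm_vars (f m)) \<and>
     params \<psi>' \<subseteq> (\<Union>v\<in>fv \<psi>. tm_params (\<sigma> v)) \<union> (\<Union>m\<in>params \<psi>. tm_params (f m)) \<and>
     (\<forall>e. (\<forall>m\<in>params \<psi>. tm_val M e (f m) = m) \<longrightarrow>
        sat M e \<psi>' = sat M (\<lambda>v. tm_val M e (\<sigma> v)) \<psi>)" by auto
  ultimately show ?case by (intro exI[of _ "Conj \<phi>' \<psi>'"]) auto
next
  case (Ex x \<phi>)
  let ?V = "(\<Union>v\<in>fv \<phi>. tm_vars (\<sigma> v)) \<union> (\<Union>m\<in>params \<phi>. tm_vars (f m))"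
  have fin: "finite (snd ` ?V)" by simp
  obtain n where n: "n \<notin> snd ` ?V" using ex_new_if_finite[OF infinite_UNIV_nat fin] by blast
  define y where "y = (fst x, n)"
  have y: "y \<notin> ?V" using n unfolding y_def by force
  let ?\<sigma> = "\<sigma>(x := Var y)"
  have "tm_ok M (?\<sigma> v) \<and> tm_sort M (?\<sigma> v) = fst v" for v
    using Ex.prems(2) by (auto simp: y_def)
  with Ex.IH[of ?\<sigma>] Ex.prems obtain \<phi>' where \<phi>': "fm_ok M \<phi>'"
     "fv \<phi>' \<subseteq> (\<Union>v\<in>fv \<phi>. tm_vars (?\<sigma> v)) \<union> (\<Union>m\<in>params \<phi>. tm_vars (f m))"
     "params \<phi>' \<subseteq> (\<Union>v\<in>fv \<phi>. tm_params (?\<sigma> v)) \<union> (\<Union>m\<in>params \<phi>. tm_params (f m))"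
     and s: "\<And>e. (\<forall>m\<in>params \<phi>. tm_val M e (f m) = m) \<Longrightarrow>
        sat M e \<phi>' = sat M (\<lambda>v. tm_val M e (?\<sigma> v)) \<phi>" by auto
  show ?case
  proof (rule exI[of _ "Ex y \<phi>'"], intro conjI allI impI)
    show "fm_ok M (Ex y \<phi>')" using \<phi>' by simp
    show "fv (Ex y \<phi>') \<subseteq> (\<Union>v\<in>fv (Ex x \<phi>). tm_vars (\<sigma> v)) \<union> (\<Union>m\<in>params (Ex x \<phi>). tm_vars (f m))"
      using \<phi>'(2) by (fastforce split: if_splits)
    show "params (Ex y \<phi>') \<subseteq>
        (\<Union>v\<in>fv (Ex x \<phi>). tm_params (\<sigma> v)) \<union> (\<Union>m\<in>params (Ex x \<phi>). tm_params (f m))"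
      using \<phi>'(3) by (fastforce split: if_splits)
    fix e assume e: "\<forall>m\<in>params (Ex x \<phi>). tm_val M e (f m) = m"
    have "sat M (e(y := a)) \<phi>' = sat M ((\<lambda>v. tm_val M e (\<sigma> v))(x := a)) \<phi>" for a
    proof -
      have "tm_val M (e(y := a)) (f m) = m" if "m \<in> params \<phi>" for m
      proof -
        have "tm_val M (e(y := a)) (f m) = tm_val M e (f m)"
          using y that by (intro tm_val_cong) auto
        then show ?thesis using e that by simp
      qed
      then have "sat M (e(y := a)) \<phi>' = sat M (\<lambda>v. tm_val M (e(y := a)) (?\<sigma> v)) \<phi>"
        by (intro s) auto
      also have "\<dots> = sat M ((\<lambda>v. tm_val M e (\<sigma> v))(x := a)) \<phi>"
      proof (rule sat_cong)
        fix v assume v: "v \<in> fv \<phi>"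
        have "tm_val M (e(y := a)) (\<sigma> v) = tm_val M e (\<sigma> v)"
          using y v by (intro tm_val_cong) auto
        then show "tm_val M (e(y := a)) (?\<sigma> v) = ((\<lambda>v. tm_val M e (\<sigma> v))(x := a)) v" by simp
      qed
      finally show ?thesis .
    qed
    then show "sat M e (Ex y \<phi>') = sat M (\<lambda>v. tm_val M e (\<sigma> v)) (Ex x \<phi>)"
      by (simp add: y_def)
  qed
qed

lemma tm_vars_subst: "tm_vars (tm_subst \<sigma> t) = tm_vars t - dom \<sigma>"
  by (induction t) (auto split: option.splits)

lemma fv_subst: "fv (subst \<sigma> \<phi>) = fv \<phi> - dom \<sigma>"
  by (induction \<phi> arbitrary: \<sigma>) (auto simp: tm_vars_subst)

lemma tm_params_subst: "tm_params (tm_subst \<sigma> t) \<subseteq> tm_params t \<union> ran \<sigma>"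
proof (induction t)
  case (Fn g ts)
  then show ?case by (fastforce simp del: split_paired_Ex)
qed (auto split: option.splits simp: ran_def)

lemma ran_upd_None: "ran (\<sigma>(x := None)) \<subseteq> ran \<sigma>"
  by (auto simp: ran_def)

lemma params_subst: "params (subst \<sigma> \<phi>) \<subseteq> params \<phi> \<union> ran \<sigma>"
proof (induction \<phi> arbitrary: \<sigma>)
  case (Ex x \<phi>)
  have "params (subst (\<sigma>(x := None)) \<phi>) \<subseteq> params \<phi> \<union> ran \<sigma>"
    using Ex[of "\<sigma>(x := None)"] ran_upd_None[of \<sigma> x] by blast
  then show ?case by simp
qed (use tm_params_subst in \<open>fastforce+\<close>)

lemma tm_val_subst:
  "tm_val M e (tm_subst \<sigma> t) = tm_val M (\<lambda>v. case \<sigma> v of None \<Rightarrow> e v | Some m \<Rightarrow> m) t"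
  by (induction t) (auto split: option.splits intro!: arg_cong[where f = "fint M _"])

lemma sat_subst:
  "sat M e (subst \<sigma> \<phi>) = sat M (\<lambda>v. case \<sigma> v of None \<Rightarrow> e v | Some m \<Rightarrow> m) \<phi>"
proof (induction \<phi> arbitrary: e \<sigma>)
  case (Rel r ts)
  have "map (tm_val M e \<circ> tm_subst \<sigma>) ts =
      map (tm_val M (\<lambda>v. case \<sigma> v of None \<Rightarrow> e v | Some m \<Rightarrow> m)) ts"
    by (simp add: tm_val_subst)
  then show ?case by (simp del: map_eq_conv)
next
  case (Ex x \<phi>)
  have "(\<lambda>v. case (\<sigma>(x := None)) v of None \<Rightarrow> (e(x := m)) v | Some m \<Rightarrow> m) =
      (\<lambda>v. case \<sigma> v of None \<Rightarrow> e v | Some m \<Rightarrow> m)(x := m)" for m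
    by (rule ext) (auto split: option.splits)
  then show ?case by (simp add: Ex)
qed (auto simp: tm_val_subst)

lemma tm_sort_subst:
  "(\<And>v m. \<sigma> v = Some m \<Longrightarrow> srt M m = fst v) \<Longrightarrow> tm_sort M (tm_subst \<sigma> t) = tm_sort M t"
  by (cases t) (auto split: option.splits)

lemma tm_ok_subst:
  assumes "\<And>v m. \<sigma> v = Some m \<Longrightarrow> m \<in> univ M \<and> srt M m = fst v"
  shows "tm_ok M t \<Longrightarrow> tm_ok M (tm_subst \<sigma> t)"
proof (induction t)
  case (Fn g ts)
  have "map (tm_sort M) (map (tm_subst \<sigma>) ts) = map (tm_sort M) ts"
    using assms by (simp add: tm_sort_subst)
  then show ?case using Fn by (auto simp del: map_map)
qed (use assms in \<open>auto split: option.splits\<close>)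

lemma fm_ok_subst:
  assumes "\<And>v m. \<sigma> v = Some m \<Longrightarrow> m \<in> univ M \<and> srt M m = fst v"
  shows "fm_ok M \<phi> \<Longrightarrow> fm_ok M (subst \<sigma> \<phi>)"
  using assms
proof (induction \<phi> arbitrary: \<sigma>)
  case (Eq t u)
  then show ?case by (auto simp: tm_sort_subst tm_ok_subst)
next
  case (Rel r ts)
  have "map (tm_sort M) (map (tm_subst \<sigma>) ts) = map (tm_sort M) ts"
    using Rel.prems(2) by (simp add: tm_sort_subst)
  moreover have "tm_ok M (tm_subst \<sigma> t)" if "t \<in> set ts" for t
    using that Rel.prems by (intro tm_ok_subst) auto
  ultimately show ?case using Rel.prems(1) by (auto simp del: map_map)
next
  case (Ex x \<phi>)
  have "fm_ok M (subst (\<sigma>(x := None)) \<phi>)"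
    using Ex.prems by (intro Ex.IH) (auto split: if_splits)
  then show ?case by simp
qed auto

lemma inst_Fml:
  assumes "\<phi> \<in> Fml M X C" "c \<in> tuples M ys"
  shows "inst ys c \<phi> \<in> Fml M (X - set ys) (C \<union> set c)"
proof -
  have len: "length c = length ys"
    using assms(2) by (auto simp: tuples_def dest: map_eq_imp_length_eq)
  have c: "set c \<subseteq> univ M" "map (srt M) c = map fst ys" using assms by (auto simp: tuples_def)
  have "m \<in> univ M \<and> srt M m = fst v" if "map_of (zip ys c) v = Some m" for v m
  proof -
    from map_of_SomeD[OF that] obtain i where "i < length ys" "ys ! i = v" "c ! i = m"
      using len by (auto simp: in_set_zip)
    then show ?thesis using c len by (metis length_map nth_map nth_mem subsetD)
  qed
  moreover have "dom (map_of (zip ys c)) = set ys" using len by simp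
  moreover have "ran (map_of (zip ys c)) \<subseteq> set c"
    by (auto simp: ran_def dest!: map_of_SomeD set_zip_rightD)
  ultimately show ?thesis
    using assms params_subst[of "map_of (zip ys c)" \<phi>]
    by (auto simp: inst_def Fml_def fv_subst fm_ok_subst)
qed

section \<open>Definable relations\<close>

lemma tm_params_univ: "tm_ok M t \<Longrightarrow> tm_params t \<subseteq> univ M"
  by (induction t) auto

lemma params_univ: "fm_ok M \<phi> \<Longrightarrow> params \<phi> \<subseteq> univ M"
  by (induction \<phi>) (auto dest: tm_params_univ)

lemma substitution_parameters:
  assumes "fm_ok M \<phi>" and "\<And>v. tm_ok M (\<sigma> v) \<and> tm_sort M (\<sigma> v) = fst v"
  obtains \<phi>' where "fm_ok M \<phi>'"
    and "fv \<phi>' \<subseteq> (\<Union>v\<in>fv \<phi>. tm_vars (\<sigma> v))"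
    and "params \<phi>' \<subseteq> (\<Union>v\<in>fv \<phi>. tm_params (\<sigma> v)) \<union> params \<phi>"
    and "\<And>e. sat M e \<phi>' = sat M (\<lambda>v. tm_val M e (\<sigma> v)) \<phi>"
proof -
  have "tm_ok M (Par m) \<and> tm_sort M (Par m) = srt M m" if "m \<in> params \<phi>" for m
    using that params_univ[OF assms(1)] by auto
  from substitution[of M \<phi> \<sigma> Par, OF assms this] show thesis
    by (auto intro: that)
qed

lemma tm_val_ok:
  assumes "is_structure M" and "asg M e"
  shows "tm_ok M t \<Longrightarrow> tm_val M e t \<in> univ M \<and> srt M (tm_val M e t) = tm_sort M t"
proof (induction t)
  case (Fn g ts)
  then have "tm_val M e t \<in> univ M \<and> srt M (tm_val M e t) = tm_sort M t" if "t \<in> set ts" for t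
    using that by simp
  then have "set (map (tm_val M e) ts) \<subseteq> univ M" "map (srt M) (map (tm_val M e) ts) = map (tm_sort M) ts"
    by (auto simp del: map_map) (simp)
  then have "set (map (tm_val M e) ts) \<subseteq> univ M \<and> map (srt M) (map (tm_val M e) ts) = fdom M g"
    using Fn.prems by (simp del: map_map set_map)
  then show ?case using assms(1) by (simp add: is_structure_def del: set_map map_map)
qed (use assms in \<open>auto simp: asg_def\<close>)

lemma asg_tm_val:
  "is_structure M \<Longrightarrow> asg M e \<Longrightarrow> (\<And>v. tm_ok M (\<sigma> v) \<and> tm_sort M (\<sigma> v) = fst v) \<Longrightarrow>
   asg M (\<lambda>v. tm_val M e (\<sigma> v))"
  by (simp add: tm_val_ok asg_def)

locale fo_structure =
  fixes M :: "('s, 'f, 'r, 'm) struct"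
  assumes str: "is_structure M"
begin

definition tup :: "'s list \<Rightarrow> 'm list set" where
  "tup ss = {d. set d \<subseteq> univ M \<and> map (srt M) d = ss}"

text \<open>A tuple of sorts \<open>ss\<close> is assigned to these variables; they are the ones that \<^const>\<open>ltp\<close> uses
  for it.\<close>

definition tuple_vars :: "'s list \<Rightarrow> 's var list" where
  "tuple_vars ss = map (\<lambda>j. (ss ! j, j)) [0..<length ss]"

text \<open>Predicates on lists take the place of formulas, so that names of variables disappear: to rename,
  permute or identify variables means to compose with a map on lists (lemma \<open>definable_pull\<close>). Only
  the values of the predicate on \<open>tup ss\<close> matter.\<close>

definition definable :: "'m set \<Rightarrow> 's list \<Rightarrow> ('m list \<Rightarrow> bool) \<Rightarrow> bool" where
  "definable C ss R \<longleftrightarrow>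
     (\<exists>\<psi>\<in>Fml M (set (tuple_vars ss)) C. \<forall>e. asg M e \<longrightarrow> sat M e \<psi> = R (map e (tuple_vars ss)))"

lemma tuples_eq: "tuples M ys = tup (map fst ys)"
  by (simp add: tuples_def tup_def)

lemma tup_length: "d \<in> tup ss \<Longrightarrow> length d = length ss"
  by (auto simp: tup_def)

lemma tup_Nil [simp]: "d \<in> tup [] \<longleftrightarrow> d = []"
  by (auto simp: tup_def)

lemma tup_append [intro]: "d \<in> tup ss \<Longrightarrow> d' \<in> tup ss' \<Longrightarrow> d @ d' \<in> tup (ss @ ss')"
  by (auto simp: tup_def)

lemma tup_split: "d \<in> tup (ss @ ts) \<longleftrightarrow> (\<exists>a b. d = a @ b \<and> a \<in> tup ss \<and> b \<in> tup ts)"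
  by (fastforce simp: tup_def map_eq_append_conv)

lemma tup_Cons: "m # d \<in> tup (s # ss) \<longleftrightarrow> m \<in> univ M \<and> srt M m = s \<and> d \<in> tup ss"
  by (auto simp: tup_def)

lemma tup_single: "d \<in> tup [s] \<longleftrightarrow> (\<exists>m. d = [m] \<and> m \<in> univ M \<and> srt M m = s)"
  by (auto simp: tup_def)

lemma tup_snoc: "tup (ts @ [t]) = (\<lambda>(d, m). d @ [m]) ` (tup ts \<times> {m \<in> univ M. srt M m = t})"
  by (auto simp: tup_split[of _ ts] tup_single)

lemma tup_self: "set p \<subseteq> univ M \<Longrightarrow> p \<in> tup (map (srt M) p)"
  by (simp add: tup_def)

lemma tup_univ: "d \<in> tup ss \<Longrightarrow> set d \<subseteq> univ M"
  by (simp add: tup_def)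

lemma tup_srt: "d \<in> tup ss \<Longrightarrow> map (srt M) d = ss"
  by (simp add: tup_def)

lemma tup_concat:
  "(\<And>g. g \<in> set gs \<Longrightarrow> g \<in> tup ts) \<Longrightarrow> concat gs \<in> tup (concat (replicate (length gs) ts))"
  by (induction gs) auto

lemma length_tuple_vars [simp]: "length (tuple_vars ss) = length ss"
  by (simp add: tuple_vars_def)

lemma nth_tuple_vars [simp]: "j < length ss \<Longrightarrow> tuple_vars ss ! j = (ss ! j, j)"
  by (simp add: tuple_vars_def)

lemma set_tuple_vars: "set (tuple_vars ss) = {(ss ! j, j) | j. j < length ss}"
  by (auto simp: tuple_vars_def)

lemma distinct_tuple_vars [simp]: "distinct (tuple_vars ss)"
  by (auto simp: tuple_vars_def distinct_map inj_on_def)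

lemma fst_tuple_vars [simp]: "map fst (tuple_vars ss) = ss"
  by (auto simp: tuple_vars_def intro: nth_equalityI)

lemma tuple_vars_append_le: "set (tuple_vars ss) \<subseteq> set (tuple_vars (ss @ ts))"
  by (auto simp: set_tuple_vars nth_append)

lemma map_tuple_vars_append:
  "map e (tuple_vars (ss @ ts)) =
     map e (tuple_vars ss) @ map (\<lambda>j. e (ts ! j, length ss + j)) [0..<length ts]"
  by (rule nth_equalityI) (auto simp: nth_append)

lemma tup_asg: "asg M e \<Longrightarrow> map e zs \<in> tup (map fst zs)"
  by (auto simp: asg_def tup_def)

lemma asg_exists:
  assumes "distinct zs" and "d \<in> tup (map fst zs)"
  obtains e where "asg M e" and "map e zs = d"
proof -
  define e where "e v = (case map_of (zip zs d) v of Some m \<Rightarrow> m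
      | None \<Rightarrow> SOME m. m \<in> univ M \<and> srt M m = fst v)" for v
  have len: "length zs = length d" using tup_length[OF assms(2)] by simp
  have nth: "e (zs ! i) = d ! i" if "i < length zs" for i
    using that len assms(1) by (simp add: e_def map_of_zip_nth)
  have "e v \<in> univ M \<and> srt M (e v) = fst v" for v
  proof (cases "v \<in> set zs")
    case True
    then obtain i where i: "i < length zs" "v = zs ! i" by (auto simp: in_set_conv_nth)
    have "srt M (d ! i) = fst (zs ! i)"
      using tup_srt[OF assms(2)] i len by (metis nth_map)
    moreover have "d ! i \<in> univ M" using tup_univ[OF assms(2)] i len by auto
    ultimately show ?thesis using i nth by simp
  next
    case False
    then have "map_of (zip zs d) v = None" using len by (simp add: map_of_zip_is_None)
    moreover have "\<exists>m. m \<in> univ M \<and> srt M m = fst v" using str by (auto simp: is_structure_def)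
    ultimately show ?thesis
      using someI_ex[of "\<lambda>m. m \<in> univ M \<and> srt M m = fst v"] by (simp add: e_def)
  qed
  then have "asg M e" by (simp add: asg_def)
  moreover have "map e zs = d" using nth len by (auto intro: nth_equalityI)
  ultimately show thesis by (rule that)
qed

lemma asg_exists_tuple_vars:
  assumes "d \<in> tup ss"
  obtains e where "asg M e" and "map e (tuple_vars ss) = d"
  using asg_exists[of "tuple_vars ss" d] assms by auto

lemma sat_tuple_vars:
  assumes "map e (tuple_vars ss) = d" and "fv \<psi> \<subseteq> set (tuple_vars ss)"
  shows "sat M e \<psi> = sat M (\<lambda>(s, j). d ! j) \<psi>"
proof (rule sat_cong)
  fix v assume "v \<in> fv \<psi>"
  then obtain j where "j < length ss" "v = (ss ! j, j)"
    using assms(2) by (auto simp: set_tuple_vars)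
  moreover from this have "d ! j = e (ss ! j, j)"
    using assms(1) by (metis length_tuple_vars nth_map nth_tuple_vars)
  ultimately show "e v = (case v of (s, j) \<Rightarrow> d ! j)" by simp
qed

lemma definable_iff:
  "definable C ss R \<longleftrightarrow>
     (\<exists>\<psi>\<in>Fml M (set (tuple_vars ss)) C. \<forall>d\<in>tup ss. sat M (\<lambda>(s, j). d ! j) \<psi> = R d)"
proof
  assume "definable C ss R"
  then obtain \<psi> where \<psi>: "\<psi> \<in> Fml M (set (tuple_vars ss)) C"
    and s: "\<And>e. asg M e \<Longrightarrow> sat M e \<psi> = R (map e (tuple_vars ss))"
    by (auto simp: definable_def)
  have "sat M (\<lambda>(s, j). d ! j) \<psi> = R d" if d: "d \<in> tup ss" for d
  proof -
    obtain e where "asg M e" "map e (tuple_vars ss) = d" using asg_exists_tuple_vars[OF d] .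
    then show ?thesis using \<psi> s[of e] sat_tuple_vars[of e ss d \<psi>] by (simp add: Fml_def)
  qed
  with \<psi> show "\<exists>\<psi>\<in>Fml M (set (tuple_vars ss)) C. \<forall>d\<in>tup ss. sat M (\<lambda>(s, j). d ! j) \<psi> = R d" by blast
next
  assume "\<exists>\<psi>\<in>Fml M (set (tuple_vars ss)) C. \<forall>d\<in>tup ss. sat M (\<lambda>(s, j). d ! j) \<psi> = R d"
  then obtain \<psi> where \<psi>: "\<psi> \<in> Fml M (set (tuple_vars ss)) C"
    and s: "\<And>d. d \<in> tup ss \<Longrightarrow> sat M (\<lambda>(s, j). d ! j) \<psi> = R d" by auto
  have "sat M e \<psi> = R (map e (tuple_vars ss))" if "asg M e" for e
    using s[of "map e (tuple_vars ss)"] tup_asg[OF that, of "tuple_vars ss"] \<psi> sat_tuple_vars[of e ss _ \<psi>]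
    by (simp add: Fml_def)
  with \<psi> show "definable C ss R" by (auto simp: definable_def)
qed

lemma definable_I:
  "\<psi> \<in> Fml M (set (tuple_vars ss)) C \<Longrightarrow> (\<And>e. asg M e \<Longrightarrow> sat M e \<psi> = R (map e (tuple_vars ss))) \<Longrightarrow> definable C ss R"
  by (auto simp: definable_def)

lemma definable_cong: "(\<And>d. d \<in> tup ss \<Longrightarrow> R d = R' d) \<Longrightarrow> definable C ss R = definable C ss R'"
  by (simp add: definable_iff)

lemma definable_mono: "definable C ss R \<Longrightarrow> C \<subseteq> C' \<Longrightarrow> definable C' ss R"
proof -
  assume "definable C ss R" "C \<subseteq> C'"
  moreover from this have "Fml M (set (tuple_vars ss)) C \<subseteq> Fml M (set (tuple_vars ss)) C'"
    by (auto simp: Fml_def)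
  ultimately show ?thesis unfolding definable_def by blast
qed

lemma definable_sat:
  assumes "fm_ok M \<phi>" and "params \<phi> \<subseteq> C"
    and "\<And>v. v \<in> fv \<phi> \<Longrightarrow> r v < length ss \<and> ss ! (r v) = fst v"
  shows "definable C ss (\<lambda>d. sat M (\<lambda>v. d ! r v) \<phi>)"
proof -
  define \<sigma> :: "'s var \<Rightarrow> ('s, 'f, 'm) trm"
    where "\<sigma> v = (if v \<in> fv \<phi> then Var (fst v, r v) else Var v)" for v
  have ok: "tm_ok M (\<sigma> v) \<and> tm_sort M (\<sigma> v) = fst v" for v by (simp add: \<sigma>_def)
  obtain \<phi>' where \<phi>': "fm_ok M \<phi>'"
    "fv \<phi>' \<subseteq> (\<Union>v\<in>fv \<phi>. tm_vars (\<sigma> v))"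
    "params \<phi>' \<subseteq> (\<Union>v\<in>fv \<phi>. tm_params (\<sigma> v)) \<union> params \<phi>"
    "\<And>e. sat M e \<phi>' = sat M (\<lambda>v. tm_val M e (\<sigma> v)) \<phi>"
    using substitution_parameters[OF assms(1) ok] by blast
  have "fv \<phi>' \<subseteq> set (tuple_vars ss)"
  proof
    fix w assume "w \<in> fv \<phi>'"
    then obtain v where "v \<in> fv \<phi>" "w = (fst v, r v)" using \<phi>'(2) by (auto simp: \<sigma>_def)
    then show "w \<in> set (tuple_vars ss)"
      using assms(3)[of v] by (auto simp: set_tuple_vars intro: exI[of _ "r v"])
  qed
  moreover have "params \<phi>' \<subseteq> C" using \<phi>'(3) assms(2) by (auto simp: \<sigma>_def split: if_splits)
  moreover have "sat M e \<phi>' = sat M (\<lambda>v. map e (tuple_vars ss) ! r v) \<phi>" for e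
    unfolding \<phi>'(4) using assms(3) by (intro sat_cong) (simp add: \<sigma>_def)
  ultimately show ?thesis using \<phi>'(1) by (auto simp: definable_def Fml_def)
qed

text \<open>The arguments may be put on any list of variables, even one with repetitions. This is the form
  in which the substitution lemma is used, and it entails closure under all maps of coordinates.\<close>

lemma definable_formula:
  assumes "definable C ss R" and "map fst zs = ss"
  obtains \<psi> where "\<psi> \<in> Fml M (set zs) C" and "\<And>e. asg M e \<Longrightarrow> sat M e \<psi> = R (map e zs)"
proof -
  from assms(1) obtain \<phi> where \<phi>: "\<phi> \<in> Fml M (set (tuple_vars ss)) C"
    and s: "\<And>e. asg M e \<Longrightarrow> sat M e \<phi> = R (map e (tuple_vars ss))" by (auto simp: definable_def)
  have len: "length ss = length zs" using assms(2) by auto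
  define \<sigma> :: "'s var \<Rightarrow> ('s, 'f, 'm) trm"
    where "\<sigma> v = (if v \<in> set (tuple_vars ss) then Var (zs ! snd v) else Var v)" for v
  have ok: "tm_ok M (\<sigma> v) \<and> tm_sort M (\<sigma> v) = fst v" for v
    using assms(2) len by (auto simp: \<sigma>_def set_tuple_vars)
  have fok: "fm_ok M \<phi>" using \<phi> by (simp add: Fml_def)
  obtain \<phi>' where \<phi>': "fm_ok M \<phi>'"
    "fv \<phi>' \<subseteq> (\<Union>v\<in>fv \<phi>. tm_vars (\<sigma> v))"
    "params \<phi>' \<subseteq> (\<Union>v\<in>fv \<phi>. tm_params (\<sigma> v)) \<union> params \<phi>"
    "\<And>e. sat M e \<phi>' = sat M (\<lambda>v. tm_val M e (\<sigma> v)) \<phi>"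
    using substitution_parameters[OF fok ok] by blast
  show thesis
  proof (rule that[of \<phi>'])
    have "fv \<phi>' \<subseteq> set zs"
      using \<phi>'(2) \<phi> len by (fastforce simp: \<sigma>_def Fml_def set_tuple_vars split: if_splits)
    moreover have "params \<phi>' \<subseteq> C"
      using \<phi>'(3) \<phi> by (fastforce simp: \<sigma>_def Fml_def split: if_splits)
    ultimately show "\<phi>' \<in> Fml M (set zs) C" using \<phi>'(1) by (simp add: Fml_def)
    fix e assume e: "asg M e"
    have "asg M (\<lambda>v. tm_val M e (\<sigma> v))"
      by (rule asg_tm_val[OF str e ok])
    then have "sat M e \<phi>' = R (map (\<lambda>v. tm_val M e (\<sigma> v)) (tuple_vars ss))"
      using s \<phi>'(4) by simp
    also have "map (\<lambda>v. tm_val M e (\<sigma> v)) (tuple_vars ss) = map e zs"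
      using len by (intro nth_equalityI) (auto simp: \<sigma>_def set_tuple_vars)
    finally show "sat M e \<phi>' = R (map e zs)" .
  qed
qed

text \<open>The map of coordinates \<open>r\<close> is accompanied by a function \<open>f\<close> that agrees with it on tuples of the
  right sorts, because the maps that occur are conveniently given by \<^const>\<open>take\<close> and
  \<^const>\<open>drop\<close>.\<close>

lemma definable_pull:
  assumes "definable C ss R" and "\<And>i. i \<in> set r \<Longrightarrow> i < length ss'" and "ss = map ((!) ss') r"
    and f: "\<And>d. d \<in> tup ss' \<Longrightarrow> f d = map ((!) d) r"
  shows "definable C ss' (\<lambda>d. R (f d))"
proof -
  let ?zs = "map (\<lambda>i. (ss' ! i, i)) r"
  obtain \<psi> where \<psi>: "\<psi> \<in> Fml M (set ?zs) C"
    and s: "\<And>e. asg M e \<Longrightarrow> sat M e \<psi> = R (map e ?zs)"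
    using definable_formula[OF assms(1), of ?zs] assms(3) by (auto simp: comp_def)
  have "\<psi> \<in> Fml M (set (tuple_vars ss')) C"
    using \<psi> assms(2) by (fastforce simp: Fml_def set_tuple_vars)
  moreover have "sat M e \<psi> = R (f (map e (tuple_vars ss')))" if "asg M e" for e
  proof -
    have "map e (tuple_vars ss') \<in> tup ss'" using tup_asg[OF that, of "tuple_vars ss'"] by simp
    then have "f (map e (tuple_vars ss')) = map e ?zs" using assms(2) f by simp
    then show ?thesis using s[OF that] by simp
  qed
  ultimately show ?thesis by (auto simp: definable_def)
qed

lemma definable_not: "definable C ss R \<Longrightarrow> definable C ss (\<lambda>d. \<not> R d)"
proof -
  assume "definable C ss R"
  then obtain \<psi> where "\<psi> \<in> Fml M (set (tuple_vars ss)) C"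
    "\<And>e. asg M e \<Longrightarrow> sat M e \<psi> = R (map e (tuple_vars ss))" by (auto simp: definable_def)
  then show ?thesis by (auto simp: definable_def Fml_def intro!: exI[of _ "Neg \<psi>"])
qed

lemma definable_conj: "definable C ss R \<Longrightarrow> definable C ss R' \<Longrightarrow> definable C ss (\<lambda>d. R d \<and> R' d)"
proof -
  assume "definable C ss R" "definable C ss R'"
  then obtain \<psi> \<psi>' where "\<psi> \<in> Fml M (set (tuple_vars ss)) C" "\<psi>' \<in> Fml M (set (tuple_vars ss)) C"
    "\<And>e. asg M e \<Longrightarrow> sat M e \<psi> = R (map e (tuple_vars ss))"
    "\<And>e. asg M e \<Longrightarrow> sat M e \<psi>' = R' (map e (tuple_vars ss))" by (auto simp: definable_def)
  then show ?thesis by (auto simp: definable_def Fml_def intro!: exI[of _ "Conj \<psi> \<psi>'"])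
qed

lemma definable_True: "definable C ss (\<lambda>d. True)"
proof -
  let ?v = "(undefined, 0)"
  have "Ex ?v (Eq (Var ?v) (Var ?v)) \<in> Fml M (set (tuple_vars ss)) C" by (auto simp: Fml_def)
  moreover have "sat M e (Ex ?v (Eq (Var ?v) (Var ?v)))" for e
    using str by (auto simp: is_structure_def)
  ultimately show ?thesis
    by (intro definable_I[of "Ex ?v (Eq (Var ?v) (Var ?v))"]) auto
qed

lemma definable_Ball: "finite S \<Longrightarrow> (\<And>i. i \<in> S \<Longrightarrow> definable C ss (R i)) \<Longrightarrow> definable C ss (\<lambda>d. \<forall>i\<in>S. R i d)"
  by (induction S rule: finite_induct) (auto intro: definable_True definable_conj)

lemma definable_iff_const: "definable C ss R \<Longrightarrow> definable C ss (\<lambda>d. R d = b)"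
  using definable_not[of C ss R] by (cases b) auto

lemma definable_ex1:
  assumes "definable C (ss @ [s]) R"
  shows "definable C ss (\<lambda>d. \<exists>m. m \<in> univ M \<and> srt M m = s \<and> R (d @ [m]))"
proof -
  let ?x = "(s, length ss)"
  from assms obtain \<psi> where \<psi>: "\<psi> \<in> Fml M (set (tuple_vars (ss @ [s]))) C"
    "\<And>e. asg M e \<Longrightarrow> sat M e \<psi> = R (map e (tuple_vars (ss @ [s])))" by (auto simp: definable_def)
  have "set (tuple_vars (ss @ [s])) - {?x} \<subseteq> set (tuple_vars ss)"
    by (auto simp: set_tuple_vars nth_append split: if_splits)
  then have "Ex ?x \<psi> \<in> Fml M (set (tuple_vars ss)) C" using \<psi>(1) by (auto simp: Fml_def)
  moreover have "sat M e (Ex ?x \<psi>) =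
      (\<exists>m. m \<in> univ M \<and> srt M m = s \<and> R (map e (tuple_vars ss) @ [m]))" if "asg M e" for e
  proof -
    have "sat M (e(?x := m)) \<psi> = R (map e (tuple_vars ss) @ [m])"
      if "m \<in> univ M" "srt M m = s" for m
    proof -
      have "map (e(?x := m)) (tuple_vars (ss @ [s])) = map e (tuple_vars ss) @ [m]"
        by (auto simp: map_tuple_vars_append set_tuple_vars)
      then show ?thesis using \<psi>(2)[of "e(?x := m)"] \<open>asg M e\<close> that by (auto simp: asg_def)
    qed
    then show ?thesis by auto
  qed
  ultimately show ?thesis by (rule definable_I)
qed

lemma definable_ex:
  "definable C (ss @ ts) R \<Longrightarrow> definable C ss (\<lambda>d. \<exists>d'\<in>tup ts. R (d @ d'))"
proof (induction ts arbitrary: R rule: rev_induct)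
  case Nil
  then show ?case by simp
next
  case (snoc t ts)
  have "definable C ((ss @ ts) @ [t]) R" using snoc.prems by simp
  from snoc.IH[OF definable_ex1[OF this]]
  have "definable C ss (\<lambda>d. \<exists>d'\<in>tup ts. \<exists>m. m \<in> univ M \<and> srt M m = t \<and> R ((d @ d') @ [m]))" .
  moreover have "(\<exists>d'\<in>tup ts. \<exists>m. m \<in> univ M \<and> srt M m = t \<and> R ((d @ d') @ [m])) =
      (\<exists>d'\<in>tup (ts @ [t]). R (d @ d'))" for d
    unfolding tup_snoc by auto
  ultimately show ?case by simp
qed

lemma definable_section:
  assumes "definable C (ss @ ts) R" and "p \<in> tup ts"
  shows "definable (C \<union> set p) ss (\<lambda>d. R (d @ p))"
proof -
  from assms obtain \<phi> where \<phi>: "\<phi> \<in> Fml M (set (tuple_vars (ss @ ts))) C"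
    and s: "\<And>e. asg M e \<Longrightarrow> sat M e \<phi> = R (map e (tuple_vars (ss @ ts)))"
      by (auto simp: definable_def)
  have len: "length p = length ts" using tup_length[OF assms(2)] .
  define \<sigma> :: "'s var \<Rightarrow> ('s, 'f, 'm) trm"
    where "\<sigma> v = (if v \<in> set (tuple_vars (ss @ ts)) \<and> snd v \<ge> length ss
       then Par (p ! (snd v - length ss)) else Var v)" for v
  have p: "p ! j \<in> univ M \<and> srt M (p ! j) = ts ! j" if "j < length ts" for j
    using that len tup_univ[OF assms(2)] tup_srt[OF assms(2)]
    by (metis nth_map nth_mem subsetD)
  have ok: "tm_ok M (\<sigma> v) \<and> tm_sort M (\<sigma> v) = fst v" for v
  proof (cases "v \<in> set (tuple_vars (ss @ ts)) \<and> snd v \<ge> length ss")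
    case True
    then obtain j where j: "v = ((ss @ ts) ! j, j)" "length ss \<le> j" "j < length ss + length ts"
      by (auto simp: set_tuple_vars)
    with True p[of "j - length ss"] show ?thesis by (simp add: \<sigma>_def nth_append)
  qed (auto simp: \<sigma>_def)
  have fok: "fm_ok M \<phi>" using \<phi> by (simp add: Fml_def)
  obtain \<phi>' where \<phi>': "fm_ok M \<phi>'"
    "fv \<phi>' \<subseteq> (\<Union>v\<in>fv \<phi>. tm_vars (\<sigma> v))"
    "params \<phi>' \<subseteq> (\<Union>v\<in>fv \<phi>. tm_params (\<sigma> v)) \<union> params \<phi>"
    "\<And>e. sat M e \<phi>' = sat M (\<lambda>v. tm_val M e (\<sigma> v)) \<phi>"
    using substitution_parameters[OF fok ok] by blast
  have "fv \<phi>' \<subseteq> set (tuple_vars ss)"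
  proof
    fix w assume "w \<in> fv \<phi>'"
    then have "w \<in> set (tuple_vars (ss @ ts))" "snd w < length ss"
      using \<phi>'(2) \<phi> by (force simp: \<sigma>_def Fml_def split: if_splits)+
    then show "w \<in> set (tuple_vars ss)" by (auto simp: set_tuple_vars nth_append)
  qed
  moreover have "params \<phi>' \<subseteq> C \<union> set p"
  proof
    fix m assume "m \<in> params \<phi>'"
    then consider "m \<in> params \<phi>" | v where "v \<in> fv \<phi>" "m \<in> tm_params (\<sigma> v)"
      using \<phi>'(3) by auto
    then show "m \<in> C \<union> set p"
    proof cases
      case 1
      then show ?thesis using \<phi> by (auto simp: Fml_def)
    next
      case 2
      then show ?thesis using len by (auto simp: \<sigma>_def set_tuple_vars split: if_splits)
    qed
  qed
  moreover have "sat M e \<phi>' = R (map e (tuple_vars ss) @ p)" if e: "asg M e" for e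
  proof -
    have "asg M (\<lambda>v. tm_val M e (\<sigma> v))"
      by (rule asg_tm_val[OF str e ok])
    then have "sat M e \<phi>' = R (map (\<lambda>v. tm_val M e (\<sigma> v)) (tuple_vars (ss @ ts)))"
      using s \<phi>'(4) by simp
    also have "map (\<lambda>v. tm_val M e (\<sigma> v)) (tuple_vars (ss @ ts)) = map e (tuple_vars ss) @ p"
      using len by (intro nth_equalityI) (auto simp: \<sigma>_def set_tuple_vars nth_append)
    finally show ?thesis .
  qed
  ultimately show ?thesis using \<phi>'(1) by (auto simp: definable_def Fml_def)
qed

text \<open>Relations over \<open>C\<close> are sections of parameter-free ones; conversely sections are definable by
  \<open>definable_section\<close>. Hence statements about types over \<open>C\<close> reduce to parameter-free relations, which
  are the ones that automorphisms preserve.\<close>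

lemma definable_parameters:
  assumes "definable C ss R"
  obtains p R0 where "set p \<subseteq> C" and "set p \<subseteq> univ M" and "definable {} (ss @ map (srt M) p) R0"
    and "\<And>d. d \<in> tup ss \<Longrightarrow> R d = R0 (d @ p)"
proof -
  from assms obtain \<phi> where \<phi>: "\<phi> \<in> Fml M (set (tuple_vars ss)) C"
    and s: "\<And>e. asg M e \<Longrightarrow> sat M e \<phi> = R (map e (tuple_vars ss))" by (auto simp: definable_def)
  obtain p where p: "set p = params \<phi>" using finite_list[OF finite_params[of \<phi>]] by (rule exE)
  have "\<forall>m. \<exists>i. m \<in> params \<phi> \<longrightarrow> i < length p \<and> p ! i = m"
    using p by (metis in_set_conv_nth)
  then obtain idx where idx: "\<And>m. m \<in> params \<phi> \<Longrightarrow> idx m < length p \<and> p ! idx m = m" by metis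
  have pu: "set p \<subseteq> univ M" using \<phi> params_univ[of M \<phi>] p by (simp add: Fml_def)
  let ?f = "\<lambda>m. Var (srt M m, length ss + idx m) :: ('s, 'f, 'm) trm"
  have "\<exists>\<phi>'. fm_ok M \<phi>' \<and>
     fv \<phi>' \<subseteq> (\<Union>v\<in>fv \<phi>. tm_vars (Var v :: ('s, 'f, 'm) trm)) \<union> (\<Union>m\<in>params \<phi>. tm_vars (?f m)) \<and>
     params \<phi>' \<subseteq> (\<Union>v\<in>fv \<phi>. tm_params (Var v :: ('s, 'f, 'm) trm)) \<union> (\<Union>m\<in>params \<phi>. tm_params (?f m)) \<and>
     (\<forall>e. (\<forall>m\<in>params \<phi>. tm_val M e (?f m) = m) \<longrightarrow>
        sat M e \<phi>' = sat M (\<lambda>v. tm_val M e (Var v :: ('s, 'f, 'm) trm)) \<phi>)"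
    using \<phi> by (intro substitution) (auto simp: Fml_def)
  then obtain \<phi>' where \<phi>': "fm_ok M \<phi>'"
    "fv \<phi>' \<subseteq> fv \<phi> \<union> (\<Union>m\<in>params \<phi>. {(srt M m, length ss + idx m)})"
    "params \<phi>' = {}"
    "\<And>e. (\<forall>m\<in>params \<phi>. e (srt M m, length ss + idx m) = m) \<Longrightarrow> sat M e \<phi>' = sat M e \<phi>" by auto
  let ?ts = "ss @ map (srt M) p"
  let ?R0 = "\<lambda>d. sat M (\<lambda>(s, j). d ! j) \<phi>'"
  have "fv \<phi>' \<subseteq> set (tuple_vars ?ts)"
  proof
    fix v assume "v \<in> fv \<phi>'"
    then consider "v \<in> fv \<phi>" | m where "m \<in> params \<phi>" "v = (srt M m, length ss + idx m)"
      using \<phi>'(2) by auto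
    then show "v \<in> set (tuple_vars ?ts)"
    proof cases
      case 1
      then show ?thesis using \<phi> tuple_vars_append_le by (fastforce simp: Fml_def)
    next
      case 2
      then show ?thesis using idx[of m]
        by (auto simp: set_tuple_vars nth_append intro!: exI[of _ "length ss + idx m"])
    qed
  qed
  then have fml: "\<phi>' \<in> Fml M (set (tuple_vars ?ts)) {}" using \<phi>' by (simp add: Fml_def)
  show thesis
  proof (rule that[of p ?R0])
    show "set p \<subseteq> C" using \<phi> p by (auto simp: Fml_def)
    show "set p \<subseteq> univ M" by (fact pu)
    show "definable {} ?ts ?R0" using fml by (auto simp: definable_iff)
    fix d assume d: "d \<in> tup ss"
    have dp: "d @ p \<in> tup ?ts" using d pu by (auto simp: tup_def)
    obtain e where e: "asg M e" "map e (tuple_vars ?ts) = d @ p"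
      using asg_exists_tuple_vars[OF dp] .
    have ed: "map e (tuple_vars ss) = d"
      using e(2) tup_length[OF d] by (simp add: map_tuple_vars_append)
    have "e (srt M m, length ss + idx m) = m" if m: "m \<in> params \<phi>" for m
    proof -
      have "map e (tuple_vars ?ts) ! (length ss + idx m) = m"
        using e(2) idx[OF m] tup_length[OF d] by (simp add: nth_append)
      then show ?thesis using idx[OF m] by (simp add: nth_append)
    qed
    then have "sat M e \<phi>' = R d" using \<phi>'(4)[of e] s[OF e(1)] ed by simp
    then show "R d = ?R0 (d @ p)"
      using sat_tuple_vars[OF e(2)] fml by (simp add: Fml_def)
  qed
qed

lemma definable_eq:
  assumes "i < length ss" "j < length ss" "ss ! i = ss ! j"
  shows "definable C ss (\<lambda>d. d ! i = d ! j)"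
proof -
  have "Eq (Var (ss ! i, i)) (Var (ss ! j, j)) \<in> Fml M (set (tuple_vars ss)) C"
    using assms by (auto simp: Fml_def set_tuple_vars)
  then show ?thesis using assms unfolding definable_def
    by (intro bexI[of _ "Eq (Var (ss ! i, i)) (Var (ss ! j, j))"]) auto
qed

end

section \<open>Types of tuples and automorphisms\<close>

context fo_structure
begin

lemma definable_swap:
  assumes "definable C (ss @ ts) R"
  shows "definable C (ts @ ss) (\<lambda>d. R (drop (length ts) d @ take (length ts) d))"
proof (rule definable_pull[OF assms])
  let ?r = "[length ts..<length ts + length ss] @ [0..<length ts]"
  show "i < length (ts @ ss)" if "i \<in> set ?r" for i using that by auto
  show "ss @ ts = map ((!) (ts @ ss)) ?r"
    by (intro nth_equalityI) (auto simp: nth_append)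
  show "drop (length ts) d @ take (length ts) d = map ((!) d) ?r" if "d \<in> tup (ts @ ss)" for d
    using tup_length[OF that] by (intro nth_equalityI) (auto simp: nth_append)
qed

lemma definable_section_left:
  assumes "definable C (ss @ ts) R" and "p \<in> tup ss"
  shows "definable (C \<union> set p) ts (\<lambda>d. R (p @ d))"
proof -
  have "definable (C \<union> set p) ts (\<lambda>d. R (drop (length ts) (d @ p) @ take (length ts) (d @ p)))"
    by (rule definable_section[OF definable_swap[OF assms(1)] assms(2)])
  then show ?thesis by (rule definable_cong[THEN iffD1, rotated]) (simp add: tup_length)
qed

text \<open>Lemma \<open>ltp_eq_iff\<close> identifies this relation with equality of \<^const>\<open>ltp\<close>.\<close>

definition same_type :: "'m set \<Rightarrow> 'm list \<Rightarrow> 'm list \<Rightarrow> bool" where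
  "same_type C d d' \<longleftrightarrow> (\<exists>ss. d \<in> tup ss \<and> d' \<in> tup ss \<and> (\<forall>R. definable C ss R \<longrightarrow> R d = R d'))"

lemma same_typeI: "d \<in> tup ss \<Longrightarrow> d' \<in> tup ss \<Longrightarrow> (\<And>R. definable C ss R \<Longrightarrow> R d = R d') \<Longrightarrow> same_type C d d'"
  by (auto simp: same_type_def)

lemma same_typeD:
  assumes "same_type C d d'" and "d \<in> tup ss"
  shows "d' \<in> tup ss" and "definable C ss R \<Longrightarrow> R d = R d'"
  using assms by (auto simp: same_type_def dest: tup_srt)

lemma same_type_refl: "set d \<subseteq> univ M \<Longrightarrow> same_type C d d"
  by (meson same_typeI tup_self)

lemma same_type_sym: "same_type C d d' \<Longrightarrow> same_type C d' d"
  unfolding same_type_def by metis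

lemma same_type_trans: "same_type C d d' \<Longrightarrow> same_type C d' d'' \<Longrightarrow> same_type C d d''"
  unfolding same_type_def by (metis tup_srt)

lemma same_type_mono: "same_type C d d' \<Longrightarrow> C' \<subseteq> C \<Longrightarrow> same_type C' d d'"
  unfolding same_type_def using definable_mono by metis

lemma same_type_append:
  assumes "same_type C d d'" and "set p \<subseteq> C" and "set p \<subseteq> univ M"
  shows "same_type C (d @ p) (d' @ p)"
proof -
  from assms(1) obtain ss where ss: "d \<in> tup ss" "d' \<in> tup ss" by (auto simp: same_type_def)
  have p: "p \<in> tup (map (srt M) p)" using assms(3) by (rule tup_self)
  have "R (d @ p) = R (d' @ p)" if R: "definable C (ss @ map (srt M) p) R" for R
  proof -
    have "definable C ss (\<lambda>d. R (d @ p))"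
      using definable_section[OF R p] assms(2) by (simp add: Un_absorb2)
    from same_typeD(2)[OF assms(1) ss(1) this] show ?thesis .
  qed
  then show ?thesis using ss p by (intro same_typeI[of _ "ss @ map (srt M) p"]) auto
qed

lemma same_type_pull:
  assumes "same_type C d d'" and "\<And>i. i \<in> set r \<Longrightarrow> i < length d"
  shows "same_type C (map ((!) d) r) (map ((!) d') r)"
proof -
  from assms(1) obtain ss where ss: "d \<in> tup ss" "d' \<in> tup ss" by (auto simp: same_type_def)
  have in_tup: "map ((!) x) r \<in> tup (map ((!) ss) r)" if "x \<in> tup ss" for x
  proof -
    have "x ! i \<in> univ M \<and> srt M (x ! i) = ss ! i" if i: "i \<in> set r" for i
    proof -
      have "i < length x" using assms(2)[OF i] tup_length[OF ss(1)] tup_length[OF \<open>x \<in> tup ss\<close>]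
        by simp
      then show ?thesis using tup_univ[OF \<open>x \<in> tup ss\<close>] tup_srt[OF \<open>x \<in> tup ss\<close>]
        by (metis nth_map nth_mem subsetD)
    qed
    then show ?thesis unfolding tup_def by (simp add: image_subset_iff)
  qed
  have "R (map ((!) d) r) = R (map ((!) d') r)" if R: "definable C (map ((!) ss) r) R" for R
  proof -
    have "definable C ss (\<lambda>x. R (map ((!) x) r))"
      using assms(2) tup_length[OF ss(1)] by (intro definable_pull[OF R]) auto
    from same_typeD(2)[OF assms(1) ss(1) this] show ?thesis .
  qed
  then show ?thesis using in_tup ss by (intro same_typeI) auto
qed

lemma ltp_tup:
  assumes "d \<in> tup ss"
  shows "ltp M d C = {\<phi> \<in> Fml M (set (tuple_vars ss)) C. sat M (\<lambda>(s, j). d ! j) \<phi>}"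
proof -
  have "tvars M {..<length d} ((!) d) = set (tuple_vars ss)"
    using tup_length[OF assms] tup_srt[OF assms] by (fastforce simp: tvars_def set_tuple_vars)
  then show ?thesis by (simp add: ltp_def tp_def)
qed

text \<open>That the two tuples have the same length and the same sorts is not presupposed: the formulas
  \<open>x\<^sub>j = x\<^sub>j\<close> in the type of a tuple determine both.\<close>

lemma ltp_eq_iff:
  assumes "set d \<subseteq> univ M" and "set d' \<subseteq> univ M"
  shows "ltp M d C = ltp M d' C \<longleftrightarrow> same_type C d d'"
proof
  assume eq: "ltp M d C = ltp M d' C"
  let ?ss = "map (srt M) d" let ?ss' = "map (srt M) d'"
  note d = ltp_tup[OF tup_self[OF assms(1)]] and d' = ltp_tup[OF tup_self[OF assms(2)]]
  have "v \<in> set (tuple_vars ?ss) \<longleftrightarrow> v \<in> set (tuple_vars ?ss')" for v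
  proof -
    have "Eq (Var v) (Var v) \<in> ltp M d C \<longleftrightarrow> v \<in> set (tuple_vars ?ss)"
      unfolding d by (auto simp: Fml_def)
    moreover have "Eq (Var v) (Var v) \<in> ltp M d' C \<longleftrightarrow> v \<in> set (tuple_vars ?ss')"
      unfolding d' by (auto simp: Fml_def)
    ultimately show ?thesis using eq by simp
  qed
  then have tuple_vars: "set (tuple_vars ?ss) = set (tuple_vars ?ss')" by blast
  then have "card (set (tuple_vars ?ss)) = card (set (tuple_vars ?ss'))" by simp
  then have len: "length d = length d'" by (simp add: distinct_card)
  have "?ss = ?ss'"
  proof (rule nth_equalityI)
    fix j assume "j < length ?ss"
    then have "(?ss ! j, j) \<in> set (tuple_vars ?ss')" using tuple_vars by (auto simp: set_tuple_vars)
    then show "?ss ! j = ?ss' ! j" by (auto simp: set_tuple_vars)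
  qed (simp add: len)
  then have tup: "d \<in> tup ?ss" "d' \<in> tup ?ss" using assms tup_self by metis+
  show "same_type C d d'"
  proof (rule same_typeI[OF tup])
    fix R assume "definable C ?ss R"
    then obtain \<psi> where "\<psi> \<in> Fml M (set (tuple_vars ?ss)) C"
      "\<forall>d\<in>tup ?ss. sat M (\<lambda>(s, j). d ! j) \<psi> = R d" by (auto simp: definable_iff)
    moreover from this have "\<psi> \<in> ltp M d C \<longleftrightarrow> \<psi> \<in> ltp M d' C" using eq by simp
    ultimately show "R d = R d'" using tup unfolding ltp_tup[OF tup(1)] ltp_tup[OF tup(2)] by simp
  qed
next
  assume "same_type C d d'"
  then obtain ss where ss: "d \<in> tup ss" "d' \<in> tup ss" "\<And>R. definable C ss R \<Longrightarrow> R d = R d'"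
    by (auto simp: same_type_def)
  have "sat M (\<lambda>(s, j). d ! j) \<phi> = sat M (\<lambda>(s, j). d' ! j) \<phi>"
    if "\<phi> \<in> Fml M (set (tuple_vars ss)) C" for \<phi>
    using that by (intro ss(3)[of "\<lambda>d. sat M (\<lambda>(s, j). d ! j) \<phi>"]) (auto simp: definable_iff)
  then show "ltp M d C = ltp M d' C"
    unfolding ltp_tup[OF ss(1)] ltp_tup[OF ss(2)] by blast
qed

lemma automorphism_tm_val:
  assumes "automorphism M g" and "asg M e"
  shows "tm_ok M t \<Longrightarrow> tm_params t = {} \<Longrightarrow> tm_val M (\<lambda>v. g (e v)) t = g (tm_val M e t)"
proof (induction t)
  case (Fn f ts)
  have ok: "tm_val M e t \<in> univ M \<and> srt M (tm_val M e t) = tm_sort M t" if "t \<in> set ts" for t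
    using that Fn.prems by (intro tm_val_ok[OF str assms(2)]) auto
  have "map (tm_val M (\<lambda>v. g (e v))) ts = map g (map (tm_val M e) ts)"
    using Fn by auto
  moreover have "set (map (tm_val M e) ts) \<subseteq> univ M" using ok by auto
  moreover have "map (srt M) (map (tm_val M e) ts) = map (tm_sort M) ts" using ok by simp
  then have "map (srt M) (map (tm_val M e) ts) = fdom M f" using Fn.prems by (simp del: map_map)
  ultimately show ?case using assms(1) by (simp add: automorphism_def del: map_map set_map)
qed auto

lemma automorphism_sat:
  assumes "automorphism M g"
  shows "asg M e \<Longrightarrow> fm_ok M \<phi> \<Longrightarrow> params \<phi> = {} \<Longrightarrow> sat M (\<lambda>v. g (e v)) \<phi> = sat M e \<phi>"
proof (induction \<phi> arbitrary: e)
  case (Eq t u)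
  have "tm_val M e t \<in> univ M" "tm_val M e u \<in> univ M"
    using tm_val_ok[OF str Eq(1)] Eq by auto
  moreover have "inj_on g (univ M)" using assms by (auto simp: automorphism_def bij_betw_def)
  ultimately show ?case using Eq automorphism_tm_val[OF assms Eq(1)] by (auto dest: inj_onD)
next
  case (Rel r ts)
  have ok: "tm_val M e t \<in> univ M \<and> srt M (tm_val M e t) = tm_sort M t" if "t \<in> set ts" for t
    using that Rel.prems by (intro tm_val_ok[OF str Rel.prems(1)]) auto
  have "map (tm_val M (\<lambda>v. g (e v))) ts = map g (map (tm_val M e) ts)"
    using Rel automorphism_tm_val[OF assms Rel(1)] by auto
  moreover have "set (map (tm_val M e) ts) \<subseteq> univ M" using ok by auto
  moreover have "map (srt M) (map (tm_val M e) ts) = map (tm_sort M) ts" using ok by simp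
  then have "map (srt M) (map (tm_val M e) ts) = rdom M r" using Rel.prems by (simp del: map_map)
  ultimately show ?case using assms by (simp add: automorphism_def del: map_map set_map)
next
  case (Ex x \<phi>)
  have g: "bij_betw g (univ M) (univ M)" "\<And>m. m \<in> univ M \<Longrightarrow> srt M (g m) = srt M m"
    using assms by (auto simp: automorphism_def)
  have step: "sat M ((\<lambda>v. g (e v))(x := g m)) \<phi> = sat M (e(x := m)) \<phi>"
    if "m \<in> univ M" "srt M m = fst x" for m
  proof -
    have "asg M (e(x := m))" using Ex.prems that by (auto simp: asg_def)
    then have "sat M (\<lambda>v. g ((e(x := m)) v)) \<phi> = sat M (e(x := m)) \<phi>"
      using Ex.prems \<open>asg M (e(x := m))\<close> by (intro Ex.IH) (simp_all del: fun_upd_apply)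
    moreover have "(\<lambda>v. g ((e(x := m)) v)) = (\<lambda>v. g (e v))(x := g m)" by auto
    ultimately show ?thesis by simp
  qed
  have "(\<exists>m\<in>univ M. srt M m = fst x \<and> sat M ((\<lambda>v. g (e v))(x := m)) \<phi>) =
      (\<exists>m\<in>univ M. srt M (g m) = fst x \<and> sat M ((\<lambda>v. g (e v))(x := g m)) \<phi>)"
    (is "?l = ?r")
  proof
    assume ?l
    then obtain m where m: "m \<in> univ M" "srt M m = fst x" "sat M ((\<lambda>v. g (e v))(x := m)) \<phi>" by blast
    then obtain m' where "m' \<in> univ M" "m = g m'" using bij_betw_imp_surj_on[OF g(1)] by blast
    with m show ?r by blast
  next
    assume ?r
    then show ?l using bij_betw_imp_surj_on[OF g(1)] by blast
  qed
  also have "\<dots> = (\<exists>m\<in>univ M. srt M m = fst x \<and> sat M (e(x := m)) \<phi>)"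
    using g(2) step by auto
  finally show ?case by simp
qed auto

lemma automorphism_tup:
  assumes "automorphism M g" and "d \<in> tup ss"
  shows "map g d \<in> tup ss"
proof -
  have "\<forall>m\<in>univ M. g m \<in> univ M \<and> srt M (g m) = srt M m"
    using assms(1) by (auto simp: automorphism_def bij_betw_def)
  then show ?thesis using assms(2) by (auto simp: tup_def subset_iff)
qed

lemma automorphism_definable:
  assumes "automorphism M g" and "definable {} ss R" and "d \<in> tup ss"
  shows "R (map g d) = R d"
proof -
  from assms(2) obtain \<psi> where \<psi>: "\<psi> \<in> Fml M (set (tuple_vars ss)) {}"
    and s: "\<And>e. asg M e \<Longrightarrow> sat M e \<psi> = R (map e (tuple_vars ss))" by (auto simp: definable_def)
  obtain e where e: "asg M e" "map e (tuple_vars ss) = d" using asg_exists_tuple_vars[OF assms(3)] .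
  have "asg M (\<lambda>v. g (e v))" using e(1) assms(1)
    by (auto simp: asg_def automorphism_def bij_betw_def)
  from s[OF this] have "sat M (\<lambda>v. g (e v)) \<psi> = R (map g d)" using e(2) by (auto simp: comp_def)
  then show ?thesis using automorphism_sat[OF assms(1) e(1), of \<psi>] \<psi> s[OF e(1)] e(2)
    by (simp add: Fml_def)
qed

end

section \<open>The monster model\<close>

locale monster = fo_structure M
  for M :: "('s, 'f, 'r, 'm) struct" +
  fixes \<kappa> :: "'k rel"
  assumes card: "Card_order \<kappa>"
    and lang: "small \<kappa> (Fml M UNIV {})"
    and saturated: "saturated \<kappa> M"
    and homogeneous: "strongly_homogeneous \<kappa> M"
begin

lemma finite_ordLeq_infinite: "finite A \<Longrightarrow> infinite B \<Longrightarrow> |A| \<le>o |B|"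
  by (intro ordLess_imp_ordLeq finite_ordLess_infinite card_of_Well_order) (simp_all add: Field_card_of)

lemma image_ordLeq: "|A| \<le>o r \<Longrightarrow> |f ` A| \<le>o r"
  by (rule ordLeq_transitive[OF card_of_image])

lemma subset_ordLeq: "A \<subseteq> B \<Longrightarrow> |B| \<le>o r \<Longrightarrow> |A| \<le>o r"
  by (rule ordLeq_transitive[OF card_of_mono1])

lemma infinite_Fml: "infinite (Fml M UNIV {})"
proof -
  let ?f = "\<lambda>n. Eq (Var (undefined, n)) (Var (undefined, n))"
  have "inj ?f" by (auto simp: inj_on_def)
  then have "infinite (range ?f)" using finite_imageD infinite_UNIV_nat by blast
  moreover have "range ?f \<subseteq> Fml M UNIV {}" by (auto simp: Fml_def)
  ultimately show ?thesis using finite_subset by blast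
qed

lemma small_mono: "small \<kappa> B \<Longrightarrow> |A| \<le>o |B| \<Longrightarrow> small \<kappa> A"
  unfolding small_def by (rule ordLeq_ordLess_trans)

lemma small_image: "small \<kappa> B \<Longrightarrow> small \<kappa> (f ` B)"
  by (rule small_mono) (auto intro: card_of_image)

lemma infinite_\<kappa>: "infinite (Field \<kappa>)"
proof
  assume "finite (Field \<kappa>)"
  moreover have "|Fml M UNIV {}| \<le>o |Field \<kappa>|"
    using lang card unfolding small_def
    by (metis card_of_Field_ordIso ordLess_imp_ordLeq ordLess_ordIso_trans ordIso_symmetric)
  ultimately show False using infinite_Fml card_of_ordLeq_finite by blast
qed

lemma small_Plus: "small \<kappa> A \<Longrightarrow> small \<kappa> B \<Longrightarrow> small \<kappa> (A <+> B)"
  unfolding small_def using card infinite_\<kappa>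
  by (metis card_of_Plus_ordLess_infinite_Field)

lemma small_Un: "small \<kappa> A \<Longrightarrow> small \<kappa> B \<Longrightarrow> small \<kappa> (A \<union> B)"
  unfolding small_def using card infinite_\<kappa>
  by (metis card_of_Un_ordLess_infinite_Field)

lemma small_finite: "finite A \<Longrightarrow> small \<kappa> A"
  by (rule small_mono[OF lang]) (use infinite_Fml in \<open>auto intro: finite_ordLeq_infinite\<close>)

lemma small_countable: 
  fixes A :: "nat \<Rightarrow> 'a set"
  assumes "\<And>n. finite (A n)"
  shows "small \<kappa> (\<Union>n. A n)"
proof (rule small_mono[OF lang])
  show "|\<Union>n. A n| \<le>o |Fml M UNIV {}|"
  proof (rule card_of_UNION_ordLeq_infinite[OF infinite_Fml])
    show "|UNIV :: nat set| \<le>o |Fml M UNIV {}|"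
      using infinite_Fml by (simp add: infinite_iff_card_of_nat)
    show "\<forall>n\<in>UNIV. |A n| \<le>o |Fml M UNIV {}|"
      using assms infinite_Fml by (auto intro: finite_ordLeq_infinite)
  qed
qed

text \<open>Saturation only speaks of one variable. A first coordinate is found by projecting all finite
  conjunctions to it; it becomes a parameter, and the other coordinates follow by induction.\<close>

lemma compactness:
  assumes "small \<kappa> C" and "C \<subseteq> univ M" and "\<And>R. R \<in> F \<Longrightarrow> definable C ss R"
    and "\<And>F0. F0 \<subseteq> F \<Longrightarrow> finite F0 \<Longrightarrow> \<exists>d\<in>tup ss. \<forall>R\<in>F0. R d"
  shows "\<exists>d\<in>tup ss. \<forall>R\<in>F. R d"
  using assms
proof (induction ss arbitrary: C F)
  case Nil
  have "R []" if "R \<in> F" for R using Nil.prems(4)[of "{R}"] that by auto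
  then show ?case by (intro bexI[of _ "[]"]) auto
next
  case (Cons s ss)
  let ?E = "\<lambda>F0 x. \<exists>d'\<in>tup ss. \<forall>R\<in>F0. R (x @ d')"
  let ?P = "{F0. F0 \<subseteq> F \<and> finite F0}"
  let ?Q = "\<lambda>F0 \<psi>. \<psi> \<in> Fml M (set (tuple_vars [s])) C \<and>
    (\<forall>e. asg M e \<longrightarrow> sat M e \<psi> = ?E F0 (map e (tuple_vars [s])))"
  have "\<forall>F0\<in>?P. \<exists>\<psi>. ?Q F0 \<psi>"
  proof
    fix F0 assume that: "F0 \<in> ?P"
    have "definable C ([s] @ ss) (\<lambda>d. \<forall>R\<in>F0. R d)"
      using that Cons.prems(3) by (intro definable_Ball) auto
    from definable_ex[OF this] show "\<exists>\<psi>. ?Q F0 \<psi>" unfolding definable_def by blast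
  qed
  from bchoice[OF this] obtain \<psi> where "\<forall>F0\<in>?P. ?Q F0 (\<psi> F0)" ..
  then have \<psi>: "\<And>F0. F0 \<in> ?P \<Longrightarrow> \<psi> F0 \<in> Fml M (set (tuple_vars [s])) C"
    and s: "\<And>F0 e. F0 \<in> ?P \<Longrightarrow> asg M e \<Longrightarrow> sat M e (\<psi> F0) = ?E F0 (map e (tuple_vars [s]))"
    by blast+
  have tuple_vars1: "tuple_vars [s] = [(s, 0)]" by (simp add: tuple_vars_def)
  have "consistent M p0" if p0: "p0 \<subseteq> \<psi> ` ?P" "finite p0" for p0
  proof -
    obtain G where G: "G \<subseteq> ?P" "finite G" "p0 = \<psi> ` G"
      using finite_subset_image[OF p0(2,1)] by blast
    then have "\<Union>G \<subseteq> F" "finite (\<Union>G)" by auto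
    from Cons.prems(4)[OF this] obtain d where d: "d \<in> tup (s # ss)" "\<forall>R\<in>\<Union>G. R d" by blast
    obtain x d' where x: "d = [x] @ d'" "[x] \<in> tup [s]" "d' \<in> tup ss"
      using d(1) tup_split[of d "[s]" ss] by (auto simp: tup_single)
    obtain e where e: "asg M e" "map e (tuple_vars [s]) = [x]"
      using asg_exists_tuple_vars[OF x(2)] .
    have "sat M e (\<psi> F0)" if "F0 \<in> G" for F0
    proof -
      have "F0 \<in> ?P" using G(1) that by blast
      from s[OF this e(1)] show ?thesis using d(2) x that by (auto simp: e(2))
    qed
    then show ?thesis using e(1) G(3) by (auto simp: consistent_def)
  qed
  moreover have "\<psi> ` ?P \<subseteq> Fml M {(s, 0)} C" using \<psi> tuple_vars1 by auto
  ultimately have "consistent M (\<psi> ` ?P)"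
    using saturated Cons.prems(1,2) unfolding saturated_def by blast
  then obtain e where e: "asg M e" "\<And>F0. F0 \<in> ?P \<Longrightarrow> sat M e (\<psi> F0)"
    by (auto simp: consistent_def)
  define x where "x = map e (tuple_vars [s])"
  have x: "x \<in> tup [s]" using tup_asg[OF e(1), of "tuple_vars [s]"] by (simp add: x_def)
  have E: "?E F0 x" if "F0 \<in> ?P" for F0 using s[OF that e(1)] e(2)[OF that] by (simp add: x_def)
  let ?F = "(\<lambda>R d'. R (x @ d')) ` F"
  have "\<exists>d\<in>tup ss. \<forall>R\<in>?F. R d"
  proof (rule Cons.IH)
    show "small \<kappa> (C \<union> set x)" using Cons.prems(1) by (simp add: small_Un small_finite)
    show "C \<union> set x \<subseteq> univ M" using Cons.prems(2) tup_univ[OF x] by auto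
    show "definable (C \<union> set x) ss R" if "R \<in> ?F" for R
    proof -
      from that obtain R' where "R' \<in> F" "R = (\<lambda>d'. R' (x @ d'))" by blast
      moreover from this have "definable C ([s] @ ss) R'" using Cons.prems(3) by simp
      ultimately show ?thesis using definable_section_left[OF _ x] by simp
    qed
    fix F0 assume "F0 \<subseteq> ?F" "finite F0"
    then obtain G where "G \<subseteq> F" "finite G" "F0 = (\<lambda>R d'. R (x @ d')) ` G"
      using finite_subset_image by metis
    then show "\<exists>d\<in>tup ss. \<forall>R\<in>F0. R d" using E[of G] by auto
  qed
  then obtain d where "d \<in> tup ss" "\<forall>R\<in>F. R (x @ d)" by auto
  then show ?case using tup_append[OF x, of d ss] by (intro bexI[of _ "x @ d"]) auto
qed

text \<open>Strong homogeneity is about maps on sets. The assignment of the entries of \<open>d\<close> to those of \<open>c\<close>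
  is such a map, and extends by the identity on \<open>B\<close>, because the type of \<open>c\<close> over \<open>B\<close> decides
  which entries coincide with each other or with an element of \<open>B\<close>.\<close>

lemma automorphism_exists:
  assumes B: "B \<subseteq> univ M" "small \<kappa> B" and same_type: "same_type B c d"
  obtains g where "automorphism M g" and "\<And>b. b \<in> B \<Longrightarrow> g b = b" and "map g c = d"
proof -
  from same_type obtain ss where ss: "c \<in> tup ss" "d \<in> tup ss" by (auto simp: same_type_def)
  have len: "length c = length ss" "length d = length ss" using ss by (simp_all add: tup_length)
  define h where "h x = (if x \<in> B then x else d ! (SOME i. i < length c \<and> c ! i = x))" for x
  have hB: "h b = b" if "b \<in> B" for b using that by (simp add: h_def)
  have hc: "h (c ! i) = d ! i" if i: "i < length c" for i
  proof (cases "c ! i \<in> B")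
    case True
    have ci: "set [c ! i] \<subseteq> univ M" using tup_univ[OF ss(1)] i by auto
    from same_type_append[OF same_type _ ci] True have "same_type B (c @ [c ! i]) (d @ [c ! i])"
      by simp
    moreover have ct: "c @ [c ! i] \<in> tup (ss @ [srt M (c ! i)])"
      using ss(1) ci by (auto simp: tup_snoc)
    moreover have "ss ! i = srt M (c ! i)" using tup_srt[OF ss(1)] i by auto
    then have "definable B (ss @ [srt M (c ! i)]) (\<lambda>x. x ! i = x ! length ss)"
      using i len by (intro definable_eq) (auto simp: nth_append)
    ultimately have "((c @ [c ! i]) ! i = (c @ [c ! i]) ! length ss) =
       ((d @ [c ! i]) ! i = (d @ [c ! i]) ! length ss)" by (rule same_typeD(2))
    then show ?thesis using True i len hB by (simp add: nth_append)
  next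
    case False
    define k where "k = (SOME k. k < length c \<and> c ! k = c ! i)"
    have k: "k < length c \<and> c ! k = c ! i" unfolding k_def by (rule someI[of _ i]) (simp add: i)
    have "ss ! k = ss ! i" using tup_srt[OF ss(1)] i k by (metis nth_map)
    then have "definable B ss (\<lambda>x. x ! k = x ! i)" using i k len by (intro definable_eq) auto
    from same_typeD(2)[OF same_type ss(1) this] have "d ! k = d ! i" using k by simp
    then show ?thesis using False by (simp add: h_def k_def)
  qed
  let ?A = "B \<union> set c"
  have "ltp M (map h l) {} = ltp M l {}" if l: "set l \<subseteq> ?A" for l
  proof -
    let ?p = "filter (\<lambda>x. x \<in> B) l"
    have lp: "set l \<subseteq> set (c @ ?p)" using l by auto
    then have "\<forall>x. \<exists>i. x \<in> set l \<longrightarrow> i < length (c @ ?p) \<and> (c @ ?p) ! i = x"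
      using lp by (metis in_set_conv_nth subsetD)
    then obtain idx where idx: "\<And>x. x \<in> set l \<Longrightarrow> idx x < length (c @ ?p) \<and> (c @ ?p) ! idx x = x"
      by metis
    have pB: "set ?p \<subseteq> B" by auto
    have e1: "same_type B (c @ ?p) (d @ ?p)"
      using pB B(1) by (intro same_type_append[OF same_type]) auto
    have l1: "map ((!) (c @ ?p)) (map idx l) = l" using idx by (simp add: map_idI)
    have hcp: "h ((c @ ?p) ! i) = (d @ ?p) ! i" if "i < length (c @ ?p)" for i
    proof (cases "i < length c")
      case True
      then show ?thesis using hc[of i] len by (simp add: nth_append)
    next
      case False
      then have "?p ! (i - length c) \<in> set ?p" using that by (intro nth_mem) auto
      then have "?p ! (i - length c) \<in> B" using pB by blast
      then show ?thesis using False hB len by (simp add: nth_append)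
    qed
    have "(d @ ?p) ! idx x = h x" if "x \<in> set l" for x
      using hcp[of "idx x"] idx[OF that] by metis
    then have l2: "map ((!) (d @ ?p)) (map idx l) = map h l" by simp
    have "same_type B l (map h l)"
      using same_type_pull[OF e1, of "map idx l"] idx unfolding l1 l2 by auto
    then have "same_type {} (map h l) l" using same_type_mono same_type_sym by blast
    moreover have "set l \<subseteq> univ M" "set (map h l) \<subseteq> univ M"
      using \<open>same_type B l (map h l)\<close> tup_univ unfolding same_type_def by blast+
    ultimately show ?thesis using ltp_eq_iff by blast
  qed
  moreover have "?A \<subseteq> univ M" using B tup_univ[OF ss(1)] by auto
  moreover have "small \<kappa> ?A" using B(2) by (simp add: small_Un small_finite)
  moreover have "h ` ?A \<subseteq> univ M"
  proof -
    have "h x \<in> univ M" if x: "x \<in> set c" for x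
    proof -
      obtain i where "i < length c" "x = c ! i" using x by (auto simp: in_set_conv_nth)
      then show ?thesis using hc[of i] tup_univ[OF ss(2)] len by auto
    qed
    then show ?thesis using hB B(1) by auto
  qed
  ultimately obtain g where g: "automorphism M g" "\<And>a. a \<in> ?A \<Longrightarrow> g a = h a"
    using homogeneous unfolding strongly_homogeneous_def by metis
  have "map g c = d" using g(2) hc len by (intro nth_equalityI) auto
  then show thesis using that g hB by auto
qed

lemma lists_ordLeq_infinite:
  assumes "infinite K" and "|X| \<le>o |K|"
  shows "|lists X| \<le>o |K|"
proof -
  let ?L = "\<lambda>n. {l \<in> lists X. length l = n}"
  have L: "|?L n| \<le>o |K|" for n
  proof (induction n)
    case 0
    have "?L 0 = {[]}" by auto
    then show ?case using assms(1) by (simp add: finite_ordLeq_infinite)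
  next
    case (Suc n)
    have "?L (Suc n) \<subseteq> (\<lambda>(x, l). x # l) ` (X \<times> ?L n)"
    proof
      fix l assume "l \<in> ?L (Suc n)"
      then show "l \<in> (\<lambda>(x, l). x # l) ` (X \<times> ?L n)" by (cases l) auto
    qed
    moreover have "|X \<times> ?L n| \<le>o |K|"
      using assms Suc by (intro card_of_Sigma_ordLeq_infinite) auto
    ultimately show ?case by (rule subset_ordLeq[OF _ image_ordLeq])
  qed
  have "lists X = (\<Union>n. ?L n)" by auto
  moreover have "|\<Union>n. ?L n| \<le>o |K|"
    using assms(1) L by (intro card_of_UNION_ordLeq_infinite) (auto simp: infinite_iff_card_of_nat)
  ultimately show ?thesis by simp
qed

text \<open>The downward Loewenheim--Skolem theorem: \<open>B\<close> is closed \<open>\<omega>\<close> times under witnesses for formulas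
  \<open>\<exists>x. \<psi>(x, p)\<close>. The last property is the Tarski--Vaught test, for tuples.\<close>

lemma small_model:
  assumes "B \<subseteq> univ M" and "small \<kappa> B"
  obtains N where "B \<subseteq> N" and "N \<subseteq> univ M" and "small \<kappa> N"
    and "\<And>ss R. definable N ss R \<Longrightarrow> \<exists>d\<in>tup ss. R d \<Longrightarrow> \<exists>d\<in>tup ss. set d \<subseteq> N \<and> R d"
proof -
  \<comment> \<open>The formula \<open>Ex v \<psi>\<close> codes both \<open>\<psi>\<close> and the sort of the witness.\<close>
  define w where "w = (\<lambda>(\<chi> :: ('s, 'f, 'r, 'm) fm, p). SOME m.
    case \<chi> of Ex v \<psi> \<Rightarrow> m \<in> univ M \<and> srt M m = fst v \<and> sat M (\<lambda>(s, j). (m # p) ! j) \<psi> | _ \<Rightarrow> False)"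
  define S where "S X = X \<union> w ` (Fml M UNIV {} \<times> lists X) \<inter> univ M" for X
  define N where "N = (\<Union>n. (S ^^ n) B)"
  define K where "K = Fml M UNIV {} <+> B"
  have K: "infinite K" "small \<kappa> K"
    using infinite_Fml small_Plus[OF lang assms(2)] by (auto simp: K_def)
  have "|(S ^^ n) B| \<le>o |K|" for n
  proof (induction n)
    case 0
    show ?case using card_of_Plus2 by (simp add: K_def)
  next
    case (Suc n)
    let ?X = "(S ^^ n) B"
    have "|Fml M UNIV {} \<times> lists ?X| \<le>o |K|"
      using K(1) lists_ordLeq_infinite[OF K(1) Suc] card_of_Plus1
      by (intro card_of_Sigma_ordLeq_infinite) (auto simp: K_def)
    then have "|w ` (Fml M UNIV {} \<times> lists ?X) \<inter> univ M| \<le>o |K|"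
      by (rule subset_ordLeq[OF Int_lower1 image_ordLeq])
    then have "|S ?X| \<le>o |K|"
      unfolding S_def[of ?X] using K(1) Suc
      by (intro card_of_Un_ordLeq_infinite_Field[of "|K|"])
        (simp_all only: Field_card_of card_of_card_order_on not_False_eq_True)
    then show ?case by simp
  qed
  then have "|N| \<le>o |K|"
    using K(1) unfolding N_def
    by (intro card_of_UNION_ordLeq_infinite) (auto simp: infinite_iff_card_of_nat)
  then have "small \<kappa> N" by (rule small_mono[OF K(2)])
  have "(S ^^ n) B \<subseteq> univ M" for n using assms(1) by (induction n) (auto simp: S_def)
  then have NM: "N \<subseteq> univ M" by (auto simp: N_def)
  have BN: "B \<subseteq> N" unfolding N_def by (auto intro!: exI[of _ 0])
  have mono: "(S ^^ m) B \<subseteq> (S ^^ n) B" if "m \<le> n" for m n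
    using that by (induction rule: dec_induct) (auto simp: S_def)
  have stage: "\<exists>n. set p \<subseteq> (S ^^ n) B" if "set p \<subseteq> N" for p
    using that
  proof (induction p)
    case (Cons x p)
    then obtain m n where "x \<in> (S ^^ m) B" "set p \<subseteq> (S ^^ n) B" by (auto simp: N_def)
    then have "set (x # p) \<subseteq> (S ^^ max m n) B"
      using mono[of m "max m n"] mono[of n "max m n"] by auto
    then show ?case by blast
  qed auto
  have one: "\<exists>x\<in>N. srt M x = s \<and> R [x]" if R: "definable N [s] R" and ex: "\<exists>d\<in>tup [s]. R d" for s R
  proof -
    obtain p R0 where p: "set p \<subseteq> N" "set p \<subseteq> univ M" "definable {} ([s] @ map (srt M) p) R0"
      "\<And>d. d \<in> tup [s] \<Longrightarrow> R d = R0 (d @ p)" using definable_parameters[OF R] by metis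
    from p(3) obtain \<psi> where \<psi>: "\<psi> \<in> Fml M (set (tuple_vars ([s] @ map (srt M) p))) {}"
      "\<And>d. d \<in> tup ([s] @ map (srt M) p) \<Longrightarrow> sat M (\<lambda>(s, j). d ! j) \<psi> = R0 d"
        by (auto simp: definable_iff)
    have sat: "sat M (\<lambda>(s, j). (m # p) ! j) \<psi> = R [m]" if "m \<in> univ M" "srt M m = s" for m
    proof -
      have "[m] \<in> tup [s]" using that by (simp add: tup_single)
      moreover from this have "[m] @ p \<in> tup ([s] @ map (srt M) p)" using tup_self[OF p(2)] by blast
      ultimately show ?thesis using \<psi>(2) p(4) by fastforce
    qed
    let ?\<chi> = "Ex (s, 0) \<psi>"
    have \<chi>: "?\<chi> \<in> Fml M UNIV {}" using \<psi>(1) by (auto simp: Fml_def)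
    have wit: "\<exists>m. m \<in> univ M \<and> srt M m = s \<and> sat M (\<lambda>(s, j). (m # p) ! j) \<psi>"
    proof -
      obtain m where "m \<in> univ M" "srt M m = s" "R [m]" using ex by (auto simp: tup_single)
      then show ?thesis using sat[of m] by blast
    qed
    have "w (?\<chi>, p) = (SOME m. m \<in> univ M \<and> srt M m = s \<and> sat M (\<lambda>(s, j). (m # p) ! j) \<psi>)"
      by (simp add: w_def)
    then have w: "w (?\<chi>, p) \<in> univ M \<and> srt M (w (?\<chi>, p)) = s \<and>
      sat M (\<lambda>(s, j). (w (?\<chi>, p) # p) ! j) \<psi>" by (simp only: someI_ex[OF wit])
    with sat have w: "w (?\<chi>, p) \<in> univ M" "srt M (w (?\<chi>, p)) = s" "R [w (?\<chi>, p)]" by blast+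
    obtain n where "set p \<subseteq> (S ^^ n) B" using stage[OF p(1)] by blast
    then have "p \<in> lists ((S ^^ n) B)" by (simp add: in_lists_conv_set subset_iff)
    then have "w (?\<chi>, p) \<in> (S ^^ Suc n) B" using w(1) \<chi> by (auto simp: S_def)
    then show ?thesis using w unfolding N_def by blast
  qed
  have "\<exists>d\<in>tup ss. set d \<subseteq> N \<and> R d" if "definable N ss R" "\<exists>d\<in>tup ss. R d" for ss R
    using that
  proof (induction ss arbitrary: R)
    case (Cons s ss)
    have R: "definable N ([s] @ ss) R" using Cons.prems(1) by simp
    have "\<exists>x\<in>tup [s]. \<exists>d\<in>tup ss. R (x @ d)"
      using Cons.prems(2) tup_split[of _ "[s]" ss] by fastforce
    then obtain x where x: "x \<in> N" "srt M x = s" "\<exists>d\<in>tup ss. R ([x] @ d)"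
      using one[OF definable_ex[OF R]] by blast
    have "[x] \<in> tup [s]" using x NM by (auto simp: tup_single)
    from definable_section_left[OF R this] have "definable N ss (\<lambda>d. R ([x] @ d))"
      using x(1) by (simp add: insert_absorb)
    from Cons.IH[OF this x(3)] obtain d where "d \<in> tup ss" "set d \<subseteq> N" "R ([x] @ d)" by blast
    then show ?case using x NM by (intro bexI[of _ "x # d"]) (auto simp: tup_Cons)
  qed auto
  then show thesis using that BN NM \<open>small \<kappa> N\<close> by blast
qed

end

section \<open>Global types and their Morley sequences\<close>

context fo_structure
begin

text \<open>A global type is represented by an ultrafilter on the set of tuples. A definable relation belongs to
  the type iff it holds eventually, and different ultrafilters may represent the same type.\<close>

definition global_type :: "'s list \<Rightarrow> 'm list filter \<Rightarrow> bool" where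
  "global_type ss W \<longleftrightarrow> ultra W \<and> eventually (\<lambda>h. h \<in> tup ss) W"

definition realizes :: "'m list filter \<Rightarrow> 's list \<Rightarrow> 'm set \<Rightarrow> 'm list \<Rightarrow> bool" where
  "realizes W ss C g \<longleftrightarrow> g \<in> tup ss \<and> (\<forall>R. definable C ss R \<and> eventually R W \<longrightarrow> R g)"

definition invariant :: "'m list filter \<Rightarrow> 's list \<Rightarrow> 'm set \<Rightarrow> bool" where
  "invariant W ss N \<longleftrightarrow>
     (\<forall>us R u v. definable {} (ss @ us) R \<and> u \<in> tup us \<and> same_type N u v \<longrightarrow>
        eventually (\<lambda>h. R (h @ u)) W = eventually (\<lambda>h. R (h @ v)) W)"

definition morley_list :: "'m list filter \<Rightarrow> 's list \<Rightarrow> 'm set \<Rightarrow> 'm list list \<Rightarrow> bool" where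
  "morley_list W ss N gs \<longleftrightarrow>
     (\<forall>i<length gs. realizes W ss (N \<union> set (concat (take i gs))) (gs ! i))"

definition morley_seq :: "'m list filter \<Rightarrow> 's list \<Rightarrow> 'm set \<Rightarrow> (nat \<Rightarrow> 'm list) \<Rightarrow> bool" where
  "morley_seq W ss N c \<longleftrightarrow> (\<forall>i. realizes W ss (N \<union> (\<Union>j<i. set (c j))) (c i))"

lemma realizes_tup: "realizes W ss C g \<Longrightarrow> g \<in> tup ss"
  by (simp add: realizes_def)

lemma realizes_mono: "realizes W ss C g \<Longrightarrow> C' \<subseteq> C \<Longrightarrow> realizes W ss C' g"
  unfolding realizes_def using definable_mono by blast

lemma global_type_ev_cong:
  assumes "global_type ss W" and "\<And>h. h \<in> tup ss \<Longrightarrow> P h = Q h"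
  shows "eventually P W = eventually Q W"
  using assms(1) by (intro eventually_cong[of "\<lambda>h. h \<in> tup ss"]) (auto simp: global_type_def assms(2))

lemma global_type_ex: "global_type ss W \<Longrightarrow> eventually P W \<Longrightarrow> \<exists>h\<in>tup ss. P h"
  using eventually_happens'[of W "\<lambda>h. h \<in> tup ss \<and> P h"]
  by (auto simp: global_type_def ultra_def eventually_conj)

lemma realizes_iff:
  assumes "global_type ss W" and "realizes W ss C g" and "definable C ss R"
  shows "R g = eventually R W"
  using assms definable_not[OF assms(3)] by (auto simp: global_type_def ultra_def realizes_def)

lemma morley_list_snoc:
  "morley_list W ss N (gs @ [u]) \<longleftrightarrow>
     morley_list W ss N gs \<and> realizes W ss (N \<union> set (concat gs)) u"
proof
  assume m: "morley_list W ss N (gs @ [u])"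
  have "realizes W ss (N \<union> set (concat (take i gs))) (gs ! i)" if "i < length gs" for i
    using m[unfolded morley_list_def, rule_format, of i] that by (simp add: nth_append)
  moreover have "realizes W ss (N \<union> set (concat gs)) u"
    using m[unfolded morley_list_def, rule_format, of "length gs"] by simp
  ultimately show "morley_list W ss N gs \<and> realizes W ss (N \<union> set (concat gs)) u"
    by (simp add: morley_list_def)
next
  assume "morley_list W ss N gs \<and> realizes W ss (N \<union> set (concat gs)) u"
  then show "morley_list W ss N (gs @ [u])"
    by (auto simp: morley_list_def nth_append less_Suc_eq)
qed

text \<open>Whether \<open>R\<close> holds of a Morley list is decided by \<open>W\<close> and the type of all entries but the last,
  since \<open>W\<close> is invariant; so the type is determined by induction on the length.\<close>

lemma morley_list_same_type:
  assumes W: "global_type ss W" "invariant W ss N" and N: "N \<subseteq> univ M"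
  shows "morley_list W ss N gs \<Longrightarrow> morley_list W ss N gs' \<Longrightarrow> length gs = length gs' \<Longrightarrow>
    same_type N (concat gs) (concat gs')"
proof (induction gs arbitrary: gs' rule: rev_induct)
  case Nil
  then show ?case by (simp add: same_type_refl)
next
  case (snoc u gs)
  obtain fs v where gs': "gs' = fs @ [v]" using snoc.prems(3) by (cases gs' rule: rev_cases) auto
  let ?d = "concat gs" let ?d' = "concat fs"
  have m: "morley_list W ss N gs" "morley_list W ss N fs"
    and u: "realizes W ss (N \<union> set ?d) u" and v: "realizes W ss (N \<union> set ?d') v"
    using snoc.prems by (simp_all only: gs' morley_list_snoc)
  have eq: "same_type N ?d ?d'" using snoc.IH[OF m] snoc.prems(3) gs' by simp
  then obtain us where us: "?d \<in> tup us" "?d' \<in> tup us" by (auto simp: same_type_def)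
  note uv = realizes_tup[OF u] realizes_tup[OF v]
  have "R (?d @ u) = R (?d' @ v)" if R: "definable N (us @ ss) R" for R
  proof -
    obtain p R0 where p: "set p \<subseteq> N" "set p \<subseteq> univ M" "definable {} ((us @ ss) @ map (srt M) p) R0"
      and R0: "\<And>d. d \<in> tup (us @ ss) \<Longrightarrow> R d = R0 (d @ p)" using definable_parameters[OF R] by metis
    let ?ps = "map (srt M) p"
    let ?n = "length ss" and ?l = "length us"
    let ?f = "\<lambda>y. (take ?l (drop ?n y) @ take ?n y) @ drop (?n + ?l) y"
    let ?r = "([?n..<?n + ?l] @ [0..<?n]) @ [?n + ?l..<?n + ?l + length p]"
    have R1: "definable {} (ss @ us @ ?ps) (\<lambda>y. R0 (?f y))"
    proof (rule definable_pull[OF p(3)])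
      show "i < length (ss @ us @ ?ps)" if "i \<in> set ?r" for i using that by auto
      show "(us @ ss) @ ?ps = map ((!) (ss @ us @ ?ps)) ?r"
        by (intro nth_equalityI) (auto simp: nth_append add.commute)
      show "?f y = map ((!) y) ?r" if "y \<in> tup (ss @ us @ ?ps)" for y
        using tup_length[OF that] by (intro nth_equalityI) (auto simp: nth_append min_def)
    qed
    have f: "?f (h @ x @ p) = (x @ h) @ p" if "h \<in> tup ss" "x \<in> tup us" for h x
      using tup_length[OF that(1)] tup_length[OF that(2)] by simp
    have key: "R (x @ w) = eventually (\<lambda>h. R0 (?f (h @ x @ p))) W"
      if x: "x \<in> tup us" and w: "realizes W ss (N \<union> set x) w" for x w
    proof -
      have "definable (N \<union> set x) ss (\<lambda>h. R (x @ h))" by (rule definable_section_left[OF R x])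
      then have "R (x @ w) = eventually (\<lambda>h. R (x @ h)) W" by (rule realizes_iff[OF W(1) w])
      also have "\<dots> = eventually (\<lambda>h. R0 (?f (h @ x @ p))) W"
      proof (rule global_type_ev_cong[OF W(1)])
        fix h assume h: "h \<in> tup ss"
        then have "x @ h \<in> tup (us @ ss)" using x by blast
        then show "R (x @ h) = R0 (?f (h @ x @ p))" unfolding f[OF h x] by (rule R0)
      qed
      finally show ?thesis .
    qed
    have "same_type N (?d @ p) (?d' @ p)" by (rule same_type_append[OF eq p(1,2)])
    moreover have "?d @ p \<in> tup (us @ ?ps)" using us(1) tup_self[OF p(2)] by blast
    ultimately have "eventually (\<lambda>h. R0 (?f (h @ ?d @ p))) W = eventually (\<lambda>h. R0 (?f (h @ ?d' @ p))) W"
      using W(2) R1 unfolding invariant_def by blast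
    then show ?thesis using key[OF us(1) u] key[OF us(2) v] by simp
  qed
  then have "same_type N (?d @ u) (?d' @ v)" using us uv by (intro same_typeI[of _ "us @ ss"]) auto
  then show ?case by (simp add: gs')
qed

lemma indiscernible_iff:
  assumes "\<And>i. set (c i) \<subseteq> univ M"
  shows "indiscernible M B c \<longleftrightarrow>
    (\<forall>is js. length is = length js \<and> sorted_wrt (<) is \<and> sorted_wrt (<) js \<longrightarrow>
       same_type B (concat (map c is)) (concat (map c js)))"
proof -
  have "set (concat (map c l)) \<subseteq> univ M" for l using assms by auto
  then show ?thesis unfolding indiscernible_def using assms ltp_eq_iff by presburger
qed

lemma indiscernible_mono:
  assumes "indiscernible M B c" and "B' \<subseteq> B"
  shows "indiscernible M B' c"
proof -
  have "\<And>i. set (c i) \<subseteq> univ M" using assms(1) by (simp add: indiscernible_def)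
  note iff = indiscernible_iff[of c, OF this]
  show ?thesis using assms same_type_mono unfolding iff by blast
qed

lemma morley_seq_list:
  assumes "morley_seq W ss N c" and "sorted_wrt (<) is"
  shows "morley_list W ss N (map c is)"
  unfolding morley_list_def
proof (intro allI impI)
  fix i assume i: "i < length (map c is)"
  have "realizes W ss (N \<union> (\<Union>j<is ! i. set (c j))) (c (is ! i))"
    using assms(1) by (simp add: morley_seq_def)
  moreover have "x < is ! i" if "x \<in> set (take i is)" for x
    using that i assms(2) by (auto simp: in_set_conv_nth sorted_wrt_iff_nth_less)
  then have "set (concat (take i (map c is))) \<subseteq> (\<Union>j<is ! i. set (c j))"
    by (auto simp: take_map)
  ultimately show "realizes W ss (N \<union> set (concat (take i (map c is)))) (map c is ! i)"
    using i by (auto elim!: realizes_mono)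
qed

lemma morley_seq_indiscernible:
  assumes "global_type ss W" "invariant W ss N" "N \<subseteq> univ M" and "morley_seq W ss N c"
  shows "indiscernible M N c"
proof -
  have "set (c i) \<subseteq> univ M" for i
    using assms(4) tup_univ realizes_tup unfolding morley_seq_def by metis
  then show ?thesis
    using morley_list_same_type[OF assms(1-3)] morley_seq_list[OF assms(4)]
      by (simp add: indiscernible_iff)
qed

end

context monster
begin

lemma realizes_exists:
  assumes "global_type ss W" and "small \<kappa> C" and "C \<subseteq> univ M"
  obtains g where "realizes W ss C g"
proof -
  let ?F = "{R. definable C ss R \<and> eventually R W}"
  have "\<exists>d\<in>tup ss. \<forall>R\<in>?F. R d"
  proof (rule compactness[OF assms(2,3)])
    fix F0 assume F0: "F0 \<subseteq> ?F" "finite F0"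
    then have "eventually (\<lambda>h. \<forall>R\<in>F0. R h) W" by (intro eventually_ball_finite) auto
    then show "\<exists>d\<in>tup ss. \<forall>R\<in>F0. R d" by (rule global_type_ex[OF assms(1)])
  qed simp
  then show thesis using that by (auto simp: realizes_def)
qed

text \<open>Dependent choice along which the set of parameters grows but stays small; the sets \<open>supp x\<close> are
  the parameters that an element \<open>x\<close> contributes.\<close>

lemma sequence_exists:
  fixes P :: "'m set \<Rightarrow> 'x \<Rightarrow> bool" and supp :: "'x \<Rightarrow> 'm set"
  assumes "small \<kappa> C0" and "C0 \<subseteq> univ M"
    and ex: "\<forall>C. small \<kappa> C \<and> C \<subseteq> univ M \<longrightarrow> (\<exists>x. P C x)"
    and supp: "\<forall>C x. P C x \<longrightarrow> finite (supp x) \<and> supp x \<subseteq> univ M"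
  shows "\<exists>e :: nat \<Rightarrow> 'x. \<forall>n. P (C0 \<union> (\<Union>j<n. supp (e j))) (e n)"
proof -
  let ?P = "\<lambda>n z. small \<kappa> (fst z) \<and> fst z \<subseteq> univ M \<and> P (fst z) (snd z) \<and> (n = 0 \<longrightarrow> fst z = C0)"
  let ?Q = "\<lambda>(n::nat) z z'. fst z' = fst z \<union> supp (snd z)"
  have "\<exists>f. \<forall>n. ?P n (f n) \<and> ?Q n (f n) (f (Suc n))"
  proof (rule dependent_nat_choice)
    show "\<exists>x. ?P 0 x" using ex assms(1,2) by auto
    fix x :: "'m set \<times> 'x" and n :: nat assume x: "?P n x"
    let ?C = "fst x \<union> supp (snd x)"
    have "finite (supp (snd x)) \<and> supp (snd x) \<subseteq> univ M" using x supp by blast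
    then have "small \<kappa> ?C" "?C \<subseteq> univ M"
      using x by (simp_all add: small_Un small_finite)
    moreover from this ex obtain y where "P ?C y" by blast
    ultimately show "\<exists>y. ?P (Suc n) y \<and> ?Q n x y"
      by (intro exI[of _ "(?C, y)"]) simp
  qed
  then obtain f where f: "\<forall>n. ?P n (f n) \<and> ?Q n (f n) (f (Suc n))" ..
  have "fst (f n) = C0 \<union> (\<Union>j<n. supp (snd (f j)))" for n
  proof (induction n)
    case 0
    show ?case using f by simp
  next
    case (Suc n)
    have "fst (f (Suc n)) = fst (f n) \<union> supp (snd (f n))" using f by blast
    then show ?case using Suc by (auto simp: lessThan_Suc)
  qed
  moreover have "P (fst (f n)) (snd (f n))" for n using f by blast
  ultimately show ?thesis by (intro exI[of _ "\<lambda>n. snd (f n)"]) simp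
qed

end

section \<open>Alternation along indiscernible sequences\<close>

context fo_structure
begin

lemma block_concat:
  assumes "\<And>g. g \<in> set gs \<Longrightarrow> length g = m" and "i < length gs"
  shows "take m (drop (i * m) (concat gs)) = gs ! i"
  using assms
proof (induction gs arbitrary: i)
  case (Cons g gs)
  show ?case
  proof (cases i)
    case 0
    then show ?thesis using Cons.prems by simp
  next
    case (Suc j)
    then show ?thesis using Cons by simp
  qed
qed simp

lemma length_concat_replicate: "length (concat (replicate n ts)) = n * length ts"
  by (induction n) auto

lemma nth_concat_replicate:
  "i < n \<Longrightarrow> l < length ts \<Longrightarrow> concat (replicate n ts) ! (i * length ts + l) = ts ! l"
proof (induction n arbitrary: i)
  case (Suc n)
  then show ?case by (cases i) (auto simp: nth_append)
qed simp

lemma block_bound: "i < n \<Longrightarrow> i * m + m \<le> n * (m::nat)"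
  by (metis Suc_leI add.commute mult_Suc mult_le_mono1)

lemma definable_block:
  assumes "definable C ts R" and "i < n"
  shows "definable C (concat (replicate n ts)) (\<lambda>d. R (take (length ts) (drop (i * length ts) d)))"
proof (rule definable_pull[OF assms(1)])
  let ?m = "length ts"
  let ?r = "map (\<lambda>l. i * ?m + l) [0..<?m]"
  have b: "i * ?m + ?m \<le> n * ?m" by (rule block_bound[OF assms(2)])
  show "l < length (concat (replicate n ts))" if "l \<in> set ?r" for l
    using that b by (auto simp: length_concat_replicate)
  show "ts = map ((!) (concat (replicate n ts))) ?r"
    using assms(2) by (intro nth_equalityI) (auto simp: nth_concat_replicate)
  show "take ?m (drop (i * ?m) d) = map ((!) d) ?r" if "d \<in> tup (concat (replicate n ts))" for d
  proof (cases "?m = 0")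
    case False
    have "length (take ?m (drop (i * ?m) d)) = ?m"
      using tup_length[OF that] b by (simp add: length_concat_replicate)
    then show ?thesis by (intro nth_equalityI) auto
  qed simp
qed

lemma definable_pattern:
  assumes "definable {} (ss @ ts) R"
  shows "definable {} (concat (replicate n ts))
    (\<lambda>d. \<exists>x\<in>tup ss. \<forall>i<n. R (x @ take (length ts) (drop (i * length ts) d)) = b i)"
proof -
  let ?m = "length ts"
  let ?nn = "concat (replicate n ts)"
  let ?f = "\<lambda>i y. drop (n * ?m) y @ take ?m (drop (i * ?m) y)"
  have "definable {} (?nn @ ss) (\<lambda>y. R (?f i y))" if i: "i < n" for i
  proof (rule definable_pull[OF assms])
    let ?r = "map (\<lambda>l. n * ?m + l) [0..<length ss] @ map (\<lambda>l. i * ?m + l) [0..<?m]"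
    have b: "i * ?m + ?m \<le> n * ?m" by (rule block_bound[OF i])
    show "l < length (?nn @ ss)" if "l \<in> set ?r" for l
      using that b by (auto simp: length_concat_replicate)
    show "ss @ ts = map ((!) (?nn @ ss)) ?r"
    proof (rule nth_equalityI)
      fix l assume l: "l < length (ss @ ts)"
      show "(ss @ ts) ! l = map ((!) (?nn @ ss)) ?r ! l"
      proof (cases "l < length ss")
        case False
        then obtain l' where l': "l = length ss + l'" "l' < ?m" using l by (metis add.commute
            add_less_cancel_left le_Suc_ex length_append not_less)
        then have "i * ?m + l' < n * ?m" using b by simp
        then show ?thesis using l' i
          by (simp add: nth_append length_concat_replicate nth_concat_replicate)
      qed (simp add: nth_append length_concat_replicate)
    qed simp
    show "?f i y = map ((!) y) ?r" if y: "y \<in> tup (?nn @ ss)" for y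
    proof -
      have len: "length y = n * ?m + length ss"
        using tup_length[OF y] by (simp add: length_concat_replicate)
      have "length (take ?m (drop (i * ?m) y)) = ?m" using len b by simp
      then show ?thesis using len by (intro nth_equalityI) (auto simp: nth_append)
    qed
  qed
  then have "definable {} (?nn @ ss) (\<lambda>y. \<forall>i\<in>{..<n}. R (?f i y) = b i)"
    by (intro definable_Ball definable_iff_const) auto
  from definable_ex[OF this] have "definable {} ?nn (\<lambda>d. \<exists>x\<in>tup ss. \<forall>i\<in>{..<n}. R (?f i (d @ x)) = b i)" .
  moreover have "?f i (d @ x) = x @ take ?m (drop (i * ?m) d)"
    if d: "d \<in> tup ?nn" and i: "i < n" for d x i
  proof -
    have "i * ?m + ?m \<le> n * ?m" by (rule block_bound[OF i])
    then show ?thesis using tup_length[OF d] by (simp add: length_concat_replicate)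
  qed
  ultimately show ?thesis by (subst definable_cong) auto
qed

text \<open>Whether a pattern \<open>b\<close> of truth values of \<open>R(x, -)\<close> along finitely many members of a sequence is
  realized is a definable property of these members, so it does not depend on their indices.\<close>

lemma indiscernible_pattern:
  assumes "definable {} (ss @ ts) R" and g: "\<And>i. g i \<in> tup ts" and ind: "indiscernible M {} g"
    and js: "sorted_wrt (<) js" "sorted_wrt (<) is" "length is = length js"
    and ex: "\<exists>x\<in>tup ss. \<forall>i<length js. R (x @ g (js ! i)) = b i"
  shows "\<exists>x\<in>tup ss. \<forall>i<length js. R (x @ g (is ! i)) = b i"
proof -
  let ?n = "length js" and ?m = "length ts"
  let ?E = "\<lambda>d. \<exists>x\<in>tup ss. \<forall>i<?n. R (x @ take ?m (drop (i * ?m) d)) = b i"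
  have E: "?E (concat (map g l)) \<longleftrightarrow> (\<exists>x\<in>tup ss. \<forall>i<?n. R (x @ g (l ! i)) = b i)"
    if "length l = ?n" for l
  proof -
    have "take ?m (drop (i * ?m) (concat (map g l))) = g (l ! i)" if "i < ?n" for i
      using that \<open>length l = ?n\<close> tup_length[OF g] by (subst block_concat) auto
    then show ?thesis by auto
  qed
  have gu: "set (g i) \<subseteq> univ M" for i using tup_univ[OF g] .
  have "same_type {} (concat (map g js)) (concat (map g is))"
    using ind js indiscernible_iff[of g, OF gu] by metis
  moreover have "concat (map g js) \<in> tup (concat (replicate ?n ts))"
    using tup_concat[of "map g js" ts] g by auto
  ultimately have "?E (concat (map g js)) = ?E (concat (map g is))"
    using definable_pattern[OF assms(1)] by (rule same_typeD(2))
  then show ?thesis using ex E js by simp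
qed

end

locale nip_monster = monster M \<kappa>
  for M :: "('s, 'f, 'r, 'm) struct" and \<kappa> :: "'k rel" +
  assumes dep: "dependent M"
begin

text \<open>If \<open>R(x, -)\<close> could alternate arbitrarily often along \<open>g\<close>, then for any set \<open>S\<close> the indices
  \<open>2 i\<close> (for \<open>i \<in> S\<close>) and \<open>2 i + 1\<close> (for \<open>i \<notin> S\<close>) select a subsequence on which \<open>R(x, -)\<close>
  follows \<open>S\<close>. Indiscernibility and compactness transfer this pattern to \<open>g\<close> itself, and \<open>R\<close> has the
  independence property.\<close>

lemma bounded_alternation:
  assumes R: "definable {} (ss @ ts) R" and g: "\<And>i. g i \<in> tup ts" and ind: "indiscernible M {} g"
  shows "\<exists>k. \<forall>x\<in>tup ss. \<exists>i<k. R (x @ g i) \<noteq> even i"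
proof (rule ccontr)
  assume "\<nexists>k. \<forall>x\<in>tup ss. \<exists>i<k. R (x @ g i) \<noteq> even i"
  then have alt: "\<exists>x\<in>tup ss. \<forall>i<k. R (x @ g i) = even i" for k by blast
  have fin: "\<exists>x\<in>tup ss. \<forall>i<n. R (x @ g i) = (i \<in> S)" for n and S :: "nat set"
  proof -
    let ?js = "map (\<lambda>i. 2 * i + (if i \<in> S then 0 else 1)) [0..<n]"
    obtain x where x: "x \<in> tup ss" "\<And>i. i < 2 * n \<Longrightarrow> R (x @ g i) = even i"
      using alt[of "2 * n"] by blast
    have "\<forall>i<length ?js. R (x @ g (?js ! i)) = (i \<in> S)" using x(2) by auto
    then have "\<exists>x\<in>tup ss. \<forall>i<length ?js. R (x @ g (?js ! i)) = (i \<in> S)" using x(1) by blast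
    moreover have "sorted_wrt (<) ?js" "sorted_wrt (<) [0..<n]" "length [0..<n] = length ?js"
      by (auto simp: sorted_wrt_iff_nth_less)
    ultimately have "\<exists>x\<in>tup ss. \<forall>i<length ?js. R (x @ g ([0..<n] ! i)) = (i \<in> S)"
      by (intro indiscernible_pattern[OF R g ind, of ?js "[0..<n]" "\<lambda>i. i \<in> S"])
    then show ?thesis by simp
  qed
  let ?C = "\<Union>i. set (g i)"
  have C: "small \<kappa> ?C" "?C \<subseteq> univ M" using tup_univ[OF g] by (auto intro: small_countable)
  have "\<exists>b\<in>tup ss. \<forall>i. R (b @ g i) = (i \<in> S)" for S
  proof -
    let ?f = "\<lambda>i x. R (x @ g i) = (i \<in> S)"
    have "\<exists>b\<in>tup ss. \<forall>P\<in>range ?f. P b"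
    proof (rule compactness[OF C])
      show "definable ?C ss P" if "P \<in> range ?f" for P
      proof -
        from that obtain i where "P = ?f i" by blast
        moreover have "definable ?C ss (\<lambda>x. R (x @ g i))"
          by (rule definable_mono[OF definable_section[OF R g]]) auto
        ultimately show ?thesis using definable_iff_const by simp
      qed
      fix F0 assume "F0 \<subseteq> range ?f" "finite F0"
      then obtain I where I: "finite I" "F0 = ?f ` I" by (meson finite_subset_image)
      then obtain n where "\<forall>i\<in>I. i < n" using finite_nat_set_iff_bounded by blast
      moreover obtain x where "x \<in> tup ss" "\<forall>i<n. ?f i x" using fin[of n S] by blast
      ultimately show "\<exists>d\<in>tup ss. \<forall>R\<in>F0. R d"
        using I(2) by (intro bexI[of _ x]) auto
    qed
    then show ?thesis by auto
  qed
  then obtain b where b: "\<And>S. b S \<in> tup ss" "\<And>S i. R (b S @ g i) = (i \<in> S)" by metis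
  let ?xs = "tuple_vars ts"
  let ?ys = "map (\<lambda>j. (ss ! j, length ts + j)) [0..<length ss]"
  have ysfst: "map fst ?ys = ss" by (auto intro: nth_equalityI)
  have dist: "distinct (?xs @ ?ys)" by (auto simp: distinct_map inj_on_def set_tuple_vars)
  obtain \<psi> where \<psi>: "\<psi> \<in> Fml M (set (?ys @ ?xs)) {}"
    and s: "\<And>e. asg M e \<Longrightarrow> sat M e \<psi> = R (map e (?ys @ ?xs))"
    using definable_formula[OF R, of "?ys @ ?xs"] ysfst by auto
  have "holds M \<psi> (?xs @ ?ys) (g i @ b S) \<longleftrightarrow> i \<in> S" for i S
  proof -
    have t: "g i @ b S \<in> tup (map fst (?xs @ ?ys))" using g b ysfst by (simp add: tup_append)
    obtain e where e: "asg M e" "map e (?xs @ ?ys) = g i @ b S" using asg_exists[OF dist t] .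
    have "holds M \<psi> (?xs @ ?ys) (g i @ b S) = sat M e \<psi>"
      unfolding holds_def e(2)[symmetric]
      using \<psi> by (intro sat_cong) (auto simp: map_of_zip_map Fml_def simp del: map_append)
    also have "\<dots> = R (map e ?ys @ map e ?xs)" using s[OF e(1)] by simp
    also have "map e ?ys @ map e ?xs = b S @ g i"
      using e(2) tup_length[OF g] by (simp add: append_eq_append_conv)
    finally show ?thesis using b by simp
  qed
  moreover have "g i \<in> tuples M ?xs" "b S \<in> tuples M ?ys" for i S
    using g b ysfst by (simp_all add: tuples_eq)
  ultimately have "independence_property M \<psi> ?xs ?ys"
    unfolding independence_property_def by blast
  moreover have "\<psi> \<in> Fml M (set ?xs \<union> set ?ys) {}" using \<psi> by (simp add: Un_commute)
  ultimately show False using dep dist unfolding dependent_def by blast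
qed

end

section \<open>Global types without dividing formulas\<close>

context fo_structure
begin

text \<open>\<open>W\<close> contains no formula that divides over \<open>A\<close>, expressed with relations; the link to formulas is
  made by \<open>nondividing_formula\<close> and \<open>row_nondividing\<close>.\<close>

definition nondividing :: "'m set \<Rightarrow> 's list \<Rightarrow> 'm list filter \<Rightarrow> bool" where
  "nondividing A ss W \<longleftrightarrow>
     (\<forall>ts R c d k. definable {} (ss @ ts) R \<and> c \<in> tup ts \<and> (\<forall>i::nat. same_type A c (d i)) \<and>
        (\<forall>S. finite S \<and> card S = k \<longrightarrow> \<not> (\<exists>h\<in>tup ss. \<forall>i\<in>S. R (h @ d i))) \<longrightarrow>
        eventually (\<lambda>h. \<not> R (h @ c)) W)"

lemma nondividingD:
  fixes d :: "nat \<Rightarrow> 'm list"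
  assumes "nondividing A ss W" and "definable {} (ss @ ts) R" and "c \<in> tup ts" and "\<And>i. same_type A c (d i)"
    and "\<And>S. finite S \<Longrightarrow> card S = k \<Longrightarrow> \<not> (\<exists>h\<in>tup ss. \<forall>i\<in>S. R (h @ d i))"
  shows "eventually (\<lambda>h. \<not> R (h @ c)) W"
  using assms unfolding nondividing_def by blast

lemma sat_inst:
  assumes e: "asg M e" and ys: "distinct ys" and c: "c \<in> tup (map fst ys)"
  obtains e' where "asg M e'" and "map e' ys = c" and "\<And>v. v \<notin> set ys \<Longrightarrow> e' v = e v"
    and "\<And>\<psi>. sat M e (inst ys c \<psi>) = sat M e' \<psi>"
proof -
  obtain e0 where e0: "asg M e0" "map e0 ys = c" using asg_exists[OF ys c] .
  let ?e = "\<lambda>v. if v \<in> set ys then e0 v else e v"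
  have "(\<lambda>v. case map_of (zip ys c) v of None \<Rightarrow> e v | Some m \<Rightarrow> m) = ?e"
    unfolding e0(2)[symmetric] by (rule ext) (simp add: map_of_zip_map)
  then have "sat M e (inst ys c \<psi>) = sat M ?e \<psi>" for \<psi> by (simp add: inst_def sat_subst)
  moreover have "asg M ?e" using e e0(1) by (simp add: asg_def)
  moreover have "map ?e ys = c" using e0(2) by auto
  ultimately show thesis using that[of ?e] by simp
qed

lemma ltp_same_type: "c \<in> tup ts \<Longrightarrow> d \<in> tup ts \<Longrightarrow> ltp M d C = ltp M c C \<longleftrightarrow> same_type C c d"
  using ltp_eq_iff tup_univ same_type_sym by metis

text \<open>If \<open>\<chi>\<close> is the instance \<open>\<phi>(x, c)\<close>, then the free variables of \<open>\<phi>\<close> are among those of the tuple \<open>x\<close>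
  and those that \<open>c\<close> replaces, so \<open>\<phi>\<close> defines a relation of the kind considered in
  \<open>nondividing\<close>.\<close>

lemma nondividing_formula:
  assumes W: "nondividing A ss W" "global_type ss W"
    and \<chi>: "\<chi> \<in> Fml M (set (tuple_vars ss)) (univ M)" and div: "divides M A \<chi>"
  shows "eventually (\<lambda>h. \<not> sat M (\<lambda>(s, j). h ! j) \<chi>) W"
proof -
  from div obtain \<phi> ys c k d where \<phi>: "\<phi> \<in> Fml M UNIV {}" and ys: "distinct ys"
    and c: "c \<in> tup (map fst ys)" and \<chi>_eq: "\<chi> = inst ys c \<phi>"
    and d: "\<And>i::nat. d i \<in> tup (map fst ys)" "\<And>i. ltp M (d i) A = ltp M c A"
    and k: "k_inconsistent M k (\<lambda>i. inst ys (d i) \<phi>)"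
    unfolding divides_def tuples_eq by metis
  let ?ts = "map fst ys"
  have len: "length c = length ys" using tup_length[OF c] by simp
  have fv: "fv \<phi> \<subseteq> set (tuple_vars ss) \<union> set ys"
  proof -
    have "fv \<chi> = fv \<phi> - set ys" using len unfolding \<chi>_eq inst_def by (subst fv_subst) simp
    then show ?thesis using \<chi> by (auto simp: Fml_def)
  qed
  have "\<forall>v. \<exists>i. v \<in> set ys \<longrightarrow> i < length ys \<and> ys ! i = v" by (metis in_set_conv_nth)
  then obtain idx where idx: "\<And>v. v \<in> set ys \<Longrightarrow> idx v < length ys \<and> ys ! idx v = v" by metis
  define r where "r v = (if v \<in> set ys then length ss + idx v else snd v)" for v
  let ?R = "\<lambda>z. sat M (\<lambda>v. z ! r v) \<phi>"
  have R: "definable {} (ss @ ?ts) ?R"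
  proof (rule definable_sat)
    fix v assume v: "v \<in> fv \<phi>"
    show "r v < length (ss @ ?ts) \<and> (ss @ ?ts) ! r v = fst v"
    proof (cases "v \<in> set ys")
      case True
      then show ?thesis using idx[OF True] by (simp add: r_def nth_append)
    next
      case False
      then have "v \<in> set (tuple_vars ss)" using v fv by auto
      then show ?thesis using False by (auto simp: r_def set_tuple_vars nth_append)
    qed
  qed (use \<phi> in \<open>auto simp: Fml_def\<close>)
  have eq: "sat M e (inst ys b \<phi>) = ?R (map e (tuple_vars ss) @ b)"
    if e: "asg M e" and b: "b \<in> tup ?ts" for e b
  proof -
    obtain e' where e': "map e' ys = b" "\<And>v. v \<notin> set ys \<Longrightarrow> e' v = e v"
      "\<And>\<psi>. sat M e (inst ys b \<psi>) = sat M e' \<psi>" using sat_inst[OF e ys b] by metis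
    have "e' v = (map e (tuple_vars ss) @ b) ! r v" if v: "v \<in> fv \<phi>" for v
    proof (cases "v \<in> set ys")
      case True
      then show ?thesis using idx[OF True] e'(1) by (auto simp: r_def nth_append)
    next
      case False
      then have "v \<in> set (tuple_vars ss)" using v fv by auto
      then obtain j where "j < length ss" "v = (ss ! j, j)" by (auto simp: set_tuple_vars)
      then show ?thesis using False e'(2)[OF False] by (simp add: r_def nth_append)
    qed
    then show ?thesis unfolding e'(3) by (rule sat_cong)
  qed
  have "eventually (\<lambda>h. \<not> ?R (h @ c)) W"
  proof (rule nondividingD[OF W(1) R c, where d = d and k = k])
    show "same_type A c (d i)" for i using d c ltp_same_type by blast
    fix S :: "nat set" assume S: "finite S" "card S = k"
    show "\<not> (\<exists>h\<in>tup ss. \<forall>i\<in>S. ?R (h @ d i))"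
    proof
      assume "\<exists>h\<in>tup ss. \<forall>i\<in>S. ?R (h @ d i)"
      then obtain h where h: "h \<in> tup ss" "\<forall>i\<in>S. ?R (h @ d i)" by blast
      obtain e where "asg M e" "map e (tuple_vars ss) = h" using asg_exists_tuple_vars[OF h(1)] .
      then have "consistent M ((\<lambda>i. inst ys (d i) \<phi>) ` S)"
        using h(2) eq[OF _ d(1)] by (auto simp: consistent_def)
      then show False using k S by (auto simp: k_inconsistent_def)
    qed
  qed
  moreover have "\<not> ?R (h @ c) \<longleftrightarrow> \<not> sat M (\<lambda>(s, j). h ! j) \<chi>" if h: "h \<in> tup ss" for h
  proof -
    obtain e where e: "asg M e" "map e (tuple_vars ss) = h" using asg_exists_tuple_vars[OF h] .
    have "sat M e \<chi> = sat M (\<lambda>(s, j). h ! j) \<chi>"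
      using sat_tuple_vars[OF e(2)] \<chi> by (simp add: Fml_def)
    then show ?thesis using eq[OF e(1) c] e(2) by (simp add: \<chi>_eq)
  qed
  ultimately show ?thesis using global_type_ev_cong[OF W(2)] by (metis (no_types, lifting))
qed

lemma automorphism_preimage:
  assumes "automorphism M g" and "c \<in> tup ts"
  obtains c0 where "c0 \<in> tup ts" and "map g c0 = c"
proof -
  have "\<exists>c0. set c0 \<subseteq> univ M \<and> map g c0 = c" if "set c \<subseteq> univ M" for c
    using that
  proof (induction c)
    case (Cons x c)
    then obtain c0 where "set c0 \<subseteq> univ M" "map g c0 = c" by auto
    moreover have "x \<in> g ` univ M"
      using Cons.prems assms(1) by (auto simp: automorphism_def bij_betw_def)
    then obtain y where "y \<in> univ M" "g y = x" by blast
    ultimately show ?case by (intro exI[of _ "y # c0"]) auto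
  qed simp
  from this[OF tup_univ[OF assms(2)]] obtain c0 where c0: "set c0 \<subseteq> univ M" "map g c0 = c" by blast
  have "map (srt M) (map g c0) = map (srt M) c0"
    using c0(1) assms(1) by (auto simp: automorphism_def)
  then have "map (srt M) c0 = ts" using c0(2) tup_srt[OF assms(2)] by simp
  then show thesis using that[of c0] c0 by (simp add: tup_def)
qed

lemma automorphism_same_type:
  assumes g: "automorphism M g" and fixes_B: "\<And>b. b \<in> B \<Longrightarrow> g b = b" and d: "d \<in> tup ss"
  shows "same_type B d (map g d)"
proof (rule same_typeI[OF d automorphism_tup[OF g d]])
  fix R assume R: "definable B ss R"
  obtain p R0 where p: "set p \<subseteq> B" "set p \<subseteq> univ M" "definable {} (ss @ map (srt M) p) R0"
    "\<And>d. d \<in> tup ss \<Longrightarrow> R d = R0 (d @ p)" using definable_parameters[OF R] by metis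
  have "d @ p \<in> tup (ss @ map (srt M) p)" using d tup_self[OF p(2)] by blast
  from automorphism_definable[OF g p(3) this] have "R0 (map g d @ map g p) = R0 (d @ p)" by simp
  moreover have "map g p = p" using fixes_B p(1) by (auto intro: map_idI)
  ultimately show "R d = R (map g d)" using p(4) d automorphism_tup[OF g d] by simp
qed

lemma global_type_automorphism:
  assumes "automorphism M g" and "global_type ss W"
  shows "global_type ss (filtermap (map g) W)"
  using assms automorphism_tup[OF assms(1)]
  by (auto simp: global_type_def ultra_filtermap eventually_filtermap elim: eventually_mono)

lemma realizes_automorphism:
  assumes g: "automorphism M g" and W: "global_type ss W" and "realizes W ss C h" and C: "C \<subseteq> univ M"
  shows "realizes (filtermap (map g) W) ss (g ` C) (map g h)"
  unfolding realizes_def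
proof (intro conjI allI impI)
  note h = realizes_tup[OF assms(3)]
  show "map g h \<in> tup ss" by (rule automorphism_tup[OF g h])
  fix R assume "definable (g ` C) ss R \<and> eventually R (filtermap (map g) W)"
  then have R: "definable (g ` C) ss R" and ev: "eventually (\<lambda>x. R (map g x)) W"
    by (auto simp: eventually_filtermap)
  obtain p R0 where p: "set p \<subseteq> g ` C" "set p \<subseteq> univ M" "definable {} (ss @ map (srt M) p) R0"
    "\<And>d. d \<in> tup ss \<Longrightarrow> R d = R0 (d @ p)" using definable_parameters[OF R] by metis
  have "\<exists>q. set q \<subseteq> C \<and> map g q = p" using p(1)
  proof (induction p)
    case (Cons x p)
    then obtain y q where "y \<in> C" "g y = x" "set q \<subseteq> C" "map g q = p" by auto
    then show ?case by (intro exI[of _ "y # q"]) auto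
  qed simp
  then obtain q where q: "set q \<subseteq> C" "map g q = p" by blast
  have "\<And>m. m \<in> univ M \<Longrightarrow> srt M (g m) = srt M m" using g by (simp add: automorphism_def)
  then have "map (srt M) p = map (srt M) q" using q C by (auto simp: subset_iff)
  then have qt: "q \<in> tup (map (srt M) p)" using q(1) C by (auto simp: tup_def)
  have eq: "R (map g x) = R0 (x @ q)" if x: "x \<in> tup ss" for x
    using automorphism_definable[OF g p(3) tup_append[OF x qt]] p(4)[OF automorphism_tup[OF g x]] q(2) by simp
  have "definable C ss (\<lambda>x. R0 (x @ q))"
    by (rule definable_mono[OF definable_section[OF p(3) qt]]) (simp add: q(1))
  moreover have "eventually (\<lambda>x. R0 (x @ q)) W"
    using ev global_type_ev_cong[OF W eq] by simp
  ultimately have "R0 (h @ q)" using assms(3) unfolding realizes_def by blast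
  then show "R (map g h)" using eq[OF h] by simp
qed

lemma nondividing_automorphism:
  assumes g: "automorphism M g" and fixes_B: "\<And>a. a \<in> A \<Longrightarrow> g a = a"
    and W: "global_type ss W" "nondividing A ss W"
  shows "nondividing A ss (filtermap (map g) W)"
  unfolding nondividing_def
proof (intro allI impI, elim conjE)
  fix ts R c k and d :: "nat \<Rightarrow> 'm list"
  assume R: "definable {} (ss @ ts) R" and c: "c \<in> tup ts" and d: "\<forall>i. same_type A c (d i)"
    and k: "\<forall>S. finite S \<and> card S = k \<longrightarrow> \<not> (\<exists>h\<in>tup ss. \<forall>i\<in>S. R (h @ d i))"
  have "d i \<in> tup ts" for i using d c same_typeD(1) by blast
  then have "\<forall>i. \<exists>d0. d0 \<in> tup ts \<and> map g d0 = d i" using automorphism_preimage[OF g] by metis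
  then obtain d0 where d0: "\<And>i. d0 i \<in> tup ts" "\<And>i. map g (d0 i) = d i" by metis
  obtain c0 where c0: "c0 \<in> tup ts" "map g c0 = c" using automorphism_preimage[OF g c] .
  have R_g: "R (map g h @ map g x) = R (h @ x)" if "h \<in> tup ss" "x \<in> tup ts" for h x
    using automorphism_definable[OF g R, of "h @ x"] that by auto
  have "eventually (\<lambda>h. \<not> R (h @ c0)) W"
  proof (rule nondividingD[OF W(2) R c0(1), where d = d0 and k = k])
    fix i
    have "same_type A c0 c" "same_type A (d0 i) (d i)"
      using automorphism_same_type[OF g fixes_B] c0 d0 by metis+
    moreover have "same_type A c (d i)" using d by simp
    ultimately show "same_type A c0 (d0 i)" by (metis same_type_sym same_type_trans)
  next
    fix S :: "nat set" assume S: "finite S" "card S = k"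
    show "\<not> (\<exists>h\<in>tup ss. \<forall>i\<in>S. R (h @ d0 i))"
    proof
      assume "\<exists>h\<in>tup ss. \<forall>i\<in>S. R (h @ d0 i)"
      then obtain h where h: "h \<in> tup ss" "\<forall>i\<in>S. R (h @ d0 i)" by blast
      then have "\<forall>i\<in>S. R (map g h @ d i)" using R_g[OF h(1) d0(1)] d0(2) by simp
      then show False using k S automorphism_tup[OF g h(1)] by blast
    qed
  qed
  moreover have "\<not> R (h @ c0) \<longleftrightarrow> \<not> R (map g h @ c)" if "h \<in> tup ss" for h
    using R_g[OF that c0(1)] c0(2) by simp
  ultimately have "eventually (\<lambda>h. \<not> R (map g h @ c)) W"
    using global_type_ev_cong[OF W(1)] by (metis (no_types, lifting))
  then show "eventually (\<lambda>h. \<not> R (h @ c)) (filtermap (map g) W)" by (simp add: eventually_filtermap)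
qed

end

context monster
begin

text \<open>The dividing formulas that the type of \<open>g\<close> over \<open>C\<close> might imply can have parameters outside \<open>C\<close>,
  and \<open>g\<close> may well satisfy one of them. But the type of \<open>g\<close> over \<open>C\<close> together with the negations of
  finitely many of them is contained in \<open>W\<close>, hence realized by some other tuple.\<close>

lemma realizes_not_forks:
  assumes W: "global_type ss W" "nondividing A ss W" and C: "small \<kappa> C" "C \<subseteq> univ M"
    and g: "realizes W ss C g"
  shows "\<not> ltp_forks M A g C"
proof
  note gt = realizes_tup[OF g]
  have "tvars M {..<length g} ((!) g) = set (tuple_vars ss)"
    using tup_length[OF gt] tup_srt[OF gt] by (fastforce simp: tvars_def set_tuple_vars)
  moreover assume "ltp_forks M A g C"
  ultimately obtain \<Delta> where \<Delta>: "finite \<Delta>" "\<Delta> \<subseteq> Fml M (set (tuple_vars ss)) (univ M)" "\<And>\<chi>. \<chi> \<in> \<Delta> \<Longrightarrow> divides M A \<chi>"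
    and cover: "\<And>e. asg M e \<Longrightarrow> \<forall>\<psi>\<in>ltp M g C. sat M e \<psi> \<Longrightarrow> \<exists>\<chi>\<in>\<Delta>. sat M e \<chi>"
    unfolding ltp_forks_def tp_forks_def forks_def ltp_def by metis
  let ?C = "C \<union> (\<Union>\<chi>\<in>\<Delta>. params \<chi>)"
  let ?s = "\<lambda>\<psi> h. sat M (\<lambda>(s, j). h ! j) \<psi>"
  let ?F = "?s ` ltp M g C \<union> (\<lambda>\<chi> h. \<not> ?s \<chi> h) ` \<Delta>"
  have "\<exists>h\<in>tup ss. \<forall>R\<in>?F. R h"
  proof (rule compactness)
    show "small \<kappa> ?C" using C(1) \<Delta>(1) by (simp add: small_Un small_finite)
    show "?C \<subseteq> univ M" using C(2) \<Delta>(2) by (auto simp: Fml_def)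
    fix R assume "R \<in> ?F"
    then consider \<psi> where "\<psi> \<in> ltp M g C" "R = ?s \<psi>" | \<chi> where "\<chi> \<in> \<Delta>" "R = (\<lambda>h. \<not> ?s \<chi> h)"
      by blast
    then show "definable ?C ss R"
    proof cases
      case 1
      then have "\<psi> \<in> Fml M (set (tuple_vars ss)) ?C"
        unfolding ltp_tup[OF gt] by (auto simp: Fml_def)
      then show ?thesis using 1 by (auto simp: definable_iff)
    next
      case 2
      then have "\<chi> \<in> Fml M (set (tuple_vars ss)) ?C" using \<Delta>(2) by (auto simp: Fml_def)
      then have "definable ?C ss (?s \<chi>)" by (auto simp: definable_iff)
      from definable_not[OF this] show ?thesis using 2 by simp
    qed
  next
    fix F0 assume F0: "F0 \<subseteq> ?F" "finite F0"
    have "eventually R W" if "R \<in> F0" for R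
    proof -
      consider \<psi> where "\<psi> \<in> ltp M g C" "R = ?s \<psi>" | \<chi> where "\<chi> \<in> \<Delta>" "R = (\<lambda>h. \<not> ?s \<chi> h)"
        using \<open>R \<in> F0\<close> F0(1) by blast
      then show ?thesis
      proof cases
        case 1
        then have "definable C ss R" "R g" unfolding ltp_tup[OF gt] by (auto simp: definable_iff)
        then show ?thesis using realizes_iff[OF W(1) g] by blast
      next
        case 2
        then show ?thesis using nondividing_formula[OF W(2,1)] \<Delta>(2,3) by blast
      qed
    qed
    then have "eventually (\<lambda>h. \<forall>R\<in>F0. R h) W" using F0(2) by (intro eventually_ball_finite) auto
    then show "\<exists>h\<in>tup ss. \<forall>R\<in>F0. R h" by (rule global_type_ex[OF W(1)])
  qed
  then obtain h where h: "h \<in> tup ss" "\<forall>R\<in>?F. R h" by blast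
  obtain e where e: "asg M e" "map e (tuple_vars ss) = h" using asg_exists_tuple_vars[OF h(1)] .
  have s: "sat M e \<psi> = ?s \<psi> h" if "\<psi> \<in> Fml M (set (tuple_vars ss)) X" for \<psi> X
    using sat_tuple_vars[OF e(2)] that by (simp add: Fml_def)
  have "\<forall>\<psi>\<in>ltp M g C. sat M e \<psi>" using h(2) s unfolding ltp_tup[OF gt] by auto
  from cover[OF e(1) this] obtain \<chi> where \<chi>: "\<chi> \<in> \<Delta>" "sat M e \<chi>" by blast
  then have "\<not> ?s \<chi> h" using h(2) by auto
  then show False using s[of \<chi> "univ M"] \<chi> \<Delta>(2) by auto
qed

end

section \<open>Coheirs and invariance\<close>

context monster
begin

text \<open>As \<open>N\<close> is an elementary substructure, the type of \<open>u\<close> over \<open>N\<close> is finitely satisfiable in \<open>N\<close>.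
  An ultrafilter that concentrates on tuples from \<open>N\<close> is invariant, because for such a tuple \<open>g\<close>
  the truth of \<open>R(g, a)\<close> only depends on the type of \<open>a\<close> over \<open>N\<close>.\<close>

lemma coheir_exists:
  assumes N: "N \<subseteq> univ M"
    and TV: "\<And>ss R. definable N ss R \<Longrightarrow> \<exists>d\<in>tup ss. R d \<Longrightarrow> \<exists>d\<in>tup ss. set d \<subseteq> N \<and> R d"
    and u: "u \<in> tup us"
  obtains Z where "global_type us Z" and "invariant Z us N" and "realizes Z us N u"
proof -
  let ?f = "\<lambda>R g. R g \<and> g \<in> tup us \<and> set g \<subseteq> N"
  let ?T = "{R. definable N us R \<and> R u}"
  have "\<exists>Z. ultra Z \<and> (\<forall>P\<in>?f ` ?T. eventually P Z)"
  proof (rule ultra_fip)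
    fix S0 assume S0: "finite S0" "S0 \<subseteq> ?f ` ?T"
    obtain T0 where T0: "T0 \<subseteq> ?T" "finite T0" "S0 = ?f ` T0"
      using finite_subset_image[OF S0] by blast
    have DT: "definable N us (\<lambda>g. \<forall>R\<in>T0. R g)" using T0(1,2) by (intro definable_Ball) auto
    have "\<exists>g\<in>tup us. \<forall>R\<in>T0. R g" using T0(1) u by (intro bexI[of _ u]) auto
    from TV[OF DT this] obtain g where "g \<in> tup us" "set g \<subseteq> N" "\<forall>R\<in>T0. R g" by blast
    then show "\<exists>g. \<forall>P\<in>S0. P g" using T0(3) by auto
  qed
  then obtain Z where Z: "ultra Z" "\<And>R. definable N us R \<Longrightarrow> R u \<Longrightarrow> eventually (?f R) Z" by auto
  have ev: "eventually (\<lambda>g. g \<in> tup us \<and> set g \<subseteq> N) Z"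
    using Z(2)[OF definable_True] by simp
  then have gt: "global_type us Z" using Z(1) by (auto simp: global_type_def elim: eventually_mono)
  have "realizes Z us N u"
    unfolding realizes_def
  proof (intro conjI allI impI u)
    fix R assume R: "definable N us R \<and> eventually R Z"
    show "R u"
    proof (rule ccontr)
      assume "\<not> R u"
      then have "eventually (?f (\<lambda>g. \<not> R g)) Z" using R definable_not by (intro Z(2)) auto
      then have "eventually (\<lambda>g. \<not> R g) Z" by (rule eventually_mono) simp
      then show False using R ultra_not[OF Z(1), of R] by simp
    qed
  qed
  moreover have "invariant Z us N"
    unfolding invariant_def
  proof (intro allI impI, elim conjE)
    fix ws R a b assume R: "definable {} (us @ ws) R" and a: "a \<in> tup ws" and ab: "same_type N a b"
    have "R (g @ a) = R (g @ b)" if "g \<in> tup us" "set g \<subseteq> N" for g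
    proof -
      have "definable N ws (\<lambda>x. R (g @ x))"
        by (rule definable_mono[OF definable_section_left[OF R that(1)]]) (simp add: that(2))
      from same_typeD(2)[OF ab a this] show ?thesis .
    qed
    then show "eventually (\<lambda>h. R (h @ a)) Z = eventually (\<lambda>h. R (h @ b)) Z"
      using ev by (intro eventually_cong[OF ev]) auto
  qed
  ultimately show thesis using gt that by blast
qed

end

context nip_monster
begin

text \<open>The pairs \<open>(g\<^bsub>2i\<^esub>, g\<^bsub>2i+1\<^esub>)\<close> witness that \<open>R(x, g\<^sub>0) \<and> \<not> R(x, g\<^sub>1)\<close> divides over \<open>A\<close>: a realization of
  \<open>k\<close> of the conjunctions would alternate along \<open>2 k\<close> members of \<open>g\<close>.\<close>

lemma nondividing_indiscernible_aux:
  assumes W: "global_type ss W" "nondividing A ss W" and R: "definable {} (ss @ ts) R"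
    and g: "\<And>i. g i \<in> tup ts" and ind: "indiscernible M A g"
  shows "\<not> eventually (\<lambda>h. R (h @ g 0) \<and> \<not> R (h @ g 1)) W"
proof -
  have ind0: "indiscernible M {} g" using ind by (rule indiscernible_mono) simp
  obtain k where k: "\<And>x. x \<in> tup ss \<Longrightarrow> \<exists>i<k. R (x @ g i) \<noteq> even i"
    using bounded_alternation[OF R g ind0] by blast
  let ?n = "length ss" and ?m = "length ts"
  let ?f = "\<lambda>z. take (?n + ?m) z" and ?f' = "\<lambda>z. take ?n z @ drop (?n + ?m) z"
  let ?R = "\<lambda>z. R (?f z) \<and> \<not> R (?f' z)"
  have "definable {} (ss @ ts @ ts) (\<lambda>z. R (?f z))"
  proof (rule definable_pull[OF R])
    show "i < length (ss @ ts @ ts)" if "i \<in> set [0..<?n + ?m]" for i using that by auto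
    show "ss @ ts = map ((!) (ss @ ts @ ts)) [0..<?n + ?m]"
      by (intro nth_equalityI) (auto simp: nth_append)
    show "?f z = map ((!) z) [0..<?n + ?m]" if "z \<in> tup (ss @ ts @ ts)" for z
      using tup_length[OF that] by (intro nth_equalityI) auto
  qed
  moreover have "definable {} (ss @ ts @ ts) (\<lambda>z. R (?f' z))"
  proof (rule definable_pull[OF R])
    let ?r = "[0..<?n] @ [?n + ?m..<?n + ?m + ?m]"
    show "i < length (ss @ ts @ ts)" if "i \<in> set ?r" for i using that by auto
    show "ss @ ts = map ((!) (ss @ ts @ ts)) ?r"
      by (intro nth_equalityI) (auto simp: nth_append)
    show "?f' z = map ((!) z) ?r" if "z \<in> tup (ss @ ts @ ts)" for z
      using tup_length[OF that] by (intro nth_equalityI) (auto simp: nth_append)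
  qed
  ultimately have dR: "definable {} (ss @ ts @ ts) ?R" using definable_conj definable_not by blast
  have R_eq: "?R (h @ a @ b) \<longleftrightarrow> R (h @ a) \<and> \<not> R (h @ b)"
    if "h \<in> tup ss" "a \<in> tup ts" for h a b
    using tup_length[OF that(1)] tup_length[OF that(2)] by simp
  have gu: "set (g i) \<subseteq> univ M" for i using tup_univ[OF g] .
  have "eventually (\<lambda>h. \<not> ?R (h @ g 0 @ g 1)) W"
  proof (rule nondividingD[OF W(2) dR, where d = "\<lambda>i. g (2 * i) @ g (2 * i + 1)" and k = k])
    show "g 0 @ g 1 \<in> tup (ts @ ts)" using g by blast
    show "same_type A (g 0 @ g 1) (g (2 * i) @ g (2 * i + 1))" for i
      using ind[unfolded indiscernible_iff[of g, OF gu], rule_format, of "[0, 1]" "[2 * i, 2 * i + 1]"] by simp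
    fix S :: "nat set" assume S: "finite S" "card S = k"
    let ?l = "sorted_list_of_set S"
    have l: "sorted_wrt (<) ?l" "length ?l = k" "set ?l = S"
      using S by (simp_all add: strict_sorted_list_of_set)
    \<comment> \<open>The indices of the members of the selected pairs, in increasing order.\<close>
    let ?js = "map (\<lambda>i. 2 * (?l ! (i div 2)) + i mod 2) [0..<2 * k]"
    show "\<not> (\<exists>h\<in>tup ss. \<forall>i\<in>S. ?R (h @ g (2 * i) @ g (2 * i + 1)))"
    proof
      assume "\<exists>h\<in>tup ss. \<forall>i\<in>S. ?R (h @ g (2 * i) @ g (2 * i + 1))"
      then obtain h where h: "h \<in> tup ss" "\<forall>i\<in>S. R (h @ g (2 * i)) \<and> \<not> R (h @ g (2 * i + 1))"
        using R_eq g by metis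
      have "R (h @ g (?js ! i)) = even i" if i: "i < length ?js" for i
      proof -
        have "?l ! (i div 2) \<in> S" using i l by (metis less_mult_imp_div_less length_map length_upt
              minus_nat.diff_0 mult.commute nth_mem)
        then show ?thesis using h(2) i
          by (cases "even i") (auto simp: even_iff_mod_2_eq_zero odd_iff_mod_2_eq_one)
      qed
      then have "\<exists>x\<in>tup ss. \<forall>i<length ?js. R (x @ g (?js ! i)) = even i" using h(1) by blast
      moreover have "sorted_wrt (<) ?js"
        unfolding sorted_wrt_iff_nth_less
      proof (intro allI impI)
        fix i j assume ij: "i < j" "j < length ?js"
        show "?js ! i < ?js ! j"
        proof (cases "i div 2 = j div 2")
          case True
          then have "i mod 2 < j mod 2"
            using ij(1) by (metis div_mult_mod_eq nat_add_left_cancel_less)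
          then show ?thesis using True ij by simp
        next
          case False
          then have lt: "i div 2 < j div 2"
            using ij(1) by (metis div_le_mono le_neq_implies_less less_imp_le_nat)
          have "j div 2 < k" using ij(2) by (auto simp: less_mult_imp_div_less mult.commute)
          then have "?l ! (i div 2) < ?l ! (j div 2)"
            using l lt by (simp add: sorted_wrt_iff_nth_less)
          moreover have "i mod 2 < 2" by simp
          ultimately have "2 * (?l ! (i div 2)) + i mod 2 < 2 * (?l ! (j div 2)) + j mod 2"
            by linarith
          then show ?thesis using ij by simp
        qed
      qed
      moreover have "sorted_wrt (<) [0..<2 * k]" "length [0..<2 * k] = length ?js" by simp_all
      ultimately have "\<exists>x\<in>tup ss. \<forall>i<length ?js. R (x @ g ([0..<2 * k] ! i)) = even i"
        by (intro indiscernible_pattern[OF R g ind0, of ?js "[0..<2 * k]" even])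
      then obtain x where x: "x \<in> tup ss" "\<And>i. i < 2 * k \<Longrightarrow> R (x @ g i) = even i" by auto
      obtain i where "i < k" "R (x @ g i) \<noteq> even i" using k[OF x(1)] by blast
      then show False using x(2)[of i] by simp
    qed
  qed
  moreover have "?R (h @ g 0 @ g 1) \<longleftrightarrow> R (h @ g 0) \<and> \<not> R (h @ g 1)" if "h \<in> tup ss" for h
    by (rule R_eq[OF that g])
  ultimately have "eventually (\<lambda>h. \<not> (R (h @ g 0) \<and> \<not> R (h @ g 1))) W"
    using global_type_ev_cong[OF W(1)] by (metis (no_types, lifting))
  moreover have "ultra W" using W(1) by (simp add: global_type_def)
  ultimately show ?thesis by (simp only: ultra_not) simp
qed

lemma nondividing_indiscernible:
  assumes W: "global_type ss W" "nondividing A ss W" and R: "definable {} (ss @ ts) R"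
    and g: "\<And>i. g i \<in> tup ts" and ind: "indiscernible M A g"
  shows "eventually (\<lambda>h. R (h @ g 0)) W = eventually (\<lambda>h. R (h @ g 1)) W"
proof -
  have u: "ultra W" using W(1) by (simp add: global_type_def)
  have "\<not> eventually (\<lambda>h. \<not> R (h @ g 0) \<and> \<not> \<not> R (h @ g 1)) W"
    using nondividing_indiscernible_aux[OF W definable_not[OF R] g ind] .
  moreover have "\<not> eventually (\<lambda>h. R (h @ g 0) \<and> \<not> R (h @ g 1)) W"
    using nondividing_indiscernible_aux[OF W R g ind] .
  ultimately show ?thesis using ultra_not[OF u] by (auto simp: eventually_conj_iff)
qed

text \<open>If \<open>u\<close> and \<open>v\<close> have the same type over \<open>N\<close>, choose successive realizations \<open>e\<close> of a coheir of this
  type over \<open>N\<close>, \<open>u\<close> and \<open>v\<close>. Both \<open>u\<close> followed by \<open>e\<close> and \<open>v\<close> followed by \<open>e\<close> are indiscernible over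
  \<open>N\<close>, so \<open>W\<close> treats \<open>u\<close> like \<open>e\<^sub>0\<close> and \<open>v\<close> like \<open>e\<^sub>0\<close>.\<close>

lemma nondividing_invariant:
  assumes W: "global_type ss W" "nondividing A ss W" and AN: "A \<subseteq> N"
    and N: "N \<subseteq> univ M" "small \<kappa> N"
    and TV: "\<And>ss R. definable N ss R \<Longrightarrow> \<exists>d\<in>tup ss. R d \<Longrightarrow> \<exists>d\<in>tup ss. set d \<subseteq> N \<and> R d"
  shows "invariant W ss N"
  unfolding invariant_def
proof (intro allI impI, elim conjE)
  fix us R u v assume R: "definable {} (ss @ us) R" and u: "u \<in> tup us" and uv: "same_type N u v"
  have v: "v \<in> tup us" using same_typeD(1)[OF uv u] .
  obtain Z where Z: "global_type us Z" "invariant Z us N" "realizes Z us N u"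
    using coheir_exists[OF N(1) TV u] by blast
  have Zv: "realizes Z us N v"
    using Z(3) v same_typeD(2)[OF uv u] by (auto simp: realizes_def)
  let ?C = "N \<union> (set u \<union> set v)"
  have C: "small \<kappa> ?C" "?C \<subseteq> univ M"
    using N tup_univ[OF u] tup_univ[OF v] by (auto simp: small_Un small_finite)
  have "\<exists>e :: nat \<Rightarrow> 'm list. \<forall>n. realizes Z us (?C \<union> (\<Union>j<n. set (e j))) (e n)"
  proof (rule sequence_exists[OF C]; intro allI impI)
    show "\<exists>x. realizes Z us C x" if "small \<kappa> C \<and> C \<subseteq> univ M" for C
      using realizes_exists[OF Z(1)] that by blast
    show "finite (set x) \<and> set x \<subseteq> univ M" if "realizes Z us C x" for C x
      using tup_univ[OF realizes_tup[OF that]] by simp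
  qed
  then obtain e :: "nat \<Rightarrow> 'm list"
    where e: "\<And>n. realizes Z us (?C \<union> (\<Union>j<n. set (e j))) (e n)" by blast
  have key: "eventually (\<lambda>h. R (h @ w)) W = eventually (\<lambda>h. R (h @ e 0)) W"
    if w: "realizes Z us N w" "set w \<subseteq> ?C" for w
  proof -
    let ?g = "case_nat w e"
    have "realizes Z us (N \<union> (\<Union>j<i. set (?g j))) (?g i)" for i
    proof (cases i)
      case 0
      then show ?thesis using w by simp
    next
      case (Suc n)
      have "(\<Union>j<i. set (?g j)) = set w \<union> (\<Union>j<n. set (e j))"
        unfolding Suc lessThan_Suc_eq_insert_0 by auto
      then show ?thesis using e[of n] w(2) Suc by (auto elim!: realizes_mono)
    qed
    then have "morley_seq Z us N ?g" by (simp add: morley_seq_def)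
    then have "indiscernible M N ?g" by (rule morley_seq_indiscernible[OF Z(1,2) N(1)])
    then have "indiscernible M A ?g" using AN by (rule indiscernible_mono)
    moreover have "?g i \<in> tup us" for i
      using realizes_tup[OF w(1)] realizes_tup[OF e] by (cases i) auto
    ultimately show ?thesis using nondividing_indiscernible[OF W R, of ?g] by simp
  qed
  show "eventually (\<lambda>h. R (h @ u)) W = eventually (\<lambda>h. R (h @ v)) W"
    using key[OF Z(3)] key[OF Zv] by auto
qed

end

section \<open>The limit of the types of the rows\<close>

context fo_structure
begin

lemma tup_concat_split:
  "d \<in> tup (concat (replicate k ss)) \<Longrightarrow>
     \<exists>hs. length hs = k \<and> d = concat hs \<and> (\<forall>h\<in>set hs. h \<in> tup ss)"
proof (induction k arbitrary: d)
  case (Suc k)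
  then obtain a b where ab: "d = a @ b" "a \<in> tup ss" "b \<in> tup (concat (replicate k ss))"
    by (auto simp: tup_split)
  from Suc.IH[OF ab(3)] obtain hs where "length hs = k" "b = concat hs" "\<forall>h\<in>set hs. h \<in> tup ss"
    by blast
  then show ?case using ab by (intro exI[of _ "a # hs"]) auto
qed simp

text \<open>The variables that the type of a sequence of tuples, read as one infinite tuple, has for the
  \<open>i\<close>-th member of the sequence.\<close>

definition row_vars :: "'s list \<Rightarrow> nat \<Rightarrow> 's var list" where
  "row_vars ss i = map (\<lambda>j. (ss ! j, prod_encode (i, j))) [0..<length ss]"

lemma fst_row_vars [simp]: "map fst (row_vars ss i) = ss"
  by (auto simp: row_vars_def intro: nth_equalityI)

lemma distinct_rows: "distinct l \<Longrightarrow> distinct (concat (map (row_vars ss) l))"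
proof (induction l)
  case (Cons i l)
  have "distinct (row_vars ss i)"
    by (auto simp: row_vars_def distinct_map inj_on_def)
  moreover have "set (row_vars ss i) \<inter> set (concat (map (row_vars ss) l)) = {}"
    using Cons.prems by (auto simp: row_vars_def)
  ultimately show ?case using Cons by auto
qed simp

lemma fst_rows: "map fst (concat (map (row_vars ss) l)) = concat (replicate (length l) ss)"
  by (induction l) auto

lemma map_rows: "map e (concat (map (row_vars ss) l)) = concat (map (\<lambda>i. map e (row_vars ss i)) l)"
  by (induction l) auto

text \<open>That the type of the sequence \<open>a\<close> over \<open>B\<close> does not fork says just that it is consistent with the
  negations of any finitely many dividing formulas. Of the type, only its part about finitely
  many members \<open>a\<^sub>i\<close> (\<open>i \<in> set l\<close>) is recorded.\<close>

lemma rows_nonforking_ultrafilter: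
  assumes a: "\<And>i. a i \<in> tup ss" and nf: "\<not> seq_tp_forks M A a B"
  obtains U where "ultra U" and "eventually (asg M) U"
    and "\<And>l R. distinct l \<Longrightarrow> definable B (concat (replicate (length l) ss)) R \<Longrightarrow> R (concat (map a l)) \<Longrightarrow>
      eventually (\<lambda>e. R (concat (map (\<lambda>i. map e (row_vars ss i)) l))) U"
    and "\<And>i \<chi>. \<chi> \<in> Fml M (set (row_vars ss i)) (univ M) \<Longrightarrow> divides M A \<chi> \<Longrightarrow>
      eventually (\<lambda>e. \<not> sat M e \<chi>) U"
proof -
  let ?J = "{prod_encode (i, j) | i j. j < length (a i)}"
  let ?c = "\<lambda>n. case prod_decode n of (i, j) \<Rightarrow> a i ! j"
  have len: "length (a i) = length ss" for i using tup_length[OF a] .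
  have nth: "srt M (a i ! j) = ss ! j" if "j < length ss" for i j
    using tup_srt[OF a[of i]] that len[of i] by (metis nth_map)
  have X: "set (row_vars ss i) \<subseteq> tvars M ?J ?c" for i
  proof
    fix v assume "v \<in> set (row_vars ss i)"
    then obtain j where j: "j < length ss" "v = (ss ! j, prod_encode (i, j))"
      by (auto simp: row_vars_def)
    then have "v = (srt M (?c (prod_encode (i, j))), prod_encode (i, j))" "prod_encode (i, j) \<in> ?J"
      using nth len by auto
    then show "v \<in> tvars M ?J ?c" unfolding tvars_def by blast
  qed
  let ?X = "tvars M ?J ?c" and ?p = "tp M ?J ?c B"
  let ?Dv = "{\<chi> \<in> Fml M ?X (univ M). divides M A \<chi>}"
  let ?n = "\<lambda>\<chi> e. \<not> sat M e \<chi>" and ?s = "\<lambda>\<psi> e. sat M e \<psi>"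
  let ?S = "insert (asg M) (?s ` ?p \<union> ?n ` ?Dv)"
  have "\<exists>U. ultra U \<and> (\<forall>P\<in>?S. eventually P U)"
  proof (rule ultra_fip)
    fix S0 assume S0: "finite S0" "S0 \<subseteq> ?S"
    have "finite (S0 \<inter> ?n ` ?Dv)" "S0 \<inter> ?n ` ?Dv \<subseteq> ?n ` ?Dv" using S0(1) by auto
    from finite_subset_image[OF this] obtain \<Delta>
      where \<Delta>: "\<Delta> \<subseteq> ?Dv" "finite \<Delta>" "S0 \<inter> ?n ` ?Dv = ?n ` \<Delta>"
      by blast
    have "\<exists>e. asg M e \<and> (\<forall>\<psi>\<in>?p. sat M e \<psi>) \<and> \<not> (\<exists>\<chi>\<in>\<Delta>. sat M e \<chi>)"
    proof (rule ccontr)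
      assume no: "\<not> ?thesis"
      have "forks M A ?X ?p"
        unfolding forks_def
      proof (intro exI[of _ \<Delta>] conjI)
        show "finite \<Delta>" "\<Delta> \<subseteq> Fml M ?X (univ M)" "\<forall>\<chi>\<in>\<Delta>. divides M A \<chi>" using \<Delta> by auto
        show "\<forall>e. asg M e \<and> (\<forall>\<psi>\<in>?p. sat M e \<psi>) \<longrightarrow> (\<exists>\<chi>\<in>\<Delta>. sat M e \<chi>)" using no by meson
      qed
      then show False using nf by (simp add: seq_tp_forks_def tp_forks_def)
    qed
    then obtain e where e: "asg M e" "\<forall>\<psi>\<in>?p. sat M e \<psi>" "\<not> (\<exists>\<chi>\<in>\<Delta>. sat M e \<chi>)"
      by (elim exE conjE) (rule that)
    have "P e" if P: "P \<in> S0" for P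
    proof -
      consider "P = asg M" | "P \<in> ?s ` ?p" | "P \<in> ?n ` \<Delta>" using P S0(2) \<Delta>(3) by blast
      then show ?thesis using e by cases auto
    qed
    then show "\<exists>e. \<forall>P\<in>S0. P e" by blast
  qed
  then obtain U where U: "ultra U" "\<And>P. P \<in> ?S \<Longrightarrow> eventually P U" by blast
  have U_asg: "eventually (asg M) U" by (rule U(2)) simp
  show thesis
  proof (rule that[OF U(1) U_asg])
    fix l R assume l: "distinct l" and R: "definable B (concat (replicate (length l) ss)) R"
      and Ra: "R (concat (map a l))"
    let ?zs = "concat (map (row_vars ss) l)"
    obtain \<psi> where \<psi>: "\<psi> \<in> Fml M (set ?zs) B" "\<And>e. asg M e \<Longrightarrow> sat M e \<psi> = R (map e ?zs)"
      using definable_formula[OF R fst_rows] by blast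
    have "concat (map a l) \<in> tup (map fst ?zs)"
      unfolding fst_rows using tup_concat[of "map a l" ss] a by auto
    then obtain e where e: "asg M e" "map e ?zs = concat (map a l)"
      using asg_exists[OF distinct_rows[OF l]] by blast
    have row: "map e (row_vars ss i) = a i" if "i \<in> set l" for i
    proof -
      have "concat (map (\<lambda>i. map e (row_vars ss i)) l) = concat (map a l)"
        using e(2) map_rows by metis
      then have "map (\<lambda>i. map e (row_vars ss i)) l = map a l"
        by (rule concat_injective) (use len in \<open>auto simp: row_vars_def zip_map_map\<close>)
      then show ?thesis using that by simp
    qed
    have "sat M (\<lambda>(s, j). ?c j) \<psi> = sat M e \<psi>"
    proof (rule sat_cong)
      fix v assume "v \<in> fv \<psi>"
      then obtain i where i: "i \<in> set l" "v \<in> set (row_vars ss i)"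
        using \<psi>(1) by (auto simp: Fml_def)
      then obtain j where j: "j < length ss" "v = (ss ! j, prod_encode (i, j))"
        by (auto simp: row_vars_def)
      have "map e (row_vars ss i) ! j = a i ! j" using row[OF i(1)] by simp
      then show "(case v of (s, j) \<Rightarrow> ?c j) = e v" using j by (simp add: row_vars_def)
    qed
    moreover have "sat M e \<psi>" using \<psi>(2)[OF e(1)] e(2) Ra by simp
    moreover have "\<psi> \<in> Fml M ?X B" using \<psi>(1) X by (fastforce simp: Fml_def)
    ultimately have "\<psi> \<in> ?p" by (simp add: tp_def)
    then have "eventually (?s \<psi>) U" by (intro U(2)) blast
    with U_asg show "eventually (\<lambda>e. R (concat (map (\<lambda>i. map e (row_vars ss i)) l))) U"
      by eventually_elim (simp add: \<psi>(2) map_rows)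
  next
    fix i \<chi> assume "\<chi> \<in> Fml M (set (row_vars ss i)) (univ M)" "divides M A \<chi>"
    then have "\<chi> \<in> ?Dv" using X[of i] by (auto simp: Fml_def)
    then show "eventually (?n \<chi>) U" by (intro U(2)) blast
  qed
qed

text \<open>To apply the assumption on dividing formulas, \<open>R(x, y)\<close> is written as a formula in which \<open>x\<close> is
  the \<open>i\<close>-th row of variables and \<open>y\<close> consists of variables beyond it.\<close>

lemma row_nondividing:
  fixes d :: "nat \<Rightarrow> 'm list"
  assumes U: "eventually (asg M) U"
    "\<And>\<chi>. \<chi> \<in> Fml M (set (row_vars ss i)) (univ M) \<Longrightarrow> divides M A \<chi> \<Longrightarrow>
      eventually (\<lambda>e. \<not> sat M e \<chi>) U"
    and R: "definable {} (ss @ ts) R" and c: "c \<in> tup ts" and d: "\<And>n. same_type A c (d n)"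
    and k: "\<And>S. finite S \<Longrightarrow> card S = k \<Longrightarrow> \<not> (\<exists>h\<in>tup ss. \<forall>n\<in>S. R (h @ d n))"
  shows "eventually (\<lambda>e. \<not> R (map e (row_vars ss i) @ c)) U"
proof -
  have "finite (snd ` set (row_vars ss i))" by simp
  then obtain N0 where N0: "\<And>m. m \<in> snd ` set (row_vars ss i) \<Longrightarrow> m < N0"
    using finite_nat_set_iff_bounded by metis
  let ?ys = "map (\<lambda>j. (ts ! j, N0 + j)) [0..<length ts]"
  have ys: "distinct ?ys" "map fst ?ys = ts"
    by (auto simp: distinct_map inj_on_def intro: nth_equalityI)
  have disj: "v \<notin> set ?ys" if "v \<in> set (row_vars ss i)" for v
  proof
    assume "v \<in> set ?ys"
    then have "N0 \<le> snd v" by auto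
    moreover have "snd v < N0" using that by (intro N0) simp
    ultimately show False by simp
  qed
  have dt: "d n \<in> tup ts" for n using same_typeD(1)[OF d c] .
  obtain \<psi> where \<psi>: "\<psi> \<in> Fml M (set (row_vars ss i @ ?ys)) {}"
    "\<And>e. asg M e \<Longrightarrow> sat M e \<psi> = R (map e (row_vars ss i @ ?ys))"
    using definable_formula[OF R, of "row_vars ss i @ ?ys"] ys(2) by auto
  have inst: "sat M e (inst ?ys b \<psi>) = R (map e (row_vars ss i) @ b)"
    if e: "asg M e" and b: "b \<in> tup ts" for e b
  proof -
    have "b \<in> tup (map fst ?ys)" using b ys(2) by simp
    from sat_inst[OF e ys(1) this] obtain e' where e': "asg M e'" "map e' ?ys = b"
      "\<And>v. v \<notin> set ?ys \<Longrightarrow> e' v = e v" "\<And>\<psi>. sat M e (inst ?ys b \<psi>) = sat M e' \<psi>" by blast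
    have "map e' (row_vars ss i) = map e (row_vars ss i)" using e'(3) disj by auto
    then show ?thesis unfolding e'(4) \<psi>(2)[OF e'(1)] map_append e'(2) by (simp only:)
  qed
  let ?\<chi> = "inst ?ys c \<psi>"
  have c': "c \<in> tuples M ?ys" using c ys(2) by (simp add: tuples_eq)
  have "?\<chi> \<in> Fml M (set (row_vars ss i @ ?ys) - set ?ys) ({} \<union> set c)"
    by (rule inst_Fml[OF \<psi>(1) c'])
  then have "?\<chi> \<in> Fml M (set (row_vars ss i)) (univ M)" using tup_univ[OF c] by (auto simp: Fml_def)
  moreover have "divides M A ?\<chi>"
    unfolding divides_def
  proof (intro exI conjI)
    show "\<psi> \<in> Fml M UNIV {}" using \<psi>(1) by (simp add: Fml_def)
    show "distinct ?ys" "c \<in> tuples M ?ys" by (fact ys(1), fact c')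
    show "\<forall>n. d n \<in> tuples M ?ys \<and> ltp M (d n) A = ltp M c A"
      using dt d ltp_same_type[OF c dt] ys(2) by (simp add: tuples_eq)
    show "k_inconsistent M k (\<lambda>n. inst ?ys (d n) \<psi>)"
      unfolding k_inconsistent_def
    proof (intro allI impI notI)
      fix S :: "nat set" assume S: "finite S \<and> card S = k"
      assume "consistent M ((\<lambda>n. inst ?ys (d n) \<psi>) ` S)"
      then obtain e where e: "asg M e" "\<forall>n\<in>S. sat M e (inst ?ys (d n) \<psi>)"
        by (auto simp: consistent_def)
      then have "\<forall>n\<in>S. R (map e (row_vars ss i) @ d n)" using inst[OF e(1) dt] by simp
      moreover have "map e (row_vars ss i) \<in> tup ss"
        using tup_asg[OF e(1), of "row_vars ss i"] by simp
      ultimately show False using k S by blast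
    qed
  qed simp
  ultimately have "eventually (\<lambda>e. \<not> sat M e ?\<chi>) U" by (rule U(2))
  with U(1) show ?thesis by eventually_elim (simp add: inst[OF _ c])
qed

text \<open>\<open>W\<close> is a limit of the global types of the rows: it contains every \<open>P\<close> that belongs to the type of
  the \<open>i\<close>-th row for all large \<open>i\<close>. A set in \<open>W\<close> then belongs to the type of infinitely many rows, and
  any \<open>k\<close> of these rows are inconsistent for \<open>\<Phi>\<close>; this is how \<open>W\<close> remembers the inconsistency of the
  sequence \<open>a\<close>, although it is the type of a single tuple.\<close>

lemma limit_type_exists:
  assumes a: "\<And>i::nat. a i \<in> tup ss" "\<And>i. same_type B (a 0) (a i)"
    and nf: "\<not> seq_tp_forks M A a B"
    and \<Phi>: "definable {} (xs @ ss) \<Phi>"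
    and k: "\<And>S. finite S \<Longrightarrow> card S = k \<Longrightarrow> \<not> (\<exists>x\<in>tup xs. \<forall>i\<in>S. \<Phi> (x @ a i))"
  obtains W where "global_type ss W" and "nondividing A ss W"
    and "\<And>R. definable B ss R \<Longrightarrow> R (a 0) \<Longrightarrow> eventually R W"
    and "\<And>P. eventually P W \<Longrightarrow>
      \<exists>hs. length hs = k \<and> (\<forall>h\<in>set hs. h \<in> tup ss \<and> P h) \<and> \<not> (\<exists>x\<in>tup xs. \<forall>h\<in>set hs. \<Phi> (x @ h))"
proof -
  obtain U where U: "ultra U" "eventually (asg M) U"
    and U_true: "\<And>l R. distinct l \<Longrightarrow> definable B (concat (replicate (length l) ss)) R \<Longrightarrow> R (concat (map a l)) \<Longrightarrow>
      eventually (\<lambda>e. R (concat (map (\<lambda>i. map e (row_vars ss i)) l))) U"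
    and U_div: "\<And>i \<chi>. \<chi> \<in> Fml M (set (row_vars ss i)) (univ M) \<Longrightarrow> divides M A \<chi> \<Longrightarrow>
      eventually (\<lambda>e. \<not> sat M e \<chi>) U"
    using rows_nonforking_ultrafilter[OF a(1) nf] by metis
  let ?row = "\<lambda>e i. map e (row_vars ss i)"
  let ?ev = "\<lambda>P. eventually (\<lambda>i. eventually (\<lambda>e. P (?row e i)) U) sequentially"
  have "\<exists>W. ultra W \<and> (\<forall>P\<in>{P. ?ev P}. eventually P W)"
  proof (rule ultra_fip)
    fix S0 assume S0: "finite S0" "S0 \<subseteq> {P. ?ev P}"
    then have "eventually (\<lambda>i. \<forall>P\<in>S0. eventually (\<lambda>e. P (?row e i)) U) sequentially"
      by (intro eventually_ball_finite) auto
    then obtain i where "\<forall>P\<in>S0. eventually (\<lambda>e. P (?row e i)) U"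
      using eventually_happens'[of sequentially] by fastforce
    then have "eventually (\<lambda>e. \<forall>P\<in>S0. P (?row e i)) U"
      using S0(1) by (intro eventually_ball_finite) auto
    from ultra_ex[OF U(1) this] show "\<exists>x. \<forall>P\<in>S0. P x" by blast
  qed
  then obtain W where W: "ultra W" "\<And>P. ?ev P \<Longrightarrow> eventually P W" by auto
  have row_tup: "?row e i \<in> tup ss" if "asg M e" for e i
    using tup_asg[OF that, of "row_vars ss i"] by simp
  have "eventually (\<lambda>e. ?row e i \<in> tup ss) U" for i using U(2) by eventually_elim (rule row_tup)
  then have "eventually (\<lambda>h. h \<in> tup ss) W" by (intro W(2)) simp
  then have gt: "global_type ss W" using W(1) by (simp add: global_type_def)
  moreover have "nondividing A ss W"
    unfolding nondividing_def
  proof (intro allI impI, elim conjE)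
    fix ts R c k and d :: "nat \<Rightarrow> 'm list"
    assume R: "definable {} (ss @ ts) R" "c \<in> tup ts" "\<forall>i. same_type A c (d i)"
      and S: "\<forall>S. finite S \<and> card S = k \<longrightarrow> \<not> (\<exists>h\<in>tup ss. \<forall>i\<in>S. R (h @ d i))"
    have "eventually (\<lambda>e. \<not> R (?row e i @ c)) U" for i
      using R(3) S by (intro row_nondividing[OF U(2) U_div R(1,2), where d = d and k = k]) blast+
    then show "eventually (\<lambda>h. \<not> R (h @ c)) W" by (intro W(2)) simp
  qed
  moreover have "eventually R W" if R: "definable B ss R" "R (a 0)" for R
  proof -
    have "eventually (\<lambda>e. R (?row e i)) U" for i
    proof -
      have "R (a i)" using same_typeD(2)[OF a(2) a(1) R(1)] R(2) by simp
      then show ?thesis using U_true[of "[i]" R] R(1) by simp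
    qed
    then show ?thesis by (intro W(2)) simp
  qed
  moreover have "\<exists>hs. length hs = k \<and> (\<forall>h\<in>set hs. h \<in> tup ss \<and> P h) \<and> \<not> (\<exists>x\<in>tup xs. \<forall>h\<in>set hs. \<Phi> (x @ h))"
    if P: "eventually P W" for P
  proof -
    let ?I = "{i. eventually (\<lambda>e. P (?row e i)) U}"
    \<comment> \<open>Otherwise \<open>\<not> P\<close> would belong to the type of all large rows, hence to \<open>W\<close>.\<close>
    have "infinite ?I"
    proof
      assume "finite ?I"
      then obtain n where n: "\<forall>i\<in>?I. i < n" using finite_nat_set_iff_bounded by blast
      have "eventually (\<lambda>e. \<not> P (?row e i)) U" if "i \<ge> n" for i
        using n that ultra_not[OF U(1), of "\<lambda>e. P (?row e i)"] by auto
      then have "eventually (\<lambda>h. \<not> P h) W" by (intro W(2)) (auto simp: eventually_sequentially)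
      then show False using P ultra_not[OF W(1), of P] by simp
    qed
    then obtain S where S: "S \<subseteq> ?I" "finite S" "card S = k"
      using infinite_arbitrarily_large by blast
    let ?l = "sorted_list_of_set S"
    have l: "distinct ?l" "length ?l = k" "set ?l = S" using S by simp_all
    let ?Q = "\<lambda>d. \<not> (\<exists>x\<in>tup xs. \<forall>i<k. \<Phi> (x @ take (length ss) (drop (i * length ss) d)) = True)"
    have "definable {} (concat (replicate k ss)) ?Q"
      by (intro definable_not definable_pattern[OF \<Phi>])
    then have Q: "definable B (concat (replicate (length ?l) ss)) ?Q"
      unfolding l(2) by (rule definable_mono) simp
    have Q_eq: "?Q (concat (map f ?l)) \<longleftrightarrow> \<not> (\<exists>x\<in>tup xs. \<forall>i\<in>S. \<Phi> (x @ f i))"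
      if "\<And>i. f i \<in> tup ss" for f
    proof -
      have "take (length ss) (drop (i * length ss) (concat (map f ?l))) = f (?l ! i)"
        if "i < k" for i
        using that l(2) tup_length[OF \<open>\<And>i. f i \<in> tup ss\<close>] by (subst block_concat) auto
      moreover have "(\<forall>i\<in>S. \<Phi> (x @ f i)) \<longleftrightarrow> (\<forall>i<k. \<Phi> (x @ f (?l ! i)))" for x
        using l by (metis in_set_conv_nth nth_mem)
      ultimately show ?thesis by auto
    qed
    have "?Q (concat (map a ?l))" using Q_eq[of a] a(1) k[OF S(2,3)] by simp
    from U_true[OF l(1) Q this] have "eventually (\<lambda>e. ?Q (concat (map (?row e) ?l))) U" .
    moreover have "eventually (\<lambda>e. \<forall>i\<in>S. P (?row e i)) U"
      using S(1,2) by (intro eventually_ball_finite) auto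
    ultimately have "eventually (\<lambda>e. asg M e \<and> (\<forall>i\<in>S. P (?row e i)) \<and> ?Q (concat (map (?row e) ?l))) U"
      using U(2) by eventually_elim blast
    from ultra_ex[OF U(1) this]
    obtain e where e: "asg M e" "\<forall>i\<in>S. P (?row e i)" "?Q (concat (map (?row e) ?l))"
      by (elim exE conjE) (rule that)
    have "\<not> (\<exists>x\<in>tup xs. \<forall>i\<in>S. \<Phi> (x @ ?row e i))" using Q_eq[OF row_tup[OF e(1)]] e(3) by simp
    then show ?thesis
      using e(2) row_tup[OF e(1)] l by (intro exI[of _ "map (?row e) ?l"]) auto
  qed
  ultimately show thesis by (rule that)
qed

end

section \<open>The Morley sequence\<close>

context monster
begin

text \<open>The approximations inside the members of \<open>W\<close> are turned by compactness into \<open>k\<close> realizations of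
  \<open>W\<close> over \<open>C\<close>. Of the joint type of these tuples only the inconsistency is known.\<close>

lemma inconsistent_row:
  assumes W: "global_type ss W" and \<Phi>: "definable {} (xs @ ss) \<Phi>"
    and approx: "\<And>P. eventually P W \<Longrightarrow>
      \<exists>hs. length hs = k \<and> (\<forall>h\<in>set hs. h \<in> tup ss \<and> P h) \<and> \<not> (\<exists>x\<in>tup xs. \<forall>h\<in>set hs. \<Phi> (x @ h))"
    and C: "small \<kappa> C" "C \<subseteq> univ M"
  shows "\<exists>hs. length hs = k \<and> (\<forall>h\<in>set hs. realizes W ss C h) \<and> \<not> (\<exists>x\<in>tup xs. \<forall>h\<in>set hs. \<Phi> (x @ h))"
proof -
  let ?b = "\<lambda>i d. take (length ss) (drop (i * length ss) d)"
  let ?Q = "\<lambda>d. \<not> (\<exists>x\<in>tup xs. \<forall>i<k. \<Phi> (x @ ?b i d) = True)"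
  let ?T = "{(i, R). i < k \<and> definable C ss R \<and> eventually R W}"
  let ?f = "\<lambda>(i, R) d. R (?b i d)"
  let ?F = "insert ?Q (?f ` ?T)"
  have b: "?b i (concat hs) = hs ! i" if "length hs = k" "\<forall>h\<in>set hs. h \<in> tup ss" "i < k" for hs i
    using that tup_length by (intro block_concat) auto
  have all: "(\<forall>i<k. P (?b i (concat hs))) \<longleftrightarrow> (\<forall>h\<in>set hs. P h)"
    if "length hs = k" "\<forall>h\<in>set hs. h \<in> tup ss" for hs P
    using b[OF that] that(1) by (metis in_set_conv_nth)
  have "\<exists>d\<in>tup (concat (replicate k ss)). \<forall>R\<in>?F. R d"
  proof (rule compactness[OF C])
    fix R assume "R \<in> ?F"
    then consider "R = ?Q" | i R' where "i < k" "definable C ss R'" "R = (\<lambda>d. R' (?b i d))" by blast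
    then show "definable C (concat (replicate k ss)) R"
    proof cases
      case 1
      have "definable {} (concat (replicate k ss)) ?Q"
        by (intro definable_not definable_pattern[OF \<Phi>])
      then show ?thesis unfolding 1 by (rule definable_mono) simp
    next
      case 2
      show ?thesis unfolding 2(3) by (rule definable_block[OF 2(2,1)])
    qed
  next
    fix F0 assume F0: "F0 \<subseteq> ?F" "finite F0"
    have "finite (F0 \<inter> ?f ` ?T)" "F0 \<inter> ?f ` ?T \<subseteq> ?f ` ?T" using F0(2) by auto
    from finite_subset_image[OF this] obtain T0
      where T0: "T0 \<subseteq> ?T" "finite T0" "F0 \<inter> ?f ` ?T = ?f ` T0"
      by blast
    let ?P = "\<lambda>h. \<forall>z\<in>T0. snd z h"
    have "eventually ?P W" using T0(1,2) by (intro eventually_ball_finite) auto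
    from approx[OF this] obtain hs
      where hs: "length hs = k" "\<forall>h\<in>set hs. h \<in> tup ss" "\<forall>h\<in>set hs. ?P h"
      "\<not> (\<exists>x\<in>tup xs. \<forall>h\<in>set hs. \<Phi> (x @ h))" by blast
    have "R (concat hs)" if R: "R \<in> F0" for R
    proof -
      consider "R = ?Q" | "R \<in> ?f ` T0" using R F0(1) T0(3) by blast
      then show ?thesis
      proof cases
        case 1
        have "(\<forall>i<k. \<Phi> (x @ ?b i (concat hs)) = True) \<longleftrightarrow> (\<forall>h\<in>set hs. \<Phi> (x @ h))" for x
          using all[OF hs(1,2), of "\<lambda>h. \<Phi> (x @ h)"] by simp
        then show ?thesis unfolding 1 using hs(4) by simp
      next
        case 2
        then obtain i R' where R': "(i, R') \<in> T0" "R = (\<lambda>d. R' (?b i d))" by auto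
        then have i: "i < k" using T0(1) by auto
        then have "R' (hs ! i)" using hs(1,3) R'(1) by fastforce
        then show ?thesis using b[OF hs(1,2) i] R'(2) by simp
      qed
    qed
    moreover have "concat hs \<in> tup (concat (replicate k ss))"
      using tup_concat[of hs ss] hs(1,2) by auto
    ultimately show "\<exists>d\<in>tup (concat (replicate k ss)). \<forall>R\<in>F0. R d" by blast
  qed
  then obtain d where d: "d \<in> tup (concat (replicate k ss))" "\<forall>R\<in>?F. R d" by blast
  obtain hs where hs: "length hs = k" "d = concat hs" "\<forall>h\<in>set hs. h \<in> tup ss"
    using tup_concat_split[OF d(1)] by blast
  have "realizes W ss C h" if h: "h \<in> set hs" for h
    unfolding realizes_def
  proof (intro conjI allI impI)
    show "h \<in> tup ss" using hs(3) h by blast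
    fix R assume R: "definable C ss R \<and> eventually R W"
    obtain i where i: "i < k" "hs ! i = h" using h hs(1) by (auto simp: in_set_conv_nth)
    then have "(i, R) \<in> ?T" using R by simp
    then have "?f (i, R) \<in> ?F" by (rule insertI2[OF imageI])
    with d(2) have "?f (i, R) d" by (rule bspec)
    then show "R h" using b[OF hs(1,3) i(1)] i(2) hs(2) by simp
  qed
  moreover have "\<not> (\<exists>x\<in>tup xs. \<forall>h\<in>set hs. \<Phi> (x @ h))"
  proof -
    have "?Q d" using d(2) by (rule bspec[OF _ insertI1])
    then have Q: "?Q (concat hs)" unfolding hs(2) .
    have eqx: "(\<forall>i<k. \<Phi> (x @ ?b i (concat hs)) = True) \<longleftrightarrow> (\<forall>h\<in>set hs. \<Phi> (x @ h))" for x
      using all[OF hs(1,3), of "\<lambda>h. \<Phi> (x @ h)"] by simp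
    show ?thesis using Q unfolding eqx .
  qed
  ultimately show ?thesis using hs(1) by blast
qed

end

context nip_monster
begin

text \<open>The sequence starts out as the first elements of the rows \<open>H\<^sub>n\<close>, each of
  which consists of \<open>k\<close> realizations of \<open>W\<close> that are inconsistent for \<open>\<Phi>\<close>. Any choice of one element
  per row is a Morley sequence of \<open>W\<close>, and this freedom contradicts bounded alternation if
  the first elements are consistent.\<close>

theorem morley_sequence_exists:
  assumes AB: "A \<subseteq> B" and B: "B \<subseteq> univ M" "small \<kappa> B"
    and a: "\<And>i::nat. a i \<in> tup ss" "\<And>i. same_type B (a 0) (a i)"
    and nf: "\<not> seq_tp_forks M A a B"
    and \<Phi>: "definable {} (xs @ ss) \<Phi>"
    and k: "\<And>S. finite S \<Longrightarrow> card S = k \<Longrightarrow> \<not> (\<exists>x\<in>tup xs. \<forall>i\<in>S. \<Phi> (x @ a i))"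
  obtains a' where "morley_sequence M B A a'" and "a' 0 = a 0" and "\<And>i. a' i \<in> tup ss"
    and "\<not> (\<exists>x\<in>tup xs. \<forall>i. \<Phi> (x @ a' i))"
proof -
  obtain W where W: "global_type ss W" "nondividing A ss W"
    and W_B: "\<And>R. definable B ss R \<Longrightarrow> R (a 0) \<Longrightarrow> eventually R W"
    and approx: "\<And>P. eventually P W \<Longrightarrow>
      \<exists>hs. length hs = k \<and> (\<forall>h\<in>set hs. h \<in> tup ss \<and> P h) \<and> \<not> (\<exists>x\<in>tup xs. \<forall>h\<in>set hs. \<Phi> (x @ h))"
    using limit_type_exists[OF a nf \<Phi> k] by blast
  obtain N where N: "B \<subseteq> N" "N \<subseteq> univ M" "small \<kappa> N"
    and TV: "\<And>ss R. definable N ss R \<Longrightarrow> \<exists>d\<in>tup ss. R d \<Longrightarrow> \<exists>d\<in>tup ss. set d \<subseteq> N \<and> R d"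
    using small_model[OF B] by blast
  have AN: "A \<subseteq> N" using AB N(1) by blast
  have inv: "invariant W ss N" by (rule nondividing_invariant[OF W AN N(2,3) TV])
  let ?P = "\<lambda>C hs. length hs = k \<and> (\<forall>h\<in>set hs. realizes W ss C h) \<and>
    \<not> (\<exists>x\<in>tup xs. \<forall>h\<in>set hs. \<Phi> (x @ h))"
  let ?s = "\<lambda>hs. set (concat hs)"
  have "\<exists>H :: nat \<Rightarrow> 'm list list. \<forall>n. ?P (N \<union> (\<Union>j<n. ?s (H j))) (H n)"
  proof (rule sequence_exists[OF N(3,2)]; intro allI impI)
    show "\<exists>hs. ?P C hs" if "small \<kappa> C \<and> C \<subseteq> univ M" for C
      by (rule inconsistent_row[OF W(1) \<Phi> approx]) (use that in auto)
    show "finite (?s hs) \<and> ?s hs \<subseteq> univ M" if "?P C hs" for C hs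
      using that realizes_tup tup_univ by fastforce
  qed
  then obtain H :: "nat \<Rightarrow> 'm list list" where "\<forall>n. ?P (N \<union> (\<Union>j<n. ?s (H j))) (H n)" ..
  then have H: "length (H n) = k" "h \<in> set (H n) \<Longrightarrow> realizes W ss (N \<union> (\<Union>j<n. ?s (H j))) h"
    "\<not> (\<exists>x\<in>tup xs. \<forall>h\<in>set (H n). \<Phi> (x @ h))" for n h by blast+
  \<comment> \<open>For \<open>k = 0\<close> the inconsistency would be that of the empty set of formulas.\<close>
  have "tup xs \<noteq> {}"
  proof -
    obtain e where "asg M e" using asg_exists[of "[]" "[]"] by auto
    then show ?thesis using tup_asg[of e "tuple_vars xs"] by auto
  qed
  then have "k > 0" using H(1,3)[of 0] by fastforce
  \<comment> \<open>The rows before the \<open>n\<close>-th are parameters of its realizations, whichever elements are chosen.\<close>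
  have path: "morley_seq W ss N p" if "\<And>n. p n \<in> set (H n)" for p
    unfolding morley_seq_def
  proof
    fix n
    have "(\<Union>j<n. set (p j)) \<subseteq> (\<Union>j<n. ?s (H j))" using that by fastforce
    then show "realizes W ss (N \<union> (\<Union>j<n. set (p j))) (p n)"
      by (intro realizes_mono[OF H(2)[OF that[of n]]]) auto
  qed
  let ?c = "\<lambda>n. H n ! 0"
  have cH: "?c n \<in> set (H n)" for n using H(1)[of n] \<open>k > 0\<close> by simp
  note c = path[OF cH]
  have ct: "?c n \<in> tup ss" for n using realizes_tup[OF H(2)[OF cH]] .
  have incons: "\<not> (\<exists>x\<in>tup xs. \<forall>n. \<Phi> (x @ ?c n))"
  proof
    assume "\<exists>x\<in>tup xs. \<forall>n. \<Phi> (x @ ?c n)"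
    then obtain x where x: "x \<in> tup xs" "\<And>n. \<Phi> (x @ ?c n)" by blast
    have "\<forall>n. \<exists>h\<in>set (H n). \<not> \<Phi> (x @ h)" using H(3) x(1) by blast
    then obtain f where f: "\<And>n. f n \<in> set (H n)" "\<And>n. \<not> \<Phi> (x @ f n)" by metis
    \<comment> \<open>By the choice of \<open>f\<close>, \<open>\<Phi>(x, -)\<close> holds exactly at the even places of this Morley sequence.\<close>
    let ?d = "\<lambda>n. if even n then ?c n else f n"
    have dH: "?d n \<in> set (H n)" for n using cH f(1) by simp
    have "indiscernible M N ?d" by (rule morley_seq_indiscernible[OF W(1) inv N(2) path[OF dH]])
    then have "indiscernible M {} ?d" by (rule indiscernible_mono) simp
    moreover have "?d n \<in> tup ss" for n using realizes_tup[OF H(2)[OF dH]] .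
    ultimately obtain l where "\<exists>i<l. \<Phi> (x @ ?d i) \<noteq> even i"
      using bounded_alternation[OF \<Phi>, of ?d] x(1) by blast
    then show False using x(2) f(2) by auto
  qed
  have "same_type B (?c 0) (a 0)"
  proof (rule same_type_sym, rule same_typeI[OF a(1) ct])
    fix R assume R: "definable B ss R"
    have r: "realizes W ss B (?c 0)" using H(2)[OF cH, of 0] N(1) by (auto elim: realizes_mono)
    have "R (?c 0) = eventually R W" by (rule realizes_iff[OF W(1) r R])
    moreover have "R (a 0) = eventually R W"
    proof (cases "R (a 0)")
      case True
      then show ?thesis using W_B[OF R] by simp
    next
      case False
      then have "eventually (\<lambda>h. \<not> R h) W" by (rule W_B[OF definable_not[OF R]])
      then show ?thesis using False W(1) ultra_not[of W R] by (simp add: global_type_def)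
    qed
    ultimately show "R (a 0) = R (?c 0)" by simp
  qed
  \<comment> \<open>Along with \<open>c\<close>, the ultrafilter \<open>W\<close> is moved by \<open>g\<close>, so that the images again do not fork over \<open>A\<close>.\<close>
  then obtain g where g: "automorphism M g" and fixes_B: "\<And>b. b \<in> B \<Longrightarrow> g b = b" and g0: "map g (?c 0) = a 0"
    using automorphism_exists[OF B] by metis
  let ?a = "\<lambda>n. map g (?c n)"
  have fixes_A: "\<And>b. b \<in> A \<Longrightarrow> g b = b" using fixes_B AB by blast
  have gB: "g ` B = B" using fixes_B by force
  let ?W = "filtermap (map g) W"
  have W': "global_type ss ?W" "nondividing A ss ?W"
    by (rule global_type_automorphism[OF g W(1)], rule nondividing_automorphism[OF g fixes_A W])
  have at: "?a n \<in> tup ss" for n by (rule automorphism_tup[OF g ct])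
  have "\<not> ltp_forks M A (?a n) (B \<union> (\<Union>j<n. set (?a j)))" for n
  proof (rule realizes_not_forks[OF W'])
    have "realizes W ss (B \<union> (\<Union>j<n. set (?c j))) (?c n)"
      using c N(1) unfolding morley_seq_def by (blast intro: realizes_mono)
    moreover have "B \<union> (\<Union>j<n. set (?c j)) \<subseteq> univ M" using B(1) tup_univ[OF ct] by blast
    ultimately have "realizes ?W ss (g ` (B \<union> (\<Union>j<n. set (?c j)))) (?a n)"
      by (rule realizes_automorphism[OF g W(1)])
    moreover have "g ` (B \<union> (\<Union>j<n. set (?c j))) = B \<union> (\<Union>j<n. set (?a j))"
      unfolding image_Un gB by (simp add: image_UN)
    ultimately show "realizes ?W ss (B \<union> (\<Union>j<n. set (?a j))) (?a n)" by simp
    show "small \<kappa> (B \<union> (\<Union>j<n. set (?a j)))" using B(2) by (simp add: small_Un small_finite)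
    show "B \<union> (\<Union>j<n. set (?a j)) \<subseteq> univ M" using B(1) tup_univ[OF at] by blast
  qed
  moreover have "indiscernible M B ?a"
  proof -
    have au: "set (?a n) \<subseteq> univ M" and cu: "set (?c n) \<subseteq> univ M" for n
      using tup_univ[OF at] tup_univ[OF ct] by blast+
    have "indiscernible M B ?c"
      using morley_seq_indiscernible[OF W(1) inv N(2) c] N(1) by (rule indiscernible_mono)
    note cind = this[unfolded indiscernible_iff[of ?c, OF cu], rule_format]
    have ca: "same_type B (concat (map ?c l)) (concat (map ?a l))" for l
    proof -
      have "concat (map ?c l) \<in> tup (concat (replicate (length l) ss))"
        using tup_concat[of "map ?c l" ss] ct by auto
      from automorphism_same_type[OF g fixes_B this] show ?thesis by (simp add: map_concat comp_def)
    qed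
    show ?thesis
      unfolding indiscernible_iff[of ?a, OF au]
    proof (intro allI impI)
      fix l l' :: "nat list" assume "length l = length l' \<and> sorted_wrt (<) l \<and> sorted_wrt (<) l'"
      then have "same_type B (concat (map ?c l)) (concat (map ?c l'))" by (intro cind) auto
      from same_type_trans[OF same_type_sym[OF ca] same_type_trans[OF this ca]]
      show "same_type B (concat (map ?a l)) (concat (map ?a l'))" .
    qed
  qed
  ultimately have "morley_sequence M B A ?a" using AB by (simp add: morley_sequence_def)
  moreover have "\<not> (\<exists>x\<in>tup xs. \<forall>n. \<Phi> (x @ ?a n))"
  proof
    assume "\<exists>x\<in>tup xs. \<forall>n. \<Phi> (x @ ?a n)"
    then obtain x where x: "x \<in> tup xs" "\<And>n. \<Phi> (x @ ?a n)" by blast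
    obtain y where y: "y \<in> tup xs" "map g y = x" using automorphism_preimage[OF g x(1)] .
    have "\<Phi> (y @ ?c n)" for n
      using automorphism_definable[OF g \<Phi> tup_append[OF y(1) ct]] x(2)[of n] y(2) by simp
    then show False using incons y(1) by blast
  qed
  ultimately show thesis using that[of ?a] g0 at by blast
qed

end

theorem theorem4p8:
  fixes M :: "('s, 'f, 'r, 'm) struct"
    and T :: "('s, 'f, 'r, 'm) fm set"
    and \<kappa> :: "'k rel"
    and A :: "'m set"
    and \<phi> :: "('s, 'f, 'r, 'm) fm"
    and xs ys :: "'s var list"
  assumes "complete_theory M T"
    and "monster_model \<kappa> M T"
    and "eq_closed M"
    and "dependent M"
    and "A \<subseteq> univ M" and "small \<kappa> A"
    and "distinct (xs @ ys)" and "\<phi> \<in> Fml M (set xs \<union> set ys) {}"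
  shows
    "(\<forall>a :: nat \<Rightarrow> 'm list.
        (\<forall>i. a i \<in> tuples M ys) \<and>
        indiscernible M A a \<and>
        \<not> consistent M (range (\<lambda>i. inst ys (a i) \<phi>)) \<and>
        \<not> seq_tp_forks M A a A \<longrightarrow>
        (\<exists>a' :: nat \<Rightarrow> 'm list.
           morley_sequence M A A a' \<and> a' 0 = a 0 \<and>
           \<not> consistent M (range (\<lambda>i. inst ys (a' i) \<phi>))))
     \<and>
     (\<forall>(J :: 'j set) (b :: 'j \<Rightarrow> 'm) (a :: nat \<Rightarrow> 'm list).
        small \<kappa> J \<and> b ` J \<subseteq> univ M \<and>
        (\<forall>i. a i \<in> tuples M ys) \<and>
        indiscernible M (A \<union> b ` J) a \<and>
        (\<exists>k. k_inconsistent M k (\<lambda>i. inst ys (a i) \<phi>)) \<and>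
        \<not> seq_tp_forks M A a (A \<union> b ` J) \<longrightarrow>
        (\<exists>a' :: nat \<Rightarrow> 'm list.
           morley_sequence M (A \<union> b ` J) A a' \<and> a' 0 = a 0 \<and>
           \<not> consistent M (range (\<lambda>i. inst ys (a' i) \<phi>))))"
proof -
  have mm: "Card_order \<kappa>" "small \<kappa> (Fml M UNIV {})" "is_structure M" "saturated \<kappa> M"
    "strongly_homogeneous \<kappa> M"
    using assms(2) by (auto simp: monster_model_def models_def)
  interpret nip_monster M \<kappa>
    using mm assms(4) by unfold_locales
  let ?xs = "map fst xs" and ?ss = "map fst ys"
  note A = assms(5,6) and dist = assms(7) and \<phi> = assms(8)
  have ys: "distinct ys" and disj: "set xs \<inter> set ys = {}" using dist by auto
  have "\<forall>v. \<exists>i. v \<in> set (xs @ ys) \<longrightarrow> i < length (xs @ ys) \<and> (xs @ ys) ! i = v"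
    by (metis in_set_conv_nth)
  then obtain r where r: "\<And>v. v \<in> set (xs @ ys) \<Longrightarrow> r v < length (xs @ ys) \<and> (xs @ ys) ! r v = v"
    by metis
  let ?\<Phi> = "\<lambda>z. sat M (\<lambda>v. z ! r v) \<phi>"
  have fv: "fv \<phi> \<subseteq> set (xs @ ys)" using \<phi> by (simp add: Fml_def)
  have \<Phi>: "definable {} (?xs @ ?ss) ?\<Phi>"
  proof (rule definable_sat)
    fix v assume "v \<in> fv \<phi>"
    then have "r v < length (xs @ ys)" "(xs @ ys) ! r v = v" using r fv by blast+
    then have "r v < length (map fst (xs @ ys))" "map fst (xs @ ys) ! r v = fst v"
      by (simp_all only: length_map nth_map)
    then show "r v < length (?xs @ ?ss) \<and> (?xs @ ?ss) ! r v = fst v" by simp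
  qed (use \<phi> in \<open>auto simp: Fml_def\<close>)
  have sat_\<Phi>: "sat M e \<phi> = ?\<Phi> (map e (xs @ ys))" for e
    using r fv by (intro sat_cong) (metis length_map nth_map subsetD)
  have cons: "consistent M ((\<lambda>i. inst ys (c i) \<phi>) ` S) \<longleftrightarrow> (\<exists>x\<in>tup ?xs. \<forall>i\<in>S. ?\<Phi> (x @ c i))"
    if c: "\<And>i::nat. c i \<in> tup ?ss" for c S
  proof -
    have eq: "sat M e (inst ys (c i) \<phi>) = ?\<Phi> (map e xs @ c i)" if e: "asg M e" for e i
    proof -
      obtain e' where e': "map e' ys = c i" "\<And>v. v \<notin> set ys \<Longrightarrow> e' v = e v"
        "\<And>\<psi>. sat M e (inst ys (c i) \<psi>) = sat M e' \<psi>" using sat_inst[OF e ys c] by metis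
      have "map e' xs = map e xs" using e'(2) disj by auto
      then show ?thesis unfolding e'(3) sat_\<Phi>[of e'] map_append e'(1) by (simp only:)
    qed
    show ?thesis
    proof
      assume "consistent M ((\<lambda>i. inst ys (c i) \<phi>) ` S)"
      then obtain e where e: "asg M e" "\<forall>i\<in>S. sat M e (inst ys (c i) \<phi>)"
        by (auto simp: consistent_def)
      then show "\<exists>x\<in>tup ?xs. \<forall>i\<in>S. ?\<Phi> (x @ c i)" using eq tup_asg[of e xs] by blast
    next
      assume "\<exists>x\<in>tup ?xs. \<forall>i\<in>S. ?\<Phi> (x @ c i)"
      then obtain x where x: "x \<in> tup ?xs" "\<forall>i\<in>S. ?\<Phi> (x @ c i)" by blast
      obtain e where "asg M e" "map e xs = x" using asg_exists[OF _ x(1)] dist by auto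
      then show "consistent M ((\<lambda>i. inst ys (c i) \<phi>) ` S)"
        using x(2) eq by (auto simp: consistent_def)
    qed
  qed
  \<comment> \<open>In both halves \<open>B\<close> is the set over which the sequence is indiscernible.\<close>
  have main: "\<exists>a'. morley_sequence M B A a' \<and> a' 0 = a 0 \<and> \<not> consistent M (range (\<lambda>i. inst ys (a' i) \<phi>))"
    if AB: "A \<subseteq> B" and B: "B \<subseteq> univ M" "small \<kappa> B" and a: "\<And>i. a i \<in> tup ?ss"
      and ind: "indiscernible M B a" and k: "k_inconsistent M k (\<lambda>i. inst ys (a i) \<phi>)"
      and nf: "\<not> seq_tp_forks M A a B"
    for B k a
  proof -
    have au: "set (a i) \<subseteq> univ M" for i using tup_univ[OF a] .
    have same: "same_type B (a 0) (a i)" for i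
      using ind[unfolded indiscernible_iff[of a, OF au], rule_format, of "[0]" "[i]"] by simp
    have "\<not> (\<exists>x\<in>tup ?xs. \<forall>i\<in>S. ?\<Phi> (x @ a i))" if "finite S" "card S = k" for S
      using k that cons[of a, OF a] by (simp add: k_inconsistent_def)
    from morley_sequence_exists[OF AB B a same nf \<Phi> this] obtain a' where
      "morley_sequence M B A a'" "a' 0 = a 0" "\<And>i. a' i \<in> tup ?ss" "\<not> (\<exists>x\<in>tup ?xs. \<forall>i. ?\<Phi> (x @ a' i))"
      by blast
    then show ?thesis using cons[of a' UNIV] by auto
  qed
  show ?thesis
  proof (intro conjI allI impI; elim conjE)
    fix a :: "nat \<Rightarrow> 'm list"
    assume a: "\<forall>i. a i \<in> tuples M ys" and ind: "indiscernible M A a"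
      and inc: "\<not> consistent M (range (\<lambda>i. inst ys (a i) \<phi>))" and nf: "\<not> seq_tp_forks M A a A"
    have at: "a i \<in> tup ?ss" for i using a by (simp add: tuples_eq)
    let ?f = "\<lambda>i x. ?\<Phi> (x @ a i)"
    \<comment> \<open>By compactness some finite part is inconsistent, and indiscernibility carries this over to
      all parts of the same size.\<close>
    have "\<exists>F0\<subseteq>range ?f. finite F0 \<and> \<not> (\<exists>x\<in>tup ?xs. \<forall>R\<in>F0. R x)"
    proof (rule ccontr)
      assume no: "\<not> ?thesis"
      let ?C = "\<Union>i. set (a i)"
      have "\<exists>x\<in>tup ?xs. \<forall>R\<in>range ?f. R x"
      proof (rule compactness)
        show "small \<kappa> ?C" by (rule small_countable) simp
        show "?C \<subseteq> univ M" using tup_univ[OF at] by blast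
        show "definable ?C ?xs R" if "R \<in> range ?f" for R
        proof -
          from that obtain i where "R = ?f i" by blast
          moreover have "definable ?C ?xs (?f i)"
            by (rule definable_mono[OF definable_section[OF \<Phi> at]]) auto
          ultimately show ?thesis by simp
        qed
      qed (use no in blast)
      then show False using inc cons[of a UNIV, OF at] by auto
    qed
    then obtain F0 where F0: "finite F0" "F0 \<subseteq> range ?f" "\<not> (\<exists>x\<in>tup ?xs. \<forall>R\<in>F0. R x)" by blast
    from finite_subset_image[OF F0(1,2)] obtain I where "finite I" "F0 = ?f ` I" by blast
    then have I: "finite I" "\<not> (\<exists>x\<in>tup ?xs. \<forall>i\<in>I. ?\<Phi> (x @ a i))" using F0(3) by auto
    have "k_inconsistent M (card I) (\<lambda>i. inst ys (a i) \<phi>)"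
      unfolding k_inconsistent_def cons[of a, OF at]
    proof (intro allI impI notI)
      fix S :: "nat set" assume S: "finite S \<and> card S = card I"
        and ex: "\<exists>x\<in>tup ?xs. \<forall>i\<in>S. ?\<Phi> (x @ a i)"
      let ?l = "sorted_list_of_set"
      have l: "sorted_wrt (<) (?l S)" "sorted_wrt (<) (?l I)" "length (?l I) = length (?l S)"
        using S I(1) by (simp_all add: strict_sorted_list_of_set)
      have "indiscernible M {} a" using ind by (rule indiscernible_mono) simp
      moreover have "\<exists>x\<in>tup ?xs. \<forall>i<length (?l S). ?\<Phi> (x @ a (?l S ! i)) = True"
        using ex S by (metis nth_mem set_sorted_list_of_set)
      ultimately have "\<exists>x\<in>tup ?xs. \<forall>i<length (?l S). ?\<Phi> (x @ a (?l I ! i)) = True"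
        by (intro indiscernible_pattern[OF \<Phi> at _ l])
      then show False using I l(3) by (metis in_set_conv_nth set_sorted_list_of_set)
    qed
    from main[OF subset_refl A at ind this nf]
    show "\<exists>a'. morley_sequence M A A a' \<and> a' 0 = a 0 \<and> \<not> consistent M (range (\<lambda>i. inst ys (a' i) \<phi>))" .
  next
    fix J :: "'j set" and b :: "'j \<Rightarrow> 'm" and a :: "nat \<Rightarrow> 'm list"
    assume "small \<kappa> J" "b ` J \<subseteq> univ M" and a: "\<forall>i. a i \<in> tuples M ys"
      and ind: "indiscernible M (A \<union> b ` J) a"
      and k: "\<exists>k. k_inconsistent M k (\<lambda>i. inst ys (a i) \<phi>)"
      and nf: "\<not> seq_tp_forks M A a (A \<union> b ` J)"
    have B: "A \<union> b ` J \<subseteq> univ M" using A \<open>b ` J \<subseteq> univ M\<close> by blast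
    have small: "small \<kappa> (A \<union> b ` J)" using A \<open>small \<kappa> J\<close> by (simp add: small_Un small_image)
    have at: "a i \<in> tup ?ss" for i using a by (simp add: tuples_eq)
    obtain l where l: "k_inconsistent M l (\<lambda>i. inst ys (a i) \<phi>)" using k ..
    from main[OF Un_upper1 B small at ind l nf]
    show "\<exists>a'. morley_sequence M (A \<union> b ` J) A a' \<and> a' 0 = a 0 \<and>
        \<not> consistent M (range (\<lambda>i. inst ys (a' i) \<phi>))" .
  qed
qed

end
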